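(* Let $n\ge 1$, let $V=\mathbb{C}^n$ be the permutation representation of the symmetric group $\mathfrak{S}_n$, and let $\mathcal{H}c_n=\mathcal{C}l_n\rtimes\mathbb{C}\mathfrak{S}_n$ be the Hecke-Clifford superalgebra. Let $\xi$ be a strict partition of $n$, let $D^\xi$ be the irreducible $\mathcal{H}c_n$-module labeled by $\xi$, and let $Q_\xi$ be the Schur $Q$-function. Define the formal power series in $t,s$ $$\widehat d_\xi(t,s)=\sum_{i\ge 0}\sum_{j=0}^{n} t^i s^j\,\dim\operatorname{Hom}_{\mathcal{H}c_n}\big(D^\xi,\ \mathcal{C}l_n\otimes S^iV\otimes\wedge^jV\big),$$ $$\widetilde d_\xi(t,s)=\sum_{i,j\ge 0} t^i s^j\,\dim\operatorname{Hom}_{\mathcal{H}c_n}\big(D^\xi,\ \mathcal{C}l_n\otimes S^iV\otimes S^jV\big).$$ Then: (1) $\widehat d_\xi(t,s)=2^{-\frac{\ell(\xi)-\delta(\xi)}{2}}\,Q_\xi(t^\bullet,st^\bullet)$, where $(t^\bullet,st^\bullet)$ denotes the specialization of the variables of $Q_\xi$ to the family $\{t^j\}_{j\ge 0}\cup\{st^j\}_{j\ge 0}$; (2) $\widetilde d_\xi(t,s)=2^{-\frac{\ell(\xi)-\delta(\xi)}{2}}\,Q_\xi(t^\bullet s^\bullet)$, where $t^\bullet s^\bullet$ denotes the specialization of the variables of $Q_\xi$ to the family $\{t^js^k\}_{j,k\ge 0}$.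
   Context: All algebras are over $\mathbb{C}$. A strict partition is a partition with distinct nonzero parts; $\ell(\xi)$ is the number of nonzero parts; $\delta(\xi)=0$ if $\ell(\xi)$ is even and $\delta(\xi)=1$ if $\ell(\xi)$ is odd. **Hecke-Clifford algebra.** The Clifford superalgebra $\mathcal{C}l_n$ is generated by odd elements $c_1,\dots,c_n$ with $c_i^2=1$ and $c_ic_j=-c_jc_i$ for $i\ne j$. The group $\mathfrak{S}_n$ acts on it by permuting the $c_i$, and $\mathcal{H}c_n=\mathcal{C}l_n\rtimes\mathbb{C}\mathfrak{S}_n$ is the semidirect product, with $\sigma c_i=c_{\sigma(i)}\sigma$ for $\sigma\in\mathfrak{S}_n$. It is a superalgebra with each $\sigma\in \mathfrak{S}_n$ even and each $c_i$ odd. All modules over a superalgebra are $\mathbb{Z}_2$-graded, and $\operatorname{Hom}_{\mathcal{H}c_n}(M,N)$ consists of all homomorphisms, both even and odd (an odd homogeneous $f$ satisfies $f(am)=(-1)^{|f||a|}a f(m)$); $\dim$ is the total dimension. Isomorphisms of modules are allowed to be odd. **Modules $\mathcal{C}l_n\otimes M$.** For an $\mathfrak{S}_n$-module $M$ (regarded as purely even), $\mathcal{H}c_n$ acts on $\mathcal{C}l_n\otimes M$: $\mathcal{C}l_n$ acts by left multiplication on the first factor, and $\mathfrak{S}_n$ acts diagonally (acting on $\mathcal{C}l_n$ by permuting the $c_i$). $S^iV$ and $\wedge^jV$ are the $i$th symmetric and $j$th exterior powers of $V$ with their natural $\mathfrak{S}_n$-actions. **Schur $Q$-functions.** Define symmetric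 functions $q_r$ in variables $x=\{x_1,x_2,\dots\}$ by $Q(u)=\sum_{r\ge 0}q_r(x)u^r=\prod_i\frac{1+ux_i}{1-ux_i}$. Set $Q_\emptyset=1$, $Q_{(r)}=q_r$, and define $Q_{(r,s)}$ by $$\sum_{r,s\ge 0}Q_{(r,s)}u_1^ru_2^s=(Q(u_1)Q(u_2)-1)\frac{u_1-u_2}{u_1+u_2}.$$ For a strict partition $\lambda=(\lambda_1,\dots,\lambda_m)$ with $m\ge 3$ define recursively $$Q_\lambda=\sum_{j=2}^m(-1)^jQ_{(\lambda_1,\lambda_j)}Q_{(\lambda_2,\dots,\widehat{\lambda_j},\dots,\lambda_m)}\ (m\text{ even}),\qquad Q_\lambda=\sum_{j=1}^m(-1)^{j-1}Q_{(\lambda_j)}Q_{(\lambda_1,\dots,\widehat{\lambda_j},\dots,\lambda_m)}\ (m\text{ odd}),$$ where the hat means omission. **The irreducible modules $D^\xi$.** The algebra $\mathcal{H}c_n$ is semisimple, and its irreducible modules, up to isomorphism, are labeled by strict partitions of $n$ as follows. For a finite-dimensional $\mathcal{H}c_n$-module $M$ let $$\operatorname{ch}^-(M)=\sum_{\alpha}z_\alpha^{-1}\,\operatorname{tr}(\sigma_\alpha|_M)\,p_\alpha,$$ where $\alpha$ runs over partitions of $n$ with all parts odd, $\sigma_\alpha\in\mathfrak{S}_n$ is any permutation of cycle type $\alpha$, $\operatorname{tr}$ is the ordinary trace, $p_\alpha$ is the power-sum symmetric function, and $z_\alpha=\prod_i i^{m_i}m_i!$ with $m_i$ the number of parts of $\alpha$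 equal to $i$. Then $D^\xi$ is the irreducible $\mathcal{H}c_n$-module, unique up to isomorphism, with $\operatorname{ch}^-(D^\xi)=2^{-\frac{\ell(\xi)-\delta(\xi)}{2}}Q_\xi$ (existence and uniqueness, and the fact that the $D^\xi$ exhaust the irreducible modules, are a known theorem of Józefiak). *)

theory Defs
  imports
    Complex_Main
    "HOL-Library.Function_Algebras"
    "HOL-Library.Multiset"
    "HOL-Library.Nat_Bijection"
    "HOL-Combinatorics.Permutations"
    "HOL-Combinatorics.Orbits"
    "HOL-Computational_Algebra.Formal_Power_Series"
begin

section \<open>Formal power series in infinitely many variables; symmetric functions\<close>

text \<open>A monomial in variables indexed by \<^typ>\<open>'x\<close> is the multiset of its variables; a formal
  series of possibly infinite support assigns a coefficient to every monomial.\<close>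

typedef 'x mfps = "UNIV :: ('x multiset \<Rightarrow> complex) set"
  morphisms mcoeff Mfps
  by simp

setup_lifting type_definition_mfps

lemma mfps_eqI: "(\<And>m. mcoeff f m = mcoeff g m) \<Longrightarrow> f = g"
  by (metis ext mcoeff_inject)

lemma finite_submultisets: "finite {a. a \<subseteq># (m :: 'x multiset)}"
proof (induction m)
  case empty
  then show ?case by simp
next
  case (add x m)
  have "{a. a \<subseteq># add_mset x m} \<subseteq> {a. a \<subseteq># m} \<union> add_mset x ` {a. a \<subseteq># m}"
  proof
    fix a assume "a \<in> {a. a \<subseteq># add_mset x m}"
    hence a: "a \<subseteq># add_mset x m" by simp
    show "a \<in> {a. a \<subseteq># m} \<union> add_mset x ` {a. a \<subseteq># m}"
    proof (cases "x \<in># a")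
      case True
      then obtain b where b: "a = add_mset x b" by (meson multi_member_split)
      with a have "b \<subseteq># m" by simp
      with b show ?thesis by blast
    next
      case False
      with a have "a \<subseteq># m"
        by (metis diff_single_trivial subset_eq_diff_conv add_mset_add_single)
      thus ?thesis by blast
    qed
  qed
  with add show ?case by (meson finite_UnI finite_imageI finite_subset)
qed

lemma finite_multiset_splits: "finite {(a, b). a + b = (m :: 'x multiset)}"
proof -
  have "{(a, b). a + b = m} \<subseteq> {a. a \<subseteq># m} \<times> {a. a \<subseteq># m}" by auto
  thus ?thesis by (rule finite_subset) (simp add: finite_submultisets)
qed

instantiation mfps :: (type) comm_ring_1
begin

lift_definition zero_mfps :: "'a mfps" is "\<lambda>m. 0" .
lift_definition one_mfps :: "'a mfps" is "\<lambda>m. if m = {#} then 1 else 0" .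
lift_definition plus_mfps :: "'a mfps \<Rightarrow> 'a mfps \<Rightarrow> 'a mfps" is "\<lambda>f g m. f m + g m" .
lift_definition minus_mfps :: "'a mfps \<Rightarrow> 'a mfps \<Rightarrow> 'a mfps" is "\<lambda>f g m. f m - g m" .
lift_definition uminus_mfps :: "'a mfps \<Rightarrow> 'a mfps" is "\<lambda>f m. - f m" .
lift_definition times_mfps :: "'a mfps \<Rightarrow> 'a mfps \<Rightarrow> 'a mfps"
  is "\<lambda>f g m. \<Sum>(a, b) | a + b = m. f a * g b" .

instance
proof
  fix f g h :: "'a mfps"
  show "f * g * h = f * (g * h)"
  proof (rule mfps_eqI)
    fix m
    have "mcoeff (f * g * h) m =
        (\<Sum>(c, d) | c + d = m. \<Sum>(a, b) | a + b = c. mcoeff f a * mcoeff g b * mcoeff h d)"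
      by (simp add: times_mfps.rep_eq sum_distrib_right split_def)
    also have "\<dots> = (\<Sum>(p, q) \<in> (SIGMA p:{(c, d). c + d = m}. {(a, b). a + b = fst p}).
        mcoeff f (fst q) * mcoeff g (snd q) * mcoeff h (snd p))"
      by (subst sum.Sigma[symmetric])
         (auto simp: finite_multiset_splits[unfolded split_def] split_def)
    also have "\<dots> = (\<Sum>(p, q) \<in> (SIGMA p:{(c, d). c + d = m}. {(a, b). a + b = snd p}).
        mcoeff f (fst p) * mcoeff g (fst q) * mcoeff h (snd q))"
      by (rule sum.reindex_bij_witness
          [where i = "\<lambda>((c, d), (a, b)). ((c + a, b), (c, a))"
             and j = "\<lambda>((c, d), (a, b)). ((a, b + d), (b, d))"])
         (auto simp: add.assoc)
    also have "\<dots> = (\<Sum>(c, d) | c + d = m. \<Sum>(a, b) | a + b = d.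
        mcoeff f c * mcoeff g a * mcoeff h b)"
      by (subst sum.Sigma[symmetric])
         (auto simp: finite_multiset_splits[unfolded split_def] split_def)
    also have "\<dots> = mcoeff (f * (g * h)) m"
      by (simp add: times_mfps.rep_eq sum_distrib_left split_def mult.assoc)
    finally show "mcoeff (f * g * h) m = mcoeff (f * (g * h)) m" .
  qed
  show "f * g = g * f"
  proof (rule mfps_eqI)
    fix m
    show "mcoeff (f * g) m = mcoeff (g * f) m"
      unfolding times_mfps.rep_eq
      by (rule sum.reindex_bij_witness[where i = prod.swap and j = prod.swap])
         (auto simp: add.commute mult.commute)
  qed
  show "1 * f = f"
  proof (rule mfps_eqI)
    fix m
    have "mcoeff (1 * f) m = (\<Sum>p \<in> {({#} :: 'a multiset, m)}. mcoeff f (snd p))"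
      unfolding times_mfps.rep_eq one_mfps.rep_eq
      by (rule sum.mono_neutral_cong_right) (auto simp: finite_multiset_splits split: if_splits)
    thus "mcoeff (1 * f) m = mcoeff f m" by simp
  qed
  show "(f + g) * h = f * h + g * h"
    by (rule mfps_eqI)
       (simp add: times_mfps.rep_eq plus_mfps.rep_eq sum.distrib[symmetric] split_def
          algebra_simps)
  show "(0 :: 'a mfps) \<noteq> 1"
    by (metis one_mfps.rep_eq zero_mfps.rep_eq zero_neq_one)
qed (transfer; simp add: fun_eq_iff add.assoc add.commute)+

end

definition mconst :: "complex \<Rightarrow> 'x mfps" where
  "mconst c = Mfps (\<lambda>m. if m = {#} then c else 0)"

definition powersum :: "nat \<Rightarrow> 'x mfps" where
  "powersum r = Mfps (\<lambda>m. if \<exists>x. m = replicate_mset r x then 1 else 0)"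

text \<open>As \<open>u\<close> and \<open>x\<^sub>i\<close> occur in \<open>Q(u) = \<Prod>\<^sub>i (1 + u x\<^sub>i)/(1 - u x\<^sub>i)\<close> only through \<open>u x\<^sub>i\<close>, the
  coefficient of \<open>u\<^sup>r \<Prod>\<^sub>i x\<^sub>i\<^bsup>a\<^sub>i\<^esup>\<close> vanishes unless \<open>r = \<Sum>\<^sub>i a\<^sub>i\<close>, and is then the product over \<open>i\<close> of the
  coefficient of \<open>X\<^bsup>a\<^sub>i\<^esup>\<close> in \<open>(1 + X)/(1 - X)\<close> (which is \<open>1\<close> if \<open>a\<^sub>i = 0\<close>).\<close>

definition q_fun :: "nat \<Rightarrow> 'x mfps" where
  "q_fun r = Mfps (\<lambda>m. if size m = r
     then \<Prod>x\<in>set_mset m. fps_nth ((1 + fps_X) / (1 - fps_X)) (count m x) else 0)"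

text \<open>In a two-variable series of type \<open>'a fps fps\<close> the outer variable is \<open>u\<^sub>1 = fps_X\<close> and the inner
  one is \<open>u\<^sub>2 = fps_const fps_X\<close>. As \<open>u\<^sub>1 + u\<^sub>2\<close> is not a zero divisor, the quotient by it is the series
  whose product with \<open>u\<^sub>1 + u\<^sub>2\<close> is the numerator.\<close>

definition Q_pair_gf :: "'x mfps fps fps" where
  "Q_pair_gf = (THE F. F * (fps_X + fps_const fps_X) =
     (Abs_fps (\<lambda>r. fps_const (q_fun r)) * fps_const (Abs_fps q_fun) - 1)
       * (fps_X - fps_const fps_X))"

text \<open>The quotient exists because \<open>Q(u) Q(-u) = 1\<close>.\<close>

lemma alternating_convolution:
  fixes c :: nat
  defines "G \<equiv> (1 + fps_X) / (1 - fps_X) :: complex fps"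
  shows "(\<Sum>i\<le>c. (-1) ^ i * (fps_nth G i * fps_nth G (c - i))) = (if c = 0 then 1 else 0)"
proof -
  define H where "H = Abs_fps (\<lambda>i. (-1) ^ i * fps_nth G i)"
  have GX: "G * (1 - fps_X) = 1 + fps_X"
    by (simp add: G_def fps_divide_unit mult.assoc inverse_mult_eq_1)
  have HX: "H * (1 + fps_X) = 1 - fps_X"
  proof (rule fps_ext)
    fix k
    have "fps_nth (G * (1 - fps_X)) k = fps_nth (1 + fps_X) k" by (simp only: GX)
    hence "fps_nth G k - (if k = 0 then 0 else fps_nth G (k - 1)) = fps_nth (1 + fps_X) k"
      by (simp add: right_diff_distrib)
    thus "fps_nth (H * (1 + fps_X)) k = fps_nth (1 - fps_X) k"
      by (cases k) (auto simp: H_def distrib_left algebra_simps split: if_splits)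
  qed
  have "H * G * ((1 + fps_X) * (1 - fps_X)) = (H * (1 + fps_X)) * (G * (1 - fps_X))"
    by (simp add: mult_ac)
  also have "\<dots> = 1 * ((1 + fps_X) * (1 - fps_X))" by (simp only: GX HX mult_1_left mult.commute)
  finally have "H * G = 1"
  proof (subst (asm) mult_right_cancel)
    have "fps_nth ((1 + fps_X) * (1 - fps_X) :: complex fps) 0 \<noteq> 0" by simp
    thus "(1 + fps_X) * (1 - fps_X) \<noteq> (0 :: complex fps)" by (metis fps_zero_nth)
  qed
  hence "fps_nth (H * G) c = fps_nth 1 c" by simp
  thus ?thesis by (simp add: fps_mult_nth H_def mult.assoc atLeast0AtMost)
qed

definition mweight :: "'x multiset \<Rightarrow> complex" where
  "mweight m = (\<Prod>x\<in>set_mset m. fps_nth ((1 + fps_X) / (1 - fps_X)) (count m x))"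

lemma mweight_replicate:
  assumes "x \<notin># m"
  shows "mweight (replicate_mset k x + m) = fps_nth ((1 + fps_X) / (1 - fps_X)) k * mweight m"
proof (cases "k = 0")
  case True
  then show ?thesis by (simp add: fps_divide_unit)
next
  case False
  with assms have "mweight (replicate_mset k x + m) =
     fps_nth ((1 + fps_X) / (1 - fps_X)) k *
     (\<Prod>y\<in>set_mset m. fps_nth ((1 + fps_X) / (1 - fps_X)) (count (replicate_mset k x + m) y))"
    by (simp add: mweight_def not_in_iff)
  also have "(\<Prod>y\<in>set_mset m. fps_nth ((1 + fps_X) / (1 - fps_X)) (count (replicate_mset k x + m) y))
     = mweight m"
    unfolding mweight_def using assms by (intro prod.cong) auto
  finally show ?thesis .
qed

lemma mweight_alternating:
  "(\<Sum>(a, b) | a + b = m. (-1) ^ size a * (mweight a * mweight b)) = (if m = {#} then 1 else 0)"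
proof (cases "m = {#}")
  case True
  have "{(a, b). a + b = {#}} = {({#}, {#} :: 'a multiset)}" by auto
  with True show ?thesis by (simp add: mweight_def)
next
  case False
  then obtain x where x: "x \<in># m" by blast
  define k where "k = count m x"
  define m' where "m' = filter_mset (\<lambda>y. y \<noteq> x) m"
  have k: "k \<noteq> 0" using x by (simp add: k_def)
  have x': "x \<notin># m'" by (simp add: m'_def)
  have m: "m = replicate_mset k x + m'"
    by (rule multiset_eqI) (simp add: k_def m'_def)
  let ?G = "fps_nth ((1 + fps_X) / (1 - fps_X) :: complex fps)"
  have "(\<Sum>(a, b) | a + b = m. (-1) ^ size a * (mweight a * mweight b)) =
     (\<Sum>(i, (a, b)) \<in> {..k} \<times> {(a, b). a + b = m'}.
        ((-1) ^ i * (?G i * ?G (k - i))) * ((-1) ^ size a * (mweight a * mweight b)))"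
  proof (rule sum.reindex_bij_witness
      [where j = "\<lambda>(a, b). (count a x, (filter_mset (\<lambda>y. y \<noteq> x) a, filter_mset (\<lambda>y. y \<noteq> x) b))"
         and i = "\<lambda>(i, (a, b)). (replicate_mset i x + a, replicate_mset (k - i) x + b)"], goal_cases)
    case (1 p)
    then show ?case
      by (cases p) (auto simp: k_def intro!: multiset_eqI)
  next
    case (2 p)
    then show ?case by (cases p) (auto simp: k_def m'_def)
  next
    case (3 p)
    then obtain i a b where p: "p = (i, (a, b))" "i \<le> k" "a + b = m'" by (cases p) auto
    have "x \<notin># a" "x \<notin># b" using x' p by auto
    hence "count a x = 0" "count b x = 0"
      "filter_mset (\<lambda>y. y \<noteq> x) a = a" "filter_mset (\<lambda>y. y \<noteq> x) b = b"
      by (auto simp: count_eq_zero_iff filter_mset_eq_conv)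
    thus ?case by (simp add: p)
  next
    case (4 p)
    then obtain i a b where p: "p = (i, (a, b))" "i \<le> k" "a + b = m'" by (cases p) auto
    have "replicate_mset i x + replicate_mset (k - i) x = replicate_mset k x"
      using p(2) by (simp add: multiset_eq_iff)
    thus ?case using p by (simp add: m add_ac)
  next
  case (5 p)
    obtain a b where p: "p = (a, b)" by (cases p)
    have a: "a = replicate_mset (count a x) x + filter_mset (\<lambda>y. y \<noteq> x) a"
      and b: "b = replicate_mset (count b x) x + filter_mset (\<lambda>y. y \<noteq> x) b"
      by (auto intro!: multiset_eqI)
    have kk: "k - count a x = count b x" using 5 by (auto simp: p k_def)
    have s: "size a = count a x + size (filter_mset (\<lambda>y. y \<noteq> x) a)"
      by (subst a) simp
    have wa: "mweight a = ?G (count a x) * mweight (filter_mset (\<lambda>y. y \<noteq> x) a)"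
      by (subst a, subst mweight_replicate) auto
    have wb: "mweight b = ?G (count b x) * mweight (filter_mset (\<lambda>y. y \<noteq> x) b)"
      by (subst b, subst mweight_replicate) auto
    show ?case by (simp add: p kk s wa wb power_add mult_ac)
  qed
  also have "\<dots> = (\<Sum>i\<le>k. (-1) ^ i * (?G i * ?G (k - i))) *
     (\<Sum>(a, b) | a + b = m'. (-1) ^ size a * (mweight a * mweight b))"
    unfolding sum_product sum.cartesian_product by (rule sum.cong) auto
  also have "\<dots> = 0" using k by (simp only: alternating_convolution if_False mult_zero_left)
  finally show ?thesis using False by simp
qed

lemma mcoeff_sum: "mcoeff (sum f A) m = (\<Sum>x\<in>A. mcoeff (f x) m)"
  by (induction A rule: infinite_finite_induct) (simp_all add: zero_mfps.rep_eq plus_mfps.rep_eq)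

lemma mcoeff_minus_one_power: "mcoeff ((-1) ^ k * f) m = (-1) ^ k * mcoeff f m"
  by (cases "even k") (simp_all add: uminus_mfps.rep_eq)

lemma mcoeff_q_fun: "mcoeff (q_fun r) m = (if size m = r then mweight m else 0)"
  by (simp add: q_fun_def mweight_def Mfps_inverse)

lemma q_fun_alternating:
  "(\<Sum>k\<le>N. (-1) ^ k * (q_fun k * q_fun (N - k))) = (if N = 0 then 1 else 0 :: 'x mfps)"
proof (rule mfps_eqI)
  fix m :: "'x multiset"
  have "mcoeff (\<Sum>k\<le>N. (-1) ^ k * (q_fun k * q_fun (N - k))) m =
      (\<Sum>k\<le>N. (-1) ^ k * mcoeff (q_fun k * q_fun (N - k)) m)"
    by (simp only: mcoeff_sum mcoeff_minus_one_power)
  also have "\<dots> = (\<Sum>k\<le>N. \<Sum>p | fst p + snd p = m. (-1) ^ k * (mcoeff (q_fun k) (fst p) * mcoeff (q_fun (N - k)) (snd p)))"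
    by (simp add: times_mfps.rep_eq sum_distrib_left split_def)
  also have "\<dots> = (\<Sum>p | fst p + snd p = m. \<Sum>k\<le>N.
       (-1) ^ k * (mcoeff (q_fun k) (fst p) * mcoeff (q_fun (N - k)) (snd p)))"
    by (rule sum.swap)
  also have "\<dots> = (\<Sum>p | fst p + snd p = m. if size m = N
       then (-1) ^ size (fst p) * (mweight (fst p) * mweight (snd p)) else 0)"
  proof (rule sum.cong[OF refl], goal_cases)
    case (1 p)
    hence m: "m = fst p + snd p" by simp
    have "(\<Sum>k\<le>N. (-1) ^ k * (mcoeff (q_fun k) (fst p) * mcoeff (q_fun (N - k)) (snd p))) =
      (\<Sum>k\<le>N. if k = size (fst p) then if size m = N
         then (-1) ^ size (fst p) * (mweight (fst p) * mweight (snd p)) else 0 else 0)"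
      by (intro sum.cong refl) (auto simp: mcoeff_q_fun m)
    also have "\<dots> = (if size m = N
         then (-1) ^ size (fst p) * (mweight (fst p) * mweight (snd p)) else 0)"
      by (auto simp: m)
    finally show ?case .
  qed
  also have "\<dots> = (if size m = N then if m = {#} then 1 else 0 else 0)"
    using mweight_alternating[of m] by (simp add: split_def)
  also have "\<dots> = mcoeff (if N = 0 then 1 else 0 :: 'x mfps) m"
    by (auto simp: one_mfps.rep_eq zero_mfps.rep_eq)
  finally show "mcoeff (\<Sum>k\<le>N. (-1) ^ k * (q_fun k * q_fun (N - k))) m =
    mcoeff (if N = 0 then 1 else 0 :: 'x mfps) m" .
qed

lemma nth_times_u1_plus_u2:
  fixes F :: "'a::comm_ring_1 fps fps"
  shows "fps_nth (fps_nth (F * (fps_X + fps_const fps_X)) r) s =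
    (if r = 0 then 0 else fps_nth (fps_nth F (r - 1)) s) +
    (if s = 0 then 0 else fps_nth (fps_nth F r) (s - 1))"
  by (simp add: distrib_left)

lemma times_u1_plus_u2_cancel:
  fixes F :: "'a::comm_ring_1 fps fps"
  assumes "F * (fps_X + fps_const fps_X) = G * (fps_X + fps_const fps_X)"
  shows "F = G"
proof -
  have "fps_nth (fps_nth F r) s = fps_nth (fps_nth G r) s" for r s
  proof (induction s arbitrary: r)
    case 0
    from arg_cong[OF assms, of "\<lambda>F. fps_nth (fps_nth F (Suc r)) 0"] show ?case
      by (simp add: nth_times_u1_plus_u2)
  next
    case (Suc s)
    from arg_cong[OF assms, of "\<lambda>F. fps_nth (fps_nth F (Suc r)) (Suc s)"] Suc show ?case
      by (simp add: nth_times_u1_plus_u2)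
  qed
  thus ?thesis by (simp add: fps_eq_iff)
qed

lemma Q_pair_gf:
  "Q_pair_gf * (fps_X + fps_const fps_X) =
     (Abs_fps (\<lambda>r. fps_const (q_fun r)) * fps_const (Abs_fps q_fun) - 1)
       * (fps_X - fps_const fps_X :: 'x mfps fps fps)"
proof -
  define N :: "'x mfps fps fps" where
    "N = (Abs_fps (\<lambda>r. fps_const (q_fun r)) * fps_const (Abs_fps q_fun) - 1)
       * (fps_X - fps_const fps_X)"
  define A :: "nat \<Rightarrow> nat \<Rightarrow> 'x mfps" where
    "A r s = q_fun r * q_fun s - (if r = 0 \<and> s = 0 then 1 else 0)" for r s
  define B where "B r s = fps_nth (fps_nth N r) s" for r s
  have B: "B r s = (if r = 0 then 0 else A (r - 1) s) - (if s = 0 then 0 else A r (s - 1))" for r s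
    unfolding B_def N_def A_def by (auto simp: right_diff_distrib)
  have A0: "(\<Sum>k\<le>M. (-1) ^ k * A k (M - k)) = 0" for M
  proof -
    have "(\<Sum>k\<le>M. (-1) ^ k * A k (M - k)) =
      (\<Sum>k\<le>M. (-1) ^ k * (q_fun k * q_fun (M - k))) - (\<Sum>k\<le>M. if k = 0 then if M = 0 then 1 else 0 else 0)"
      by (subst sum_subtractf[symmetric], intro sum.cong) (auto simp: A_def algebra_simps)
    thus ?thesis by (simp add: q_fun_alternating)
  qed
  have B0: "(\<Sum>k\<le>Suc M. (-1) ^ k * B k (Suc M - k)) = 0" for M
  proof -
    have "(\<Sum>k\<le>Suc M. (-1) ^ k * B k (Suc M - k)) =
      (\<Sum>k\<le>Suc M. if k = 0 then 0 else (-1) ^ k * A (k - 1) (Suc M - k)) -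
      (\<Sum>k\<le>Suc M. if k = Suc M then 0 else (-1) ^ k * A k (M - k))"
      by (subst sum_subtractf[symmetric], intro sum.cong) (auto simp: B algebra_simps)
    also have "(\<Sum>k\<le>Suc M. if k = 0 then 0 else (-1) ^ k * A (k - 1) (Suc M - k)) =
      - (\<Sum>k\<le>M. (-1) ^ k * A k (M - k))"
      by (subst sum.atMost_Suc_shift) (simp add: sum_negf)
    also have "(\<Sum>k\<le>Suc M. if k = Suc M then 0 else (-1) ^ k * A k (M - k)) =
      (\<Sum>k\<le>M. (-1) ^ k * A k (M - k))"
      by simp
    finally show ?thesis by (simp add: A0)
  qed
  define F where "F = Abs_fps (\<lambda>r. Abs_fps (\<lambda>s. \<Sum>k\<le>s. (-1) ^ k * B (r + 1 + k) (s - k)))"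
  have F: "F * (fps_X + fps_const fps_X) = N"
  proof -
    have "fps_nth (fps_nth (F * (fps_X + fps_const fps_X)) r) s = B r s" for r s
    proof (cases s)
      case 0
      thus ?thesis by (auto simp: nth_times_u1_plus_u2 F_def B)
    next
      case (Suc s')
      have *: "(\<Sum>k\<le>s. (-1) ^ k * B (r + k) (s - k)) =
        B r s - (\<Sum>k\<le>s'. (-1) ^ k * B (r + 1 + k) (s' - k))"
        unfolding Suc by (subst sum.atMost_Suc_shift) (simp add: sum_negf)
      show ?thesis
      proof (cases "r = 0")
        case True
        with * B0[of s'] show ?thesis
          by (simp add: nth_times_u1_plus_u2 F_def Suc del: sum.atMost_Suc)
      next
        case False
        with * show ?thesis
          by (simp add: nth_times_u1_plus_u2 F_def Suc del: sum.atMost_Suc)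
      qed
    qed
    thus ?thesis by (simp add: fps_eq_iff B_def)
  qed
  have "Q_pair_gf = F"
    unfolding Q_pair_gf_def N_def[symmetric] using F times_u1_plus_u2_cancel
    by (intro the_equality) (auto simp del: distrib_left)
  with F show ?thesis by (simp add: N_def)
qed

definition Q_pair :: "nat \<Rightarrow> nat \<Rightarrow> 'x mfps" where
  "Q_pair r s = fps_nth (fps_nth Q_pair_gf r) s"

text \<open>The part \<open>\<lambda>\<^sub>j\<close> is \<open>xs ! (j - 1)\<close>, and \<open>omit j xs\<close> is \<open>xs\<close> without it.\<close>

definition omit :: "nat \<Rightarrow> 'a list \<Rightarrow> 'a list" where
  "omit j xs = take (j - 1) xs @ drop j xs"

lemma length_omit [termination_simp]: "1 \<le> j \<Longrightarrow> j \<le> length xs \<Longrightarrow> length (omit j xs) = length xs - 1"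
  by (simp add: omit_def)

fun schurQ :: "nat list \<Rightarrow> 'x mfps" where
  "schurQ [] = 1"
| "schurQ [r] = q_fun r"
| "schurQ [r, s] = Q_pair r s"
| "schurQ (a # b # c # l) =
    (let xs = a # b # c # l; m = length xs in
     if even m
     then \<Sum>j = 2..m. (-1) ^ j * Q_pair (xs ! 0) (xs ! (j - 1)) * schurQ (omit 1 (omit j xs))
     else \<Sum>j = 1..m. (-1) ^ (j - 1) * q_fun (xs ! (j - 1)) * schurQ (omit j xs))"

definition strict_partition :: "nat \<Rightarrow> nat list \<Rightarrow> bool" where
  "strict_partition n \<xi> \<longleftrightarrow> sorted_wrt (>) \<xi> \<and> 0 \<notin> set \<xi> \<and> sum_list \<xi> = n"

definition dlt :: "nat list \<Rightarrow> nat" where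
  "dlt \<xi> = (if even (length \<xi>) then 0 else 1)"

text \<open>\<open>2\<^bsup>-(\<ell>(\<xi>)-\<delta>(\<xi>))/2\<^esup>\<close>; the halving is exact, as \<open>\<ell>(\<xi>) - \<delta>(\<xi>)\<close> is even.\<close>

definition two_factor :: "nat list \<Rightarrow> complex" where
  "two_factor \<xi> = 1 / 2 ^ ((length \<xi> - dlt \<xi>) div 2)"

text \<open>Evaluation at \<open>x\<^sub>k = y k\<close>, where \<open>y k\<close> is a series in \<open>t\<close> and \<open>s\<close>: each coefficient of
  \<open>\<Sum>\<^sub>m f\<^sub>m y\<^sup>m\<close> is required to be a finite sum.\<close>

definition mfps_eval :: "nat mfps \<Rightarrow> (nat \<Rightarrow> complex fps fps) \<Rightarrow> complex fps fps" where
  "mfps_eval f y = Abs_fps (\<lambda>i. Abs_fps (\<lambda>j.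
     \<Sum>m | mcoeff f m * fps_nth (fps_nth (\<Prod>k\<in>#m. y k) i) j \<noteq> 0.
       mcoeff f m * fps_nth (fps_nth (\<Prod>k\<in>#m. y k) i) j))"

abbreviation tvar :: "complex fps fps" where "tvar \<equiv> fps_X"
abbreviation svar :: "complex fps fps" where "svar \<equiv> fps_const fps_X"

text \<open>The families \<open>{t\<^sup>j} \<union> {s t\<^sup>j}\<close> and \<open>{t\<^sup>j s\<^sup>k}\<close>. A bijection with \<^typ>\<open>nat\<close> enumerates each of
  them; for symmetric functions its choice does not matter.\<close>

definition vars_t_st :: "nat \<Rightarrow> complex fps fps" where
  "vars_t_st k = (case sum_decode k of Inl j \<Rightarrow> tvar ^ j | Inr j \<Rightarrow> svar * tvar ^ j)"

definition vars_ts :: "nat \<Rightarrow> complex fps fps" where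
  "vars_ts k = (case prod_decode k of (j, l) \<Rightarrow> tvar ^ j * svar ^ l)"


section \<open>Representations of the symmetric group on coordinate spaces\<close>

text \<open>The coordinate space on a finite set \<open>X\<close> consists of the functions vanishing off \<open>X\<close>.
  Addition of functions is pointwise; their pointwise product plays no role.\<close>

definition fscale :: "complex \<Rightarrow> ('b \<Rightarrow> complex) \<Rightarrow> 'b \<Rightarrow> complex" where
  "fscale c f = (\<lambda>x. c * f x)"

definition bvec :: "'b \<Rightarrow> 'b \<Rightarrow> complex" where
  "bvec x = (\<lambda>y. if y = x then 1 else 0)"

definition coord_space :: "'b set \<Rightarrow> ('b \<Rightarrow> complex) set" where
  "coord_space X = {f. \<forall>x. x \<notin> X \<longrightarrow> f x = 0}"

definition tensor :: "('a \<Rightarrow> complex) \<Rightarrow> ('b \<Rightarrow> complex) \<Rightarrow> 'a \<times> 'b \<Rightarrow> complex" where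
  "tensor f g = (\<lambda>(x, y). f x * g y)"

definition tensor_map :: "'a set \<Rightarrow> 'b set \<Rightarrow>
    (('a \<Rightarrow> complex) \<Rightarrow> 'c \<Rightarrow> complex) \<Rightarrow> (('b \<Rightarrow> complex) \<Rightarrow> 'd \<Rightarrow> complex) \<Rightarrow>
    ('a \<times> 'b \<Rightarrow> complex) \<Rightarrow> 'c \<times> 'd \<Rightarrow> complex" where
  "tensor_map X Y P R h = (\<Sum>(x, y)\<in>X \<times> Y. fscale (h (x, y)) (tensor (P (bvec x)) (R (bvec y))))"

record 'b srep =
  basis :: "'b set"
  rho :: "(nat \<Rightarrow> nat) \<Rightarrow> ('b \<Rightarrow> complex) \<Rightarrow> 'b \<Rightarrow> complex"

definition perm_rep :: "nat \<Rightarrow> nat srep" where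
  "perm_rep n = \<lparr>basis = {1..n}, rho = (\<lambda>\<sigma> f. f \<circ> inv \<sigma>)\<rparr>"

definition tensor_rep :: "'a srep \<Rightarrow> 'b srep \<Rightarrow> ('a \<times> 'b) srep" where
  "tensor_rep V W =
     \<lparr>basis = basis V \<times> basis W,
      rho = (\<lambda>\<sigma>. tensor_map (basis V) (basis W) (rho V \<sigma>) (rho W \<sigma>))\<rparr>"

text \<open>The symmetric algebra of the coordinate space on \<open>X\<close> is the polynomial algebra in variables
  indexed by \<open>X\<close>, and \<open>S\<^sup>i V\<close> has the monomials of degree \<open>i\<close> as basis. The group acts by algebra
  automorphisms: \<open>\<sigma>(v\<^sub>1 \<cdots> v\<^sub>i) = \<sigma>v\<^sub>1 \<cdots> \<sigma>v\<^sub>i\<close>.\<close>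

definition linear_form :: "'b set \<Rightarrow> ('b \<Rightarrow> complex) \<Rightarrow> 'b mfps" where
  "linear_form X v = (\<Sum>x\<in>X. mconst (v x) * Mfps (bvec {#x#}))"

definition sym_power :: "nat \<Rightarrow> 'b srep \<Rightarrow> 'b multiset srep" where
  "sym_power i V = (let B = {m. set_mset m \<subseteq> basis V \<and> size m = i} in
     \<lparr>basis = B,
      rho = (\<lambda>\<sigma> h. \<Sum>m\<in>B. fscale (h m)
               (mcoeff (\<Prod>x\<in>#m. linear_form (basis V) (rho V \<sigma> (bvec x)))))\<rparr>)"

text \<open>The exterior algebra has the basis \<open>e\<^sub>I = e\<^bsub>i\<^sub>1\<^esub> \<and> \<cdots> \<and> e\<^bsub>i\<^sub>k\<^esub>\<close>, \<open>I = {i\<^sub>1 < \<cdots> < i\<^sub>k} \<subseteq> X\<close>, and the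
  Clifford algebra likewise the basis \<open>c\<^sub>I\<close>. Sorting the product of \<open>e\<^sub>I\<close> and \<open>e\<^sub>J\<close>, or of \<open>c\<^sub>I\<close>
  and \<open>c\<^sub>J\<close>, gives one sign for each pair \<open>i \<in> I\<close>, \<open>j \<in> J\<close> with \<open>j < i\<close>; afterwards
  \<open>e\<^sub>x \<and> e\<^sub>x = 0\<close>, resp. \<open>c\<^sub>x\<^sup>2 = 1\<close>, removes repeated factors.\<close>

definition merge_sign :: "'b::linorder set \<Rightarrow> 'b set \<Rightarrow> complex" where
  "merge_sign I J = (-1) ^ card {(i, j). i \<in> I \<and> j \<in> J \<and> j < i}"

definition wedge :: "'b::linorder set \<Rightarrow> ('b set \<Rightarrow> complex) \<Rightarrow> ('b set \<Rightarrow> complex) \<Rightarrow>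
    'b set \<Rightarrow> complex" where
  "wedge X f g = (\<Sum>I\<in>Pow X. \<Sum>J\<in>Pow X.
     if I \<inter> J = {} then fscale (f I * g J * merge_sign I J) (bvec (I \<union> J)) else 0)"

definition ext_vec :: "'b set \<Rightarrow> ('b \<Rightarrow> complex) \<Rightarrow> 'b set \<Rightarrow> complex" where
  "ext_vec X v = (\<Sum>x\<in>X. fscale (v x) (bvec {x}))"

definition ext_power :: "nat \<Rightarrow> 'b::linorder srep \<Rightarrow> 'b set srep" where
  "ext_power j V = (let X = basis V; B = {I. I \<subseteq> X \<and> card I = j} in
     \<lparr>basis = B,
      rho = (\<lambda>\<sigma> h. \<Sum>I\<in>B. fscale (h I)
               (foldr (wedge X)
                  (map (\<lambda>x. ext_vec X (rho V \<sigma> (bvec x))) (sorted_list_of_set I))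
                  (bvec {})))\<rparr>)"


section \<open>The Hecke-Clifford superalgebra\<close>

definition cl_mult :: "nat \<Rightarrow> (nat set \<Rightarrow> complex) \<Rightarrow> (nat set \<Rightarrow> complex) \<Rightarrow> nat set \<Rightarrow> complex" where
  "cl_mult n f g = (\<Sum>I\<in>Pow {1..n}. \<Sum>J\<in>Pow {1..n}.
     fscale (f I * g J * merge_sign I J) (bvec (sym_diff I J)))"

text \<open>The automorphism \<open>c\<^sub>i \<mapsto> c\<^bsub>\<sigma>(i)\<^esub>\<close> of the Clifford algebra.\<close>

definition cl_perm :: "nat \<Rightarrow> (nat \<Rightarrow> nat) \<Rightarrow> (nat set \<Rightarrow> complex) \<Rightarrow> nat set \<Rightarrow> complex" where
  "cl_perm n \<sigma> f = (\<Sum>I\<in>Pow {1..n}. fscale (f I)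
     (foldr (cl_mult n) (map (\<lambda>i. bvec {\<sigma> i}) (sorted_list_of_set I)) (bvec {})))"

lemma cl_mult_bvec:
  assumes "I \<subseteq> {1..n}" "J \<subseteq> {1..n}"
  shows "cl_mult n (bvec I) (bvec J) = fscale (merge_sign I J) (bvec (sym_diff I J))"
proof -
  have "cl_mult n (bvec I) (bvec J) = (\<Sum>I'\<in>Pow {1..n}. \<Sum>J'\<in>Pow {1..n}.
      if J' = J then if I' = I then fscale (merge_sign I J) (bvec (sym_diff I J)) else 0 else 0)"
    unfolding cl_mult_def by (intro sum.cong refl) (auto simp: bvec_def fscale_def fun_eq_iff)
  also have "\<dots> = fscale (merge_sign I J) (bvec (sym_diff I J))"
    using assms by simp
  finally show ?thesis .
qed

lemma cl_relations:
  assumes "i \<in> {1..n}" "j \<in> {1..n}"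
  shows "cl_mult n (bvec {i}) (bvec {i}) = bvec {}"
    and "i \<noteq> j \<Longrightarrow> cl_mult n (bvec {i}) (bvec {j}) = - cl_mult n (bvec {j}) (bvec {i})"
proof -
  have *: "merge_sign {i} {j} = (if j < i then -1 else 1)" for i j :: nat
  proof -
    have "{(a, b). a \<in> {i} \<and> b \<in> {j} \<and> b < a} = (if j < i then {(i, j)} else {})"
      by auto
    thus ?thesis by (simp add: merge_sign_def)
  qed
  show "cl_mult n (bvec {i}) (bvec {i}) = bvec {}"
    using assms by (simp add: cl_mult_bvec * fscale_def)
  show "cl_mult n (bvec {i}) (bvec {j}) = - cl_mult n (bvec {j}) (bvec {i})" if "i \<noteq> j"
    using assms that
    by (cases i j rule: linorder_cases)
       (simp_all add: cl_mult_bvec * fscale_def fun_eq_iff insert_commute Un_commute)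
qed

lemma cl_perm_generator:
  assumes "i \<in> {1..n}" "\<sigma> permutes {1..n}"
  shows "cl_perm n \<sigma> (bvec {i}) = bvec {\<sigma> i}"
proof -
  have "\<sigma> i \<in> {1..n}" using assms by (simp only: permutes_in_image)
  hence 1: "cl_mult n (bvec {\<sigma> i}) (bvec {}) = bvec {\<sigma> i}"
    by (simp add: cl_mult_bvec merge_sign_def fscale_def)
  have "cl_perm n \<sigma> (bvec {i}) = (\<Sum>I\<in>Pow {1..n}. if I = {i} then bvec {\<sigma> i} else 0)"
    unfolding cl_perm_def
    by (intro sum.cong refl) (auto simp: bvec_def[of "{i}"] fscale_def 1 fun_eq_iff)
  also have "\<dots> = bvec {\<sigma> i}" using assms by simp
  finally show ?thesis .
qed

text \<open>The pair \<open>(I, \<sigma>)\<close> stands for \<open>c\<^sub>I \<sigma>\<close>, and \<open>(c\<^sub>I \<sigma>) (c\<^sub>J \<tau>) = c\<^sub>I \<sigma>(c\<^sub>J) \<sigma>\<tau>\<close>.\<close>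

type_synonym hc = "nat set \<times> (nat \<Rightarrow> nat) \<Rightarrow> complex"

definition hc_basis :: "nat \<Rightarrow> (nat set \<times> (nat \<Rightarrow> nat)) set" where
  "hc_basis n = Pow {1..n} \<times> {\<sigma>. \<sigma> permutes {1..n}}"

definition hc_mult :: "nat \<Rightarrow> hc \<Rightarrow> hc \<Rightarrow> hc" where
  "hc_mult n a b = (\<Sum>(I, \<sigma>)\<in>hc_basis n. \<Sum>(J, \<tau>)\<in>hc_basis n.
     fscale (a (I, \<sigma>) * b (J, \<tau>))
       (tensor (cl_mult n (bvec I) (cl_perm n \<sigma> (bvec J))) (bvec (\<sigma> \<circ> \<tau>))))"

definition hc_one :: hc where
  "hc_one = bvec ({}, id)"

text \<open>Homogeneous components are indexed by the parities \<open>0\<close> (even) and \<open>1\<close> (odd).\<close>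

definition hc_part :: "nat \<Rightarrow> nat \<Rightarrow> hc set" where
  "hc_part n k = coord_space {(I, \<sigma>) \<in> hc_basis n. card I mod 2 = k}"

record 'v supermodule =
  smult :: "complex \<Rightarrow> 'v \<Rightarrow> 'v"
  part :: "nat \<Rightarrow> 'v set"
  act :: "hc \<Rightarrow> 'v \<Rightarrow> 'v"

definition sm_carrier :: "'v::ab_group_add supermodule \<Rightarrow> 'v set" where
  "sm_carrier M = {x + y | x y. x \<in> part M 0 \<and> y \<in> part M 1}"

text \<open>The carrier is a subspace of an ambient vector space; nothing is required of the action
  outside it.\<close>

locale hc_module =
  fixes n :: nat and M :: "'v::ab_group_add supermodule"
  assumes vector_space: "vector_space (smult M)"
    and subspace_part: "k \<in> {0, 1} \<Longrightarrow> module.subspace (smult M) (part M k)"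
    and direct: "part M 0 \<inter> part M 1 = {0}"
    and graded: "\<lbrakk>k \<in> {0, 1}; l \<in> {0, 1}; a \<in> hc_part n k; x \<in> part M l\<rbrakk> \<Longrightarrow>
                   act M a x \<in> part M ((k + l) mod 2)"
    and act_add_right: "\<lbrakk>a \<in> coord_space (hc_basis n); x \<in> sm_carrier M; y \<in> sm_carrier M\<rbrakk> \<Longrightarrow>
                   act M a (x + y) = act M a x + act M a y"
    and act_smult_right: "\<lbrakk>a \<in> coord_space (hc_basis n); x \<in> sm_carrier M\<rbrakk> \<Longrightarrow>
                   act M a (smult M c x) = smult M c (act M a x)"
    and act_add_left: "\<lbrakk>a \<in> coord_space (hc_basis n); b \<in> coord_space (hc_basis n);
                   x \<in> sm_carrier M\<rbrakk> \<Longrightarrow> act M (a + b) x = act M a x + act M b x"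
    and act_smult_left: "\<lbrakk>a \<in> coord_space (hc_basis n); x \<in> sm_carrier M\<rbrakk> \<Longrightarrow>
                   act M (fscale c a) x = smult M c (act M a x)"
    and act_mult: "\<lbrakk>a \<in> coord_space (hc_basis n); b \<in> coord_space (hc_basis n);
                   x \<in> sm_carrier M\<rbrakk> \<Longrightarrow> act M (hc_mult n a b) x = act M a (act M b x)"
    and act_one: "x \<in> sm_carrier M \<Longrightarrow> act M hc_one x = x"

definition hc_submodule :: "nat \<Rightarrow> 'v::ab_group_add supermodule \<Rightarrow> 'v set \<Rightarrow> bool" where
  "hc_submodule n M U \<longleftrightarrow>
     module.subspace (smult M) U \<and> U \<subseteq> sm_carrier M \<and>
     (\<forall>x\<in>part M 0. \<forall>y\<in>part M 1. x + y \<in> U \<longrightarrow> x \<in> U \<and> y \<in> U) \<and>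
     (\<forall>a\<in>coord_space (hc_basis n). \<forall>x\<in>U. act M a x \<in> U)"

definition hc_irreducible :: "nat \<Rightarrow> 'v::ab_group_add supermodule \<Rightarrow> bool" where
  "hc_irreducible n M \<longleftrightarrow> hc_module n M \<and> sm_carrier M \<noteq> {0} \<and>
     (\<forall>U. hc_submodule n M U \<longrightarrow> U = {0} \<or> U = sm_carrier M)"

definition sm_finite_dim :: "'v::ab_group_add supermodule \<Rightarrow> bool" where
  "sm_finite_dim M \<longleftrightarrow> (\<exists>B. finite B \<and> module.span (smult M) B = sm_carrier M)"

text \<open>A homomorphism is a map on the carrier. It is extended by zero to the ambient type, so that
  distinct functions are distinct homomorphisms.\<close>

definition hc_Hom_part :: "nat \<Rightarrow> 'v::ab_group_add supermodule \<Rightarrow> 'w::ab_group_add supermodule \<Rightarrow>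
    nat \<Rightarrow> ('v \<Rightarrow> 'w) set" where
  "hc_Hom_part n M N k = {f.
     (\<forall>x\<in>sm_carrier M. \<forall>y\<in>sm_carrier M. f (x + y) = f x + f y) \<and>
     (\<forall>c. \<forall>x\<in>sm_carrier M. f (smult M c x) = smult N c (f x)) \<and>
     (\<forall>l\<in>{0, 1}. \<forall>x\<in>part M l. f x \<in> part N ((k + l) mod 2)) \<and>
     (\<forall>l\<in>{0, 1}. \<forall>a\<in>hc_part n l. \<forall>x\<in>sm_carrier M.
        f (act M a x) = smult N ((-1) ^ (k * l)) (act N a (f x))) \<and>
     (\<forall>x. x \<notin> sm_carrier M \<longrightarrow> f x = 0)}"

definition hc_Hom :: "nat \<Rightarrow> 'v::ab_group_add supermodule \<Rightarrow> 'w::ab_group_add supermodule \<Rightarrow>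
    ('v \<Rightarrow> 'w) set" where
  "hc_Hom n M N = {f + g | f g. f \<in> hc_Hom_part n M N 0 \<and> g \<in> hc_Hom_part n M N 1}"

definition dim_Hom :: "nat \<Rightarrow> 'v::ab_group_add supermodule \<Rightarrow> 'w::ab_group_add supermodule \<Rightarrow> nat" where
  "dim_Hom n M N = vector_space.dim (\<lambda>c f x. smult N c (f x)) (hc_Hom n M N)"

text \<open>The module \<open>Cl\<^sub>n \<otimes> M\<close>: \<open>c\<^sub>I \<sigma>\<close> acts by \<open>u \<otimes> v \<mapsto> c\<^sub>I \<sigma>(u) \<otimes> \<sigma>v\<close>.\<close>

definition cl_tensor :: "nat \<Rightarrow> 'b srep \<Rightarrow> (nat set \<times> 'b \<Rightarrow> complex) supermodule" where
  "cl_tensor n M =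
     \<lparr>smult = fscale,
      part = (\<lambda>k. coord_space ({I \<in> Pow {1..n}. card I mod 2 = k} \<times> basis M)),
      act = (\<lambda>a h. \<Sum>(I, \<sigma>)\<in>hc_basis n. fscale (a (I, \<sigma>))
               (tensor_map (Pow {1..n}) (basis M)
                  (\<lambda>u. cl_mult n (bvec I) (cl_perm n \<sigma> u)) (rho M \<sigma>) h))\<rparr>"


section \<open>Characters and the modules labelled by strict partitions\<close>

text \<open>The trace of a linear endomorphism \<open>T\<close> of a finite-dimensional subspace \<open>W\<close>, computed in an
  arbitrary basis \<open>B\<close> of \<open>W\<close>.\<close>

definition trace_on :: "(complex \<Rightarrow> 'v \<Rightarrow> 'v) \<Rightarrow> 'v::ab_group_add set \<Rightarrow> ('v \<Rightarrow> 'v) \<Rightarrow> complex" where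
  "trace_on sc W T =
     (let B = SOME B. \<not> module.dependent sc B \<and> module.span sc B = W
      in \<Sum>b\<in>B. module.representation sc B (T b) b)"

definition odd_partitions :: "nat \<Rightarrow> nat multiset set" where
  "odd_partitions n = {\<alpha>. \<Sum>\<^sub># \<alpha> = n \<and> (\<forall>i\<in>#\<alpha>. odd i)}"

definition zee :: "nat multiset \<Rightarrow> nat" where
  "zee \<alpha> = (\<Prod>i\<in>set_mset \<alpha>. i ^ count \<alpha> i * fact (count \<alpha> i))"

definition cycle_type :: "nat \<Rightarrow> (nat \<Rightarrow> nat) \<Rightarrow> nat multiset" where
  "cycle_type n \<sigma> = image_mset card (mset_set (orbit \<sigma> ` {1..n}))"

definition perm_of_type :: "nat \<Rightarrow> nat multiset \<Rightarrow> nat \<Rightarrow> nat" where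
  "perm_of_type n \<alpha> = (SOME \<sigma>. \<sigma> permutes {1..n} \<and> cycle_type n \<sigma> = \<alpha>)"

definition ch_minus :: "nat \<Rightarrow> 'v::ab_group_add supermodule \<Rightarrow> nat mfps" where
  "ch_minus n M = (\<Sum>\<alpha>\<in>odd_partitions n.
     mconst (trace_on (smult M) (sm_carrier M) (act M (bvec ({}, perm_of_type n \<alpha>)))
               / of_nat (zee \<alpha>))
       * (\<Prod>i\<in>#\<alpha>. powersum i))"

text \<open>\<open>D\<close> is (a representative of the isomorphism class of) the module \<open>D\<^sup>\<xi>\<close>.\<close>

definition is_D :: "nat \<Rightarrow> nat list \<Rightarrow> 'v::ab_group_add supermodule \<Rightarrow> bool" where
  "is_D n \<xi> D \<longleftrightarrow> hc_irreducible n D \<and> sm_finite_dim D \<and>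
     ch_minus n D = mconst (two_factor \<xi>) * schurQ \<xi>"

definition d_hat :: "nat \<Rightarrow> 'v::ab_group_add supermodule \<Rightarrow> complex fps fps" where
  "d_hat n D = Abs_fps (\<lambda>i. \<Sum>j = 0..n. fps_const (of_nat (dim_Hom n D
     (cl_tensor n (tensor_rep (sym_power i (perm_rep n)) (ext_power j (perm_rep n))))))
     * fps_X ^ j)"

definition d_tilde :: "nat \<Rightarrow> 'v::ab_group_add supermodule \<Rightarrow> complex fps fps" where
  "d_tilde n D = Abs_fps (\<lambda>i. Abs_fps (\<lambda>j. of_nat (dim_Hom n D
     (cl_tensor n (tensor_rep (sym_power i (perm_rep n)) (sym_power j (perm_rep n)))))))"

end

theory Submission
  imports Defs "HOL-Library.FuncSet" "HOL-Library.Disjoint_Sets"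
begin

text \<open>Since \<open>Cl\<^sub>n \<otimes> M\<close> is induced from the symmetric group, \<open>Hom(D, Cl\<^sub>n \<otimes> M)\<close> is the space of
  equivariant maps \<open>D \<rightarrow> M\<close>, and its dimension is the average of \<open>tr \<sigma>|\<^sub>D tr \<sigma>|\<^sub>M\<close> (the traces
  on \<open>M\<close> are integers). If \<open>\<sigma>\<close> has a cycle of even length, supported on \<open>I\<close> say, then
  \<open>\<sigma> c\<^sub>I = - c\<^sub>I \<sigma>\<close> and \<open>tr \<sigma>|\<^sub>D = 0\<close>. For \<open>\<sigma>\<close> of odd cycle type \<open>\<alpha>\<close> the trace on
  \<open>S\<^sup>iV \<otimes> \<wedge>\<^sup>jV\<close> (or \<open>S\<^sup>iV \<otimes> S\<^sup>jV\<close>) counts the ways to attach to each cycle a variable of the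
  specialization so that the total exponents are \<open>(i, j)\<close>, which is the coefficient of \<open>t\<^sup>i s\<^sup>j\<close> in
  the specialized \<open>p\<^sub>\<alpha>\<close>. Thus both series are specializations of \<open>ch\<^sup>-(D)\<close>.\<close>

section \<open>Signs\<close>

text \<open>Three obstacles shape the proof. Signs: \<sigma> permutes the basis elements c_I and e_I
  only up to a reordering sign, so its trace on M is a signed count of fixed basis elements. On
  invariant sets the sign is multiplicative; it is 1 for \<sigma> of odd order, which makes the
  count plain in the odd classes, and -1 on a single even cycle, which produces the vanishing trace
  on D. Parity: even and odd homomorphisms come from equivariant maps on the even and on the odd
  part of D, so together they make up all equivariant maps from D to M, with no parity condition
  left. The dimension is then the trace of an explicit averaging projection in coordinates.
  Infinitely many variables: each family contains the variable 1, so bounding the exponents of t and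
  s leaves infinitely many monomials; a coefficient of the specialization is a finite sum because
  the series is homogeneous of degree n, which is read off from \<open>ch_minus\<close>. The weights
  1/z_\<alpha> arise from class sizes, so the permutations of each odd type have to be
  counted.\<close>

lemma sum_fun_apply:
  fixes f :: "'a \<Rightarrow> 'b \<Rightarrow> 'c::comm_monoid_add"
  shows "sum f A x = (\<Sum>a\<in>A. f a x)"
  by (induction A rule: infinite_finite_induct) simp_all

text \<open>For \<open>f\<close> injective on \<open>I\<close> this is (-1) to the number of
  inversions: the sign produced when \<sigma> is applied to c_I or e_I and the factors are sorted
  again. Indexing by unordered pairs lets the image map carry the pairs in a set to the pairs in its
  image.\<close>

definition inv_sign :: "('a::linorder \<Rightarrow> 'b::linorder) \<Rightarrow> 'a set \<Rightarrow> complex" where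
  "inv_sign f I = (\<Prod>P\<in>{P. P \<subseteq> I \<and> card P = 2}. if strict_mono_on P f then 1 else -1)"

lemma finite_two_subsets: "finite I \<Longrightarrow> finite {P. P \<subseteq> I \<and> card P = 2}"
  by (rule finite_subset[of _ "Pow I"]) auto

lemma strict_mono_on_pair:
  fixes f :: "'a::linorder \<Rightarrow> 'b::linorder"
  assumes "x < y"
  shows "strict_mono_on {x, y} f \<longleftrightarrow> f x < f y"
  using assms by (auto simp: strict_mono_on_def)

lemma card_2_less:
  fixes P :: "'a::linorder set"
  assumes "card P = 2"
  obtains x y where "x < y" "P = {x, y}"
proof -
  obtain a b where ab: "P = {a, b}" "a \<noteq> b" using assms by (meson card_2_iff)
  show ?thesis
  proof (cases "a < b")
    case True
    with ab that show ?thesis by blast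
  next
    case False
    with ab have "b < a" "P = {b, a}" by auto
    with that show ?thesis by blast
  qed
qed

text \<open>The signs multiply pair by pair: a composite preserves the order of a pair iff both maps
  preserve it or both reverse it. Injectivity keeps every pair a pair.\<close>

lemma inv_sign_comp:
  assumes "finite I" "inj_on g I" "inj_on f (g ` I)"
  shows "inv_sign (f \<circ> g) I = inv_sign f (g ` I) * inv_sign g I"
proof -
  have "inv_sign f (g ` I) =
      (\<Prod>P\<in>{P. P \<subseteq> I \<and> card P = 2}. if strict_mono_on (g ` P) f then 1 else -1)"
    unfolding inv_sign_def
  proof (rule prod.reindex_bij_betw[symmetric])
    show "bij_betw ((`) g) {P. P \<subseteq> I \<and> card P = 2} {P. P \<subseteq> g ` I \<and> card P = 2}"
      unfolding bij_betw_def
    proof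
      show "inj_on ((`) g) {P. P \<subseteq> I \<and> card P = 2}"
        using assms(2) by (auto intro!: inj_onI simp: inj_on_image_eq_iff)
      show "(`) g ` {P. P \<subseteq> I \<and> card P = 2} = {P. P \<subseteq> g ` I \<and> card P = 2}"
        using assms(2) by (auto simp: subset_image_iff card_image inj_on_subset)
    qed
  qed
  hence "inv_sign f (g ` I) * inv_sign g I = (\<Prod>P\<in>{P. P \<subseteq> I \<and> card P = 2}.
      (if strict_mono_on (g ` P) f then 1 else -1) * (if strict_mono_on P g then 1 else -1))"
    by (simp add: inv_sign_def prod.distrib)
  also have "\<dots> = inv_sign (f \<circ> g) I"
    unfolding inv_sign_def
  proof (rule prod.cong[OF refl])
    fix P assume "P \<in> {P. P \<subseteq> I \<and> card P = 2}"
    then obtain x y where P: "x < y" "P = {x, y}" "x \<in> I" "y \<in> I"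
      by (auto elim!: card_2_less)
    have ne: "g x \<noteq> g y" "f (g x) \<noteq> f (g y)"
      using assms P by (auto simp: inj_on_def)
    show "(if strict_mono_on (g ` P) f then 1 else -1) * (if strict_mono_on P g then 1 else -1)
        = (if strict_mono_on P (f \<circ> g) then 1 else - 1 :: complex)"
    proof (cases "g x < g y")
      case True
      thus ?thesis using P by (simp add: strict_mono_on_pair)
    next
      case False
      hence gyx: "g y < g x" using ne by auto
      have "strict_mono_on {g x, g y} f \<longleftrightarrow> f (g y) < f (g x)"
        using strict_mono_on_pair[OF gyx] by (simp add: insert_commute)
      thus ?thesis using P gyx ne by (auto simp: strict_mono_on_pair)
    qed
  qed
  finally show ?thesis by simp
qed

lemma inv_sign_id: "inv_sign id I = 1"
  unfolding inv_sign_def by (rule prod.neutral) (auto simp: strict_mono_on_def)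

lemma inv_sign_square: "inv_sign f I * inv_sign f I = 1"
  unfolding inv_sign_def prod.distrib[symmetric] by (rule prod.neutral) auto

lemma inv_sign_cong:
  assumes "\<And>x. x \<in> I \<Longrightarrow> f x = g x"
  shows "inv_sign f I = inv_sign g I"
  unfolding inv_sign_def
proof (rule prod.cong[OF refl])
  fix P assume "P \<in> {P. P \<subseteq> I \<and> card P = 2}"
  hence "\<And>x. x \<in> P \<Longrightarrow> f x = g x" using assms by auto
  thus "(if strict_mono_on P f then 1 else -1) = (if strict_mono_on P g then 1 else - 1 :: complex)"
    by (simp add: strict_mono_on_def)
qed

text \<open>Splits off the pairs containing the least element; this is the recursion along a sorted
  list in \<open>foldr_singletons\<close>.\<close>

lemma inv_sign_insert_min:
  assumes "finite I" "\<And>y. y \<in> I \<Longrightarrow> x < y"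
  shows "inv_sign f (insert x I) = (\<Prod>y\<in>I. if f x < f y then 1 else -1) * inv_sign f I"
proof -
  have x: "x \<notin> I" using assms(2) by auto
  have two: "{P. P \<subseteq> insert x I \<and> card P = 2} = (\<lambda>y. {x, y}) ` I \<union> {P. P \<subseteq> I \<and> card P = 2}"
    (is "?L = ?R")
  proof
    show "?L \<subseteq> ?R"
    proof
      fix P assume P: "P \<in> ?L"
      then obtain a b where ab: "P = {a, b}" "a < b" by (auto elim!: card_2_less)
      show "P \<in> ?R"
      proof (cases "x \<in> P")
        case True
        with P ab show ?thesis by (auto simp: insert_commute)
      next
        case False
        with P show ?thesis by auto
      qed
    qed
    show "?R \<subseteq> ?L" using x by (auto simp: card_insert_if)
  qed
  moreover have "inj_on (\<lambda>y. {x, y}) I" by (auto intro!: inj_onI simp: doubleton_eq_iff)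
  ultimately show ?thesis
    unfolding inv_sign_def two using x assms
    by (subst prod.union_disjoint)
       (auto simp: finite_two_subsets prod.reindex strict_mono_on_pair)
qed

text \<open>The inversions are exactly the pairs containing the top index m - 1, which wraps around
  to 0; there are m - 1 of them.\<close>

lemma inv_sign_cycle:
  "inv_sign (\<lambda>i. Suc i mod m) {..<m} = (-1) ^ (m - 1)"
proof (cases m)
  case 0
  thus ?thesis by (simp add: inv_sign_def)
next
  case (Suc k)
  have two: "{P. P \<subseteq> {..<Suc k} \<and> card P = 2} = (\<lambda>y. {y, k}) ` {..<k} \<union> {P. P \<subseteq> {..<k} \<and> card P = 2}"
    (is "?L = ?R")
  proof
    show "?L \<subseteq> ?R"
    proof
      fix P assume P: "P \<in> ?L"
      then obtain a b where ab: "P = {a, b}" "a < b" by (auto elim!: card_2_less)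
      show "P \<in> ?R" using P ab by (cases "b = k") auto
    qed
    show "?R \<subseteq> ?L" by (auto simp: less_Suc_eq)
  qed
  have dis: "(\<lambda>y. {y, k}) ` {..<k} \<inter> {P. P \<subseteq> {..<k} \<and> card P = 2} = {}" by auto
  have inj: "inj_on (\<lambda>y. {y, k}) {..<k}" by (auto intro!: inj_onI simp: doubleton_eq_iff)
  have 1: "(\<Prod>P\<in>{P. P \<subseteq> {..<k} \<and> card P = 2}. if strict_mono_on P (\<lambda>i. Suc i mod m) then 1 else -1 :: complex) = 1"
  proof (rule prod.neutral, safe)
    fix P assume P: "P \<subseteq> {..<k}" "card P = 2"
    from P(2) obtain a b where ab: "P = {a, b}" "a < b" by (auto elim!: card_2_less)
    have "Suc a mod m < Suc b mod m" using P ab Suc by auto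
    thus "(if strict_mono_on P (\<lambda>i. Suc i mod m) then 1 else -1 :: complex) = 1"
      using ab by (simp add: strict_mono_on_pair)
  qed
  have "inv_sign (\<lambda>i. Suc i mod m) {..<m} =
     (\<Prod>y<k. if strict_mono_on {y, k} (\<lambda>i. Suc i mod m) then 1 else -1)"
    unfolding inv_sign_def Suc two
    by (subst prod.union_disjoint) (use dis inj 1 in \<open>auto simp: finite_two_subsets prod.reindex Suc\<close>)
  also have "\<dots> = (\<Prod>y<k. -1)"
    by (rule prod.cong) (auto simp: strict_mono_on_pair Suc)
  finally show ?thesis by (simp add: Suc)
qed

section \<open>Sign rules for products of basis elements c_I and e_I\<close>

lemma merge_sign_prod:
  assumes "finite I" "finite J"
  shows "merge_sign I J = (\<Prod>i\<in>I. \<Prod>j\<in>J. if j < i then -1 else 1)"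
proof -
  have "(\<Prod>i\<in>I. \<Prod>j\<in>J. if j < i then -1 else 1 :: complex) =
      (\<Prod>p\<in>I \<times> J. if snd p < fst p then -1 else 1)"
    by (simp add: prod.cartesian_product split_def)
  also have "\<dots> = (\<Prod>p\<in>{p \<in> I \<times> J. snd p < fst p}. -1)"
    using assms by (intro prod.inter_filter[symmetric]) simp
  also have "{p \<in> I \<times> J. snd p < fst p} = {(i, j). i \<in> I \<and> j \<in> J \<and> j < i}" by auto
  finally show ?thesis by (simp add: merge_sign_def)
qed

text \<open>The factors over the intersection occur twice on the right and cancel, being square
  roots of 1.\<close>

lemma prod_sym_diff:
  fixes g :: "'a \<Rightarrow> complex"
  assumes "finite B" "finite C" "\<And>x. g x * g x = 1"
  shows "prod g (sym_diff B C) = prod g B * prod g C"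
proof -
  have "prod g (sym_diff B C) = prod g (B - C) * prod g (C - B)"
    using assms by (intro prod.union_disjoint) auto
  moreover have "prod g B = prod g (B - C) * prod g (B \<inter> C)"
    using assms by (metis Int_commute mult.commute prod.Int_Diff)
  moreover have "prod g C = prod g (C - B) * prod g (B \<inter> C)"
    using assms by (metis Int_commute mult.commute prod.Int_Diff)
  moreover have "prod g (B \<inter> C) * prod g (B \<inter> C) = 1"
    unfolding prod.distrib[symmetric] by (simp add: assms)
  ultimately show ?thesis by (simp add: mult_ac) 
qed

text \<open>Together with its left-hand counterpart: the sign of the product c_I c_J is a
  bicharacter for symmetric difference. \<open>merge_sign_shift\<close> rests on this.\<close>

lemma merge_sign_sym_diff_right:
  assumes "finite A" "finite B" "finite C"
  shows "merge_sign A (sym_diff B C) = merge_sign A B * merge_sign A C"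
  using assms by (simp add: merge_sign_prod prod_sym_diff prod.distrib)

lemma merge_sign_sym_diff_left:
  assumes "finite A" "finite B" "finite C"
  shows "merge_sign (sym_diff B C) A = merge_sign B A * merge_sign C A"
  unfolding merge_sign_prod[OF finite_Diff[OF assms(2), of C, THEN finite_UnI, OF finite_Diff[OF assms(3), of B]] assms(1)]
    merge_sign_prod[OF assms(2,1)] merge_sign_prod[OF assms(3,1)]
  by (rule prod_sym_diff[OF assms(2,3)]) (auto simp flip: prod.distrib intro!: prod.neutral)

lemma merge_sign_square: "merge_sign A B * merge_sign A B = 1"
  by (simp add: merge_sign_def flip: power_mult_distrib)

lemma merge_sign_empty [simp]: "merge_sign {} J = 1" "merge_sign I {} = 1"
  by (simp_all add: merge_sign_def)

text \<open>This is the scalar c_L^2: each unordered pair in L is counted once, as its decreasing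
  ordering. Only the cardinality enters, so c_L and its image under a permutation have the same
  square.\<close>

lemma merge_sign_diag:
  assumes "finite L"
  shows "merge_sign L L = (-1) ^ (card L choose 2)"
proof -
  have "bij_betw (\<lambda>(i, j). {i, j}) {(i, j). i \<in> L \<and> j \<in> L \<and> j < i} {P. P \<subseteq> L \<and> card P = 2}"
    unfolding bij_betw_def
  proof
    show "inj_on (\<lambda>(i, j). {i, j}) {(i, j). i \<in> L \<and> j \<in> L \<and> j < i}"
      by (auto intro!: inj_onI simp: doubleton_eq_iff)
    show "(\<lambda>(i, j). {i, j}) ` {(i, j). i \<in> L \<and> j \<in> L \<and> j < i} = {P. P \<subseteq> L \<and> card P = 2}"
    proof (intro equalityI subsetI)
      fix P assume P: "P \<in> {P. P \<subseteq> L \<and> card P = 2}"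
      then obtain a b where "P = {a, b}" "a < b" by (auto elim!: card_2_less)
      with P show "P \<in> (\<lambda>(i, j). {i, j}) ` {(i, j). i \<in> L \<and> j \<in> L \<and> j < i}"
        by (auto intro!: image_eqI[of _ _ "(b, a)"])
    qed auto
  qed
  thus ?thesis using assms by (simp add: merge_sign_def bij_betw_same_card n_subsets)
qed

text \<open>The product \<open>m\<close> is abstract so that one computation serves both
  \<open>cl_perm\<close> and the action on \<open>ext_power\<close>. The images of the generators
  are multiplied in the increasing order of their preimages; moving each one to its place costs a
  \<open>merge_sign\<close>, and these accumulate to \<open>inv_sign\<close>.\<close>

lemma foldr_singletons:
  fixes xs :: "'a::linorder list" and \<sigma> :: "'a \<Rightarrow> 'b::linorder"
  assumes op: "\<And>c y J. y \<in> X \<Longrightarrow> J \<subseteq> X \<Longrightarrow> y \<notin> J \<Longrightarrow>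
      m (bvec {y}) (fscale c (bvec J)) = fscale (c * merge_sign {y} J) (bvec (insert y J))"
    and "sorted xs" "distinct xs" "\<sigma> ` set xs \<subseteq> X" "inj_on \<sigma> (set xs)"
  shows "foldr m (map (\<lambda>x. bvec {\<sigma> x}) xs) (bvec {}) =
      fscale (inv_sign \<sigma> (set xs)) (bvec (\<sigma> ` set xs))"
  using assms(2-)
proof (induction xs)
  case Nil
  have "{P :: 'a set. P = {} \<and> card P = 2} = {}" by auto
  thus ?case by (simp add: fscale_def inv_sign_def)
next
  case (Cons x xs)
  have lt: "x < y" if "y \<in> set xs" for y
    using Cons.prems that by (auto simp: order.strict_iff_order)
  have ms: "merge_sign {\<sigma> x} (\<sigma> ` set xs) = (\<Prod>y\<in>set xs. if \<sigma> x < \<sigma> y then 1 else -1)"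
  proof -
    have "merge_sign {\<sigma> x} (\<sigma> ` set xs) = (\<Prod>y\<in>set xs. if \<sigma> y < \<sigma> x then -1 else 1)"
      using Cons.prems by (simp add: merge_sign_prod prod.reindex)
    also have "\<dots> = (\<Prod>y\<in>set xs. if \<sigma> x < \<sigma> y then 1 else -1)"
    proof (rule prod.cong[OF refl])
      fix y assume "y \<in> set xs"
      hence "\<sigma> x \<noteq> \<sigma> y" using Cons.prems by auto
      thus "(if \<sigma> y < \<sigma> x then -1 else 1 :: complex) = (if \<sigma> x < \<sigma> y then 1 else -1)" by auto
    qed
    finally show ?thesis .
  qed
  have "foldr m (map (\<lambda>x. bvec {\<sigma> x}) (x # xs)) (bvec {}) =
      m (bvec {\<sigma> x}) (fscale (inv_sign \<sigma> (set xs)) (bvec (\<sigma> ` set xs)))"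
    using Cons by simp
  also have "\<dots> = fscale (inv_sign \<sigma> (set xs) * merge_sign {\<sigma> x} (\<sigma> ` set xs))
      (bvec (insert (\<sigma> x) (\<sigma> ` set xs)))"
    by (rule op) (use Cons.prems in auto)
  also have "inv_sign \<sigma> (set xs) * merge_sign {\<sigma> x} (\<sigma> ` set xs) = inv_sign \<sigma> (set (x # xs))"
    by (simp add: ms inv_sign_insert_min lt)
  finally show ?case by simp
qed

lemma sum_fscale_bvec:
  fixes F :: "'a \<Rightarrow> 'b \<Rightarrow> complex"
  assumes "finite X" "x \<in> X"
  shows "(\<Sum>y\<in>X. fscale (c * bvec x y) (F y)) = fscale c (F x)"
proof -
  have "(\<Sum>y\<in>X. fscale (c * bvec x y) (F y)) = (\<Sum>y\<in>X. if y = x then fscale c (F x) else 0)"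
    by (intro sum.cong refl) (auto simp: bvec_def fscale_def fun_eq_iff)
  thus ?thesis using assms by simp
qed

lemma sum_fscale_bvec':
  fixes F :: "'a \<Rightarrow> 'b \<Rightarrow> complex"
  assumes "finite X" "x \<in> X"
  shows "(\<Sum>y\<in>X. fscale (bvec x y) (F y)) = F x"
  using sum_fscale_bvec[OF assms, of 1 F] by (simp add: fscale_def)

lemma cl_mult_fscale:
  "cl_mult n (fscale c f) g = fscale c (cl_mult n f g)"
  "cl_mult n f (fscale c g) = fscale c (cl_mult n f g)"
  unfolding cl_mult_def fscale_def fun_eq_iff
  by (simp_all add: sum_fun_apply sum_distrib_left mult_ac)

lemma cl_perm_bvec:
  assumes "\<sigma> permutes {1..n}" "I \<subseteq> {1..n}"
  shows "cl_perm n \<sigma> (bvec I) = fscale (inv_sign \<sigma> I) (bvec (\<sigma> ` I))"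
proof -
  have fin: "finite I" using assms(2) finite_subset by blast
  have "cl_perm n \<sigma> (bvec I) = foldr (cl_mult n) (map (\<lambda>i. bvec {\<sigma> i}) (sorted_list_of_set I)) (bvec {})"
    unfolding cl_perm_def by (rule sum_fscale_bvec') (use assms in auto)
  also have "\<dots> = fscale (inv_sign \<sigma> I) (bvec (\<sigma> ` I))"
  proof (subst foldr_singletons[where X = "{1..n}"])
    fix c :: complex and y :: nat and J :: "nat set"
    assume "y \<in> {1..n}" "J \<subseteq> {1..n}" "y \<notin> J"
    hence "cl_mult n (bvec {y}) (bvec J) = fscale (merge_sign {y} J) (bvec (insert y J))"
      by (simp add: cl_mult_bvec insert_Diff_if)
    thus "cl_mult n (bvec {y}) (fscale c (bvec J)) = fscale (c * merge_sign {y} J) (bvec (insert y J))"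
      by (simp only: cl_mult_fscale) (simp add: fscale_def mult.assoc)
  next
    show "\<sigma> ` set (sorted_list_of_set I) \<subseteq> {1..n}"
      using assms permutes_image[OF assms(1)] fin by auto
    show "inj_on \<sigma> (set (sorted_list_of_set I))"
      using assms permutes_inj inj_on_subset by blast
  qed (use fin in auto)
  finally show ?thesis .
qed

section \<open>Cycle types\<close>

text \<open>\<open>cycle_type\<close> for an arbitrary finite set in place of {1..n}, so that
  permutations can be counted by induction over the set.\<close>

definition orbit_sizes :: "'a set \<Rightarrow> ('a \<Rightarrow> 'a) \<Rightarrow> nat multiset" where
  "orbit_sizes X \<sigma> = image_mset card (mset_set (orbit \<sigma> ` X))"

lemma permutes_self_in_orbit: "\<sigma> permutes X \<Longrightarrow> finite X \<Longrightarrow> x \<in> orbit \<sigma> x"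
  by (intro permutation_self_in_orbit) (auto simp: permutation_permutes)

lemma permutes_orbit_eq:
  assumes "\<sigma> permutes X" "finite X" "y \<in> orbit \<sigma> x"
  shows "orbit \<sigma> y = orbit \<sigma> x"
  using assms by (meson cyclic_on_orbit orbit_cyclic_eq3)

lemma disjoint_orbits:
  assumes "\<sigma> permutes X" "finite X"
  shows "disjoint (orbit \<sigma> ` A)"
proof (rule pairwiseI)
  fix V W assume V: "V \<in> orbit \<sigma> ` A" and W: "W \<in> orbit \<sigma> ` A" and "V \<noteq> W"
  then obtain x y where xy: "V = orbit \<sigma> x" "W = orbit \<sigma> y" by auto
  show "disjnt V W"
  proof (rule ccontr)
    assume "\<not> disjnt V W"
    then obtain z where "z \<in> V" "z \<in> W" by (auto simp: disjnt_def)
    hence "orbit \<sigma> z = V" "orbit \<sigma> z = W" using permutes_orbit_eq[OF assms, of z] unfolding xy by blast+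
    with \<open>V \<noteq> W\<close> show False by simp
  qed
qed

lemma permutes_finite_orbit:
  assumes "\<sigma> permutes X" "finite X"
  shows "finite (orbit \<sigma> x)"
  using assms by (meson cyclic_on_orbit finite_cyclic_on)

lemma permutes_image_orbit:
  assumes "\<sigma> permutes X" "finite X"
  shows "\<sigma> ` orbit \<sigma> x = orbit \<sigma> x"
proof (rule endo_inj_surj)
  show "finite (orbit \<sigma> x)" using assms by (rule permutes_finite_orbit)
  show "\<sigma> ` orbit \<sigma> x \<subseteq> orbit \<sigma> x" by (auto intro: orbit.intros)
  show "inj_on \<sigma> (orbit \<sigma> x)" using assms by (metis permutes_inj inj_on_subset subset_UNIV)
qed

lemma orbit_enum:
  fixes x :: 'a
  assumes "\<sigma> permutes X" "finite X"
  defines "m \<equiv> card (orbit \<sigma> x)"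
  shows "bij_betw (\<lambda>i. (\<sigma> ^^ i) x) {..<m} (orbit \<sigma> x)" and "(\<sigma> ^^ m) x = x" and "m > 0"
proof -
  let ?d = "funpow_dist1 \<sigma> x x"
  have x: "x \<in> orbit \<sigma> x" using assms permutes_self_in_orbit by metis
  have b: "bij_betw (\<lambda>i. (\<sigma> ^^ i) x) {0..<?d} (orbit \<sigma> x)"
    unfolding bij_betw_def using inj_on_funpow_dist1[OF x] orbit_conv_funpow_dist1[OF x] by auto
  hence "m = ?d" unfolding m_def using bij_betw_same_card by force
  thus "bij_betw (\<lambda>i. (\<sigma> ^^ i) x) {..<m} (orbit \<sigma> x)" "(\<sigma> ^^ m) x = x" "m > 0"
    using b funpow_dist1_prop[OF x] by (auto simp: atLeast0LessThan)
qed

lemma orbit_enum_step: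
  assumes "\<sigma> permutes X" "finite X" and i: "i < card (orbit \<sigma> x)"
  shows "\<sigma> ((\<sigma> ^^ i) x) = (\<sigma> ^^ (Suc i mod card (orbit \<sigma> x))) x"
proof (cases "Suc i = card (orbit \<sigma> x)")
  case True
  with orbit_enum(2)[OF assms(1,2), of x] show ?thesis by (metis funpow.simps(2) comp_apply mod_self funpow_0)
next
  case False
  with i show ?thesis by simp
qed

text \<open>Elements with equal values are matched one at a time. Applied to the sets of orbits of
  two permutations, this pairs orbits of equal size.\<close>

lemma image_mset_eq_imp_bij:
  assumes "finite A" "finite B" "image_mset f (mset_set A) = image_mset g (mset_set B)"
  shows "\<exists>h. bij_betw h A B \<and> (\<forall>a\<in>A. g (h a) = f a)"
  using assms
proof (induction A arbitrary: B rule: finite_induct)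
  case empty
  hence "B = {}" by (metis image_mset_is_empty_iff mset_set.empty mset_set_empty_iff)
  thus ?case by (simp add: bij_betw_def)
next
  case (insert a A)
  have "f a \<in># image_mset g (mset_set B)"
    using insert.hyps insert.prems(2)[symmetric] by simp
  then obtain b where b: "b \<in> B" "g b = f a" using insert.prems(1) by auto
  have "mset_set B = add_mset b (mset_set (B - {b}))"
    using b insert.prems(1) by (simp add: mset_set.remove)
  hence "image_mset f (mset_set A) = image_mset g (mset_set (B - {b}))"
    using insert.prems(2) insert.hyps b by simp
  then obtain h where h: "bij_betw h A (B - {b})" "\<forall>a\<in>A. g (h a) = f a"
    using insert.IH[of "B - {b}"] insert.prems(1) by auto
  let ?h = "h(a := b)"
  have "bij_betw ?h A (B - {b})"
    using h(1) insert.hyps(2) by (metis bij_betw_cong fun_upd_apply)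
  hence "bij_betw ?h (A \<union> {a}) (B - {b} \<union> {b})"
    by (rule bij_betw_combine) auto
  hence "bij_betw ?h (insert a A) B" using b(1) by (simp add: insert_absorb)
  moreover have "\<forall>c\<in>insert a A. g (?h c) = f c" using h(2) b insert.hyps(2) by auto
  ultimately show ?case by blast
qed

text \<open>Both orbits are run through by iteration from a base point, and the i-th iterates are
  matched. This respects the wrap-around because the periods agree.\<close>

lemma orbits_equivalent:
  assumes \<sigma>: "\<sigma> permutes X" "finite X" and \<tau>: "\<tau> permutes Y" "finite Y"
    and card: "card (orbit \<sigma> x) = card (orbit \<tau> y)"
  shows "\<exists>h. bij_betw h (orbit \<sigma> x) (orbit \<tau> y) \<and> (\<forall>z\<in>orbit \<sigma> x. h (\<sigma> z) = \<tau> (h z))"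
proof -
  let ?m = "card (orbit \<sigma> x)"
  let ?a = "\<lambda>i. (\<sigma> ^^ i) x" and ?b = "\<lambda>i. (\<tau> ^^ i) y"
  note a = orbit_enum[OF \<sigma>, of x]
  note b = orbit_enum[OF \<tau>, of y, folded card]
  let ?h = "?b \<circ> inv_into {..<?m} ?a"
  have "bij_betw ?h (orbit \<sigma> x) (orbit \<tau> y)"
    using a(1) b(1) by (intro bij_betw_trans[OF bij_betw_inv_into])
  moreover have "?h (\<sigma> z) = \<tau> (?h z)" if z: "z \<in> orbit \<sigma> x" for z
  proof -
    obtain i where i: "i < ?m" "z = ?a i" using a(1) z by (auto simp: bij_betw_def)
    have "\<sigma> z = ?a (Suc i mod ?m)" using orbit_enum_step[OF \<sigma>, of i x] i by simp
    moreover have "\<tau> (?b i) = ?b (Suc i mod ?m)"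
      using orbit_enum_step[OF \<tau>, of i y] i card by simp
    ultimately show ?thesis
      using i a(1,3) by (simp add: bij_betw_inv_into_left[OF a(1)])
  qed
  ultimately show ?thesis by blast
qed

text \<open>The matchings of single orbits are glued. The orbit of \<open>h x\<close> is the partner
  of the orbit of x, so distinct orbits stay apart and h is injective.\<close>

lemma same_orbit_sizes_imp_equivalent:
  assumes \<sigma>: "\<sigma> permutes X" "finite X" and \<tau>: "\<tau> permutes Y" "finite Y"
    and eq: "orbit_sizes X \<sigma> = orbit_sizes Y \<tau>"
  shows "\<exists>h. bij_betw h X Y \<and> (\<forall>x\<in>X. h (\<sigma> x) = \<tau> (h x))"
proof -
  obtain g where g: "bij_betw g (orbit \<sigma> ` X) (orbit \<tau> ` Y)"
    "\<forall>W\<in>orbit \<sigma> ` X. card (g W) = card W"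
    using image_mset_eq_imp_bij[OF _ _ eq[unfolded orbit_sizes_def]] \<sigma>(2) \<tau>(2) by auto
  have "\<forall>W\<in>orbit \<sigma> ` X. \<exists>h. bij_betw h W (g W) \<and> (\<forall>z\<in>W. h (\<sigma> z) = \<tau> (h z))"
  proof
    fix W assume W: "W \<in> orbit \<sigma> ` X"
    then obtain x where x: "W = orbit \<sigma> x" by auto
    have "g W \<in> orbit \<tau> ` Y" using g(1) W by (rule bij_betw_apply)
    then obtain y where y: "g W = orbit \<tau> y" by auto
    show "\<exists>h. bij_betw h W (g W) \<and> (\<forall>z\<in>W. h (\<sigma> z) = \<tau> (h z))"
      unfolding y unfolding x using g(2) W x y by (intro orbits_equivalent[OF \<sigma> \<tau>]) metis
  qed
  then obtain H where H: "\<And>W. W \<in> orbit \<sigma> ` X \<Longrightarrow> bij_betw (H W) W (g W)"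
    "\<And>W z. W \<in> orbit \<sigma> ` X \<Longrightarrow> z \<in> W \<Longrightarrow> H W (\<sigma> z) = \<tau> (H W z)"
    by metis
  define h where "h x = H (orbit \<sigma> x) x" for x
  have self: "x \<in> orbit \<sigma> x" for x using \<sigma> by (rule permutes_self_in_orbit)
  have self': "y \<in> orbit \<tau> y" for y using \<tau> by (rule permutes_self_in_orbit)
  have h_in: "h x \<in> g (orbit \<sigma> x)" if "x \<in> X" for x
    using H(1)[of "orbit \<sigma> x"] that self[of x] by (auto simp: h_def bij_betw_def)
  have orb: "g (orbit \<sigma> x) = orbit \<tau> (h x)" if x: "x \<in> X" for x
  proof -
    have "g (orbit \<sigma> x) \<in> orbit \<tau> ` Y" using bij_betw_apply[OF g(1)] x by auto
    then obtain y where "g (orbit \<sigma> x) = orbit \<tau> y" by auto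
    with h_in[OF x] show ?thesis using permutes_orbit_eq[OF \<tau>] by metis
  qed
  have "bij_betw h X Y"
    unfolding bij_betw_def
  proof
    show "inj_on h X"
    proof (rule inj_onI)
      fix x x' assume x: "x \<in> X" "x' \<in> X" "h x = h x'"
      hence "g (orbit \<sigma> x) = g (orbit \<sigma> x')" by (simp add: orb)
      hence o: "orbit \<sigma> x = orbit \<sigma> x'" using g(1) x by (auto simp: bij_betw_def inj_on_def)
      have "inj_on (H (orbit \<sigma> x)) (orbit \<sigma> x)" using H(1) x by (auto simp: bij_betw_def)
      thus "x = x'" using x(3) o self[of x] self[of x'] by (auto simp: h_def inj_on_def)
    qed
    show "h ` X = Y"
    proof (intro equalityI subsetI)
      fix y assume "y \<in> h ` X"
      then obtain x where x: "x \<in> X" "y = h x" by auto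
      have "g (orbit \<sigma> x) \<in> orbit \<tau> ` Y" using bij_betw_apply[OF g(1)] x by auto
      then obtain y' where "y' \<in> Y" "g (orbit \<sigma> x) = orbit \<tau> y'" by auto
      with h_in[OF x(1)] x show "y \<in> Y" using permutes_orbit_subset[OF \<tau>(1)] by auto
    next
      fix y assume y: "y \<in> Y"
      hence "orbit \<tau> y \<in> g ` orbit \<sigma> ` X" using bij_betw_imp_surj_on[OF g(1)] by auto
      then obtain x where x: "x \<in> X" "orbit \<tau> y = g (orbit \<sigma> x)" by auto
      have "y \<in> H (orbit \<sigma> x) ` orbit \<sigma> x"
        using bij_betw_imp_surj_on[OF H(1)[of "orbit \<sigma> x"]] x self'[of y] by simp
      then obtain z where z: "z \<in> orbit \<sigma> x" "H (orbit \<sigma> x) z = y" by auto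
      have "orbit \<sigma> z = orbit \<sigma> x" using z permutes_orbit_eq[OF \<sigma>] by metis
      moreover have "z \<in> X" using z x permutes_orbit_subset[OF \<sigma>(1)] by auto
      ultimately show "y \<in> h ` X" using z by (intro image_eqI[of _ _ z]) (simp_all add: h_def)
    qed
  qed
  moreover have "h (\<sigma> x) = \<tau> (h x)" if "x \<in> X" for x
  proof -
    have "orbit \<sigma> (\<sigma> x) = orbit \<sigma> x" by (rule permutes_orbit_eq[OF \<sigma>]) (rule orbit.base)
    thus ?thesis unfolding h_def using H(2)[of "orbit \<sigma> x" x] that self[of x] by simp
  qed
  ultimately show ?thesis by blast
qed

lemma same_cycle_type_imp_conjugate:
  assumes "\<sigma> permutes {1..n}" "\<tau> permutes {1..n}" "cycle_type n \<sigma> = cycle_type n \<tau>"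
  obtains \<pi> where "\<pi> permutes {1..n}" "\<pi> \<circ> \<sigma> = \<tau> \<circ> \<pi>"
proof -
  obtain h where h: "bij_betw h {1..n} {1..n}" "\<forall>x\<in>{1..n}. h (\<sigma> x) = \<tau> (h x)"
    using same_orbit_sizes_imp_equivalent[OF assms(1) _ assms(2)] assms(3)
    by (auto simp: cycle_type_def orbit_sizes_def)
  define \<pi> where "\<pi> x = (if x \<in> {1..n} then h x else x)" for x
  have "bij_betw \<pi> {1..n} {1..n}"
    using h(1) by (subst bij_betw_cong[of _ _ h]) (auto simp: \<pi>_def)
  hence "\<pi> permutes {1..n}" by (rule bij_imp_permutes) (auto simp: \<pi>_def)
  moreover have "\<pi> (\<sigma> x) = \<tau> (\<pi> x)" for x
  proof (cases "x \<in> {1..n}")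
    case True
    thus ?thesis using h(2) permutes_in_image[OF assms(1), of x] by (simp add: \<pi>_def)
  next
    case False
    hence "\<sigma> x = x" "\<tau> x = x" using assms(1,2) by (simp_all only: permutes_not_in not_False_eq_True)
    thus ?thesis using False by (simp only: \<pi>_def if_False)
  qed
  ultimately show ?thesis using that by (auto simp: fun_eq_iff)
qed

section \<open>Counting the permutations with given orbit sizes\<close>

lemma orbit_sizes_pos: "\<sigma> permutes X \<Longrightarrow> finite X \<Longrightarrow> 0 \<notin># orbit_sizes X \<sigma>"
  by (auto simp: orbit_sizes_def permutes_finite_orbit orbit_nonempty)

lemma sum_orbit_sizes:
  assumes "\<sigma> permutes X" "finite X"
  shows "\<Sum>\<^sub># (orbit_sizes X \<sigma>) = card X"
proof -
  have "\<Union> (orbit \<sigma> ` X) = X"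
    using permutes_self_in_orbit[OF assms] permutes_orbit_subset[OF assms(1)] by auto
  moreover have "card (\<Union> (orbit \<sigma> ` X)) = (\<Sum>W\<in>orbit \<sigma> ` X. card W)"
  proof (rule card_Union_disjoint)
    show "disjoint (orbit \<sigma> ` X)" using assms by (rule disjoint_orbits)
  qed (use assms permutes_finite_orbit in auto)
  ultimately show ?thesis by (simp add: orbit_sizes_def sum_unfold_sum_mset)
qed

lemma card_orbit_size:
  assumes "\<sigma> permutes X" "finite X"
  shows "card {b \<in> X. card (orbit \<sigma> b) = k} = k * count (orbit_sizes X \<sigma>) k"
proof -
  let ?S = "{W \<in> orbit \<sigma> ` X. card W = k}"
  have "{b \<in> X. card (orbit \<sigma> b) = k} = \<Union> ?S"
    using permutes_self_in_orbit[OF assms] permutes_orbit_subset[OF assms(1)]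
      permutes_orbit_eq[OF assms] by fastforce
  moreover have "card (\<Union> ?S) = (\<Sum>W\<in>?S. card W)"
  proof (rule card_Union_disjoint)
    show "disjoint ?S" by (rule pairwise_subset[OF disjoint_orbits[OF assms]]) auto
  qed (use assms permutes_finite_orbit in auto)
  moreover have "count (orbit_sizes X \<sigma>) k = card ?S"
    using assms(2) by (simp add: orbit_sizes_def count_image_mset' sum.If_cases Int_def conj_commute eq_commute)
  ultimately show ?thesis by simp
qed

text \<open>Composing with the transposition puts x into the cycle of b, immediately before b, and
  lengthens that cycle by one. For b = x a new fixed point arises; the value k = 0 covers it,
  because no orbit has size 0 and removing 0 from the multiset changes nothing.\<close>

lemma orbit_sizes_insert_transpose:
  assumes p: "p permutes X" "finite X" and x: "x \<notin> X" and b: "b \<in> insert x X"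
  defines "k \<equiv> if b = x then 0 else card (orbit p b)"
  shows "orbit_sizes (insert x X) (transpose x b \<circ> p) =
     add_mset (Suc k) (orbit_sizes X p - {#k#})"
proof -
  define q where "q = transpose x b \<circ> p"
  define C where "C = (if b = x then {} else orbit p b)"
  have q: "q permutes insert x X"
    using permutes_insert[of x X] p b unfolding q_def by auto
  have fin: "finite (insert x X)" using p by simp
  have px: "p x = x" using p x by (simp add: permutes_def)
  have qx: "q x = b" by (simp add: q_def px)
  have qy: "q y = p y" if "y \<in> X" "p y \<noteq> b" for y
    using that x permutes_in_image[OF p(1), of y] by (auto simp: q_def transpose_def)
  have CX: "C \<subseteq> X" using permutes_orbit_subset[OF p(1)] b by (auto simp: C_def)
  have fC: "finite C" "card C = k"
    using CX p(2) finite_subset by (auto simp: C_def k_def)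
  have orb_x: "orbit q x = insert x C"
  proof
    show "orbit q x \<subseteq> insert x C"
    proof
      fix y assume "y \<in> orbit q x"
      thus "y \<in> insert x C"
      proof induction
        case base
        show ?case using permutes_self_in_orbit[OF p, of b] by (auto simp: qx C_def)
      next
        case (step y)
        show ?case
        proof (cases "y = x")
          case True
          thus ?thesis using permutes_self_in_orbit[OF p, of b] by (auto simp: qx C_def)
        next
          case False
          with step.IH have y: "y \<in> C" "b \<noteq> x" by (auto simp: C_def split: if_splits)
          hence "p y \<in> C" by (auto simp: C_def intro: orbit.step)
          moreover have "q y = p y \<or> q y = x"
            using qy[of y] y CX by (cases "p y = b") (auto simp: q_def)
          ultimately show ?thesis by auto
        qed
      qed
    qed
    have "y \<in> orbit q x" if "y \<in> orbit p b" "b \<noteq> x" for y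
      using that(1)
    proof induction
      case base
      have "b \<in> orbit q x" using orbit.base[of q x] by (simp add: qx)
      moreover have "b \<in> X" using b that by simp
      ultimately show ?case using qy[of b] orbit.step[of b q x] by (cases "p b = b") auto
    next
      case (step y)
      have "b \<in> orbit q x" using orbit.base[of q x] by (simp add: qx)
      moreover have "y \<in> X" using step.hyps permutes_orbit_subset[OF p(1)] b that by auto
      ultimately show ?case using qy[of y] orbit.step[OF step.IH] by (cases "p y = b") auto
    qed
    thus "insert x C \<subseteq> orbit q x"
      using permutes_self_in_orbit[OF q fin, of x] by (auto simp: C_def)
  qed
  have orb_y: "orbit q y = orbit p y" if y: "y \<in> X" "y \<notin> C" for y
  proof (rule orbit_cong)
    show "y \<in> orbit p y" using p by (rule permutes_self_in_orbit)
    fix s assume s: "s \<in> orbit p y"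
    have "s \<in> X" using s y permutes_orbit_subset[OF p(1)] by auto
    moreover have "p s \<noteq> b"
    proof
      assume "p s = b"
      hence "b \<in> orbit p y" using s orbit.step by metis
      hence "orbit p b = orbit p y" by (rule permutes_orbit_eq[OF p])
      moreover have "b \<in> X" using \<open>p s = b\<close> \<open>s \<in> X\<close> permutes_in_image[OF p(1)] by auto
      ultimately show False using y x permutes_self_in_orbit[OF p, of y] by (auto simp: C_def split: if_splits)
    qed
    ultimately show "q s = p s" by (rule qy)
  qed
  have img: "orbit q ` insert x X = insert (insert x C) (orbit p ` X - {C})"
  proof -
    have "orbit q y = insert x C" if "y \<in> C" for y
      using permutes_orbit_eq[OF q fin, of y x] that orb_x by auto
    hence "orbit q ` C \<subseteq> {insert x C}" by auto
    moreover have "orbit q ` insert x X = insert (orbit q x) (orbit q ` C \<union> orbit q ` (X - C))"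
      using CX by blast
    moreover have "orbit q ` (X - C) = orbit p ` (X - C)"
      using orb_y by (intro image_cong) auto
    ultimately have "orbit q ` insert x X = insert (insert x C) (orbit p ` (X - C))"
      using orb_x by auto
    moreover have "orbit p ` (X - C) = orbit p ` X - {C}"
    proof (intro equalityI subsetI)
      fix W assume "W \<in> orbit p ` (X - C)"
      then obtain y where y: "y \<in> X" "y \<notin> C" "W = orbit p y" by auto
      thus "W \<in> orbit p ` X - {C}" using permutes_self_in_orbit[OF p, of y] by auto
    next
      fix W assume "W \<in> orbit p ` X - {C}"
      then obtain y where y: "y \<in> X" "W \<noteq> C" "W = orbit p y" by auto
      moreover have "y \<notin> C"
        using y permutes_orbit_eq[OF p, of y b] by (auto simp: C_def split: if_splits)
      ultimately show "W \<in> orbit p ` (X - C)" by auto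
    qed
    ultimately show ?thesis by simp
  qed
  have "x \<notin> C" using CX x by auto
  have notin: "insert x C \<notin> orbit p ` X - {C}"
    using permutes_orbit_subset[OF p(1)] x by blast
  have "orbit_sizes X p - {#k#} = image_mset card (mset_set (orbit p ` X - {C}))"
  proof (cases "b = x")
    case True
    hence "0 \<notin># orbit_sizes X p" "C = {}" "k = 0"
      using orbit_sizes_pos[OF p] by (auto simp: C_def k_def)
    moreover have "{} \<notin> orbit p ` X" using orbit_nonempty by force
    ultimately show ?thesis by (simp add: orbit_sizes_def diff_single_trivial)
  next
    case False
    hence "C \<in> orbit p ` X" using b by (auto simp: C_def)
    hence "mset_set (orbit p ` X) = add_mset C (mset_set (orbit p ` X - {C}))"
      using p(2) by (simp add: mset_set.remove)
    thus ?thesis using fC by (simp add: orbit_sizes_def)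
  qed
  moreover have "orbit_sizes (insert x X) q =
      add_mset (Suc k) (image_mset card (mset_set (orbit p ` X - {C})))"
    using notin p(2) fC \<open>x \<notin> C\<close> unfolding orbit_sizes_def img by (subst mset_set.insert) auto
  ultimately show ?thesis by (simp add: q_def)
qed

lemma zee_add_mset: "zee (add_mset j \<gamma>) = j * Suc (count \<gamma> j) * zee \<gamma>"
proof -
  let ?f = "\<lambda>\<alpha> i. i ^ count \<alpha> i * fact (count \<alpha> i) :: nat"
  have *: "zee \<alpha> = (\<Prod>i\<in>insert j (set_mset \<gamma>). ?f \<alpha> i)" if "set_mset \<alpha> \<subseteq> insert j (set_mset \<gamma>)" for \<alpha>
    unfolding zee_def using that by (intro prod.mono_neutral_left) (auto simp: not_in_iff)
  have "zee (add_mset j \<gamma>) = ?f (add_mset j \<gamma>) j * (\<Prod>i\<in>set_mset \<gamma> - {j}. ?f (add_mset j \<gamma>) i)"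
    by (subst *) (auto simp: prod.insert_remove)
  also have "(\<Prod>i\<in>set_mset \<gamma> - {j}. ?f (add_mset j \<gamma>) i) = (\<Prod>i\<in>set_mset \<gamma> - {j}. ?f \<gamma> i)"
    by (intro prod.cong) auto
  also have "?f (add_mset j \<gamma>) j * \<dots> = j * Suc (count \<gamma> j) * (?f \<gamma> j * \<dots>)" by (simp add: algebra_simps)
  also have "?f \<gamma> j * (\<Prod>i\<in>set_mset \<gamma> - {j}. ?f \<gamma> i) = zee \<gamma>"
    by (subst *[of \<gamma>]) (auto simp: prod.insert_remove)
  finally show ?thesis .
qed

lemma sum_mult_count:
  fixes \<alpha> :: "nat multiset"
  assumes "finite S" "set_mset \<alpha> \<subseteq> S"
  shows "(\<Sum>j\<in>S. j * count \<alpha> j) = \<Sum>\<^sub># \<alpha>"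
  using assms(2)
proof (induction \<alpha>)
  case (add i \<alpha>)
  have "(\<Sum>j\<in>S. j * count (add_mset i \<alpha>) j) = (\<Sum>j\<in>S. (if j = i then i else 0) + j * count \<alpha> j)"
    by (intro sum.cong) auto
  with add assms(1) show ?case by (simp add: sum.distrib)
qed simp

text \<open>Every permutation of \<open>insert x X\<close> arises from exactly one p on X and one b
  by inserting x before b, or as a fixed point. Grouped by the length j of the cycle that receives
  x, the pairs contribute j * count \<alpha> j * |X|! after multiplication by \<open>zee\<close>;
  these add up to (|X| + 1)! because the parts of \<alpha> add up to |X| + 1.\<close>

lemma card_permutes_orbit_sizes:
  assumes "finite X" "\<Sum>\<^sub># \<alpha> = card X" "0 \<notin># \<alpha>"
  shows "card {\<sigma>. \<sigma> permutes X \<and> orbit_sizes X \<sigma> = \<alpha>} * zee \<alpha> = fact (card X)"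
  using assms
proof (induction X arbitrary: \<alpha> rule: finite_induct)
  case empty
  have a: "\<alpha> = {#}"
  proof (rule ccontr)
    assume "\<alpha> \<noteq> {#}"
    then obtain i where "i \<in># \<alpha>" by blast
    with empty show False by auto
  qed
  have "{\<sigma> :: 'a \<Rightarrow> 'a. \<sigma> permutes {} \<and> orbit_sizes {} \<sigma> = \<alpha>} = {id}"
    by (auto simp: a orbit_sizes_def)
  thus ?case by (simp add: a zee_def)
next
  case (insert x X)
  let ?P = "\<lambda>X \<beta>. {\<sigma> :: 'a \<Rightarrow> 'a. \<sigma> permutes X \<and> orbit_sizes X \<sigma> = \<beta>}"
  let ?k = "\<lambda>b p. if b = x then 0 else card (orbit p b)"
  define S where "S j = {(p, b). p permutes X \<and> b \<in> insert x X \<and> Suc (?k b p) = j \<and>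
      orbit_sizes X p - {#?k b p#} = \<alpha> - {#j#}}" for j
  have finS: "finite (S j)" for j
    by (rule finite_subset[of _ "{p. p permutes X} \<times> insert x X"])
       (use insert.hyps in \<open>auto simp: S_def finite_permutations\<close>)
  have inj: "inj_on (\<lambda>(p, b). transpose x b \<circ> p) {(p, b). p permutes X \<and> b \<in> insert x X}"
  proof (rule inj_onI, clarify)
    fix p b p' b'
    assume H: "p permutes X" "p' permutes X"
      "transpose x b \<circ> p = transpose x b' \<circ> p'"
    have "b = b'"
      using fun_cong[OF H(3), of x] H(1,2) insert.hyps(2) by (simp add: permutes_not_in)
    moreover have "p = p'"
      using H(3) \<open>b = b'\<close> by (metis comp_assoc transpose_comp_involutory id_comp)
    ultimately show "p = p' \<and> b = b'" by simp
  qed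
  have "?P (insert x X) \<alpha> = (\<lambda>(p, b). transpose x b \<circ> p) ` (\<Union>j\<in>set_mset \<alpha>. S j)"
  proof (intro equalityI subsetI)
    fix q assume q: "q \<in> ?P (insert x X) \<alpha>"
    hence "q \<in> {q. q permutes insert x X}" by simp
    then obtain b p where bp: "b \<in> insert x X" "p permutes X" "q = transpose x b \<circ> p"
      unfolding permutes_insert by (elim imageE CollectE case_prodE) auto
    have "orbit_sizes (insert x X) q = add_mset (Suc (?k b p)) (orbit_sizes X p - {#?k b p#})"
      unfolding bp(3) by (rule orbit_sizes_insert_transpose[OF bp(2) insert.hyps(1,2) bp(1)])
    moreover have "orbit_sizes (insert x X) q = \<alpha>" using q by (simp only: mem_Collect_eq)
    ultimately have "add_mset (Suc (?k b p)) (orbit_sizes X p - {#?k b p#}) = \<alpha>" by (simp only:)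
    hence "Suc (?k b p) \<in># \<alpha>" "orbit_sizes X p - {#?k b p#} = \<alpha> - {#Suc (?k b p)#}"
      by (metis union_single_eq_member, metis add_mset_remove_trivial)
    moreover from this have "(p, b) \<in> S (Suc (?k b p))"
      using bp unfolding S_def by blast
    ultimately show "q \<in> (\<lambda>(p, b). transpose x b \<circ> p) ` (\<Union>j\<in>set_mset \<alpha>. S j)" using bp(3) by force
  next
    fix q assume "q \<in> (\<lambda>(p, b). transpose x b \<circ> p) ` (\<Union>j\<in>set_mset \<alpha>. S j)"
    then obtain j p b where *: "j \<in># \<alpha>" "(p, b) \<in> S j" "q = transpose x b \<circ> p" by auto
    hence bp: "b \<in> insert x X" "p permutes X" by (auto simp: S_def)
    have "q permutes insert x X" using permutes_insert[of x X] bp * by auto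
    moreover have "orbit_sizes (insert x X) q = add_mset (Suc (?k b p)) (orbit_sizes X p - {#?k b p#})"
      unfolding *(3) by (rule orbit_sizes_insert_transpose[OF bp(2) insert.hyps(1,2) bp(1)])
    moreover have "Suc (?k b p) = j" "orbit_sizes X p - {#?k b p#} = \<alpha> - {#j#}"
      using *(2) unfolding S_def by blast+
    ultimately show "q \<in> ?P (insert x X) \<alpha>" using *(1) by (simp only: mem_Collect_eq insert_DiffM)
  qed
  moreover have "inj_on (\<lambda>(p, b). transpose x b \<circ> p) (\<Union>j\<in>set_mset \<alpha>. S j)"
    by (rule inj_on_subset[OF inj]) (auto simp: S_def)
  ultimately have "card (?P (insert x X) \<alpha>) = card (\<Union>j\<in>set_mset \<alpha>. S j)"
    by (simp add: card_image)
  also have "\<dots> = (\<Sum>j\<in>set_mset \<alpha>. card (S j))"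
    by (rule card_UN_disjoint) (use finS in \<open>auto simp: S_def\<close>)
  finally have card_P: "card (?P (insert x X) \<alpha>) = (\<Sum>j\<in>set_mset \<alpha>. card (S j))" .
  have card_S: "card (S j) * zee \<alpha> = j * count \<alpha> j * fact (card X)" if j: "j \<in># \<alpha>" for j
  proof -
    define \<gamma> where "\<gamma> = \<alpha> - {#j#}"
    have \<alpha>: "\<alpha> = add_mset j \<gamma>" using j by (simp add: \<gamma>_def)
    have j0: "j > 0" using j insert.prems(2) by (metis gr0I)
    have card_i: "card (insert x X) = Suc (card X)" using insert.hyps by simp
    have \<gamma>0: "0 \<notin># \<gamma>" using insert.prems(2) \<alpha> by simp
    show ?thesis
    proof (cases "j = 1")
      case True
      have "S j = (\<lambda>p. (p, x)) ` ?P X \<gamma>"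
      proof -
        have k: "Suc (?k b p) = j \<longleftrightarrow> b = x" if "p permutes X" for p b
          using permutes_finite_orbit[OF that insert.hyps(1), of b] orbit_nonempty[of p b] True by auto
        have "orbit_sizes X p - {#0#} = orbit_sizes X p" if "p permutes X" for p
          using orbit_sizes_pos[OF that insert.hyps(1)] by (simp add: diff_single_trivial)
        hence "(p, b) \<in> S j \<longleftrightarrow> p permutes X \<and> b = x \<and> orbit_sizes X p = \<gamma>" for p b
          unfolding S_def mem_Collect_eq prod.case \<gamma>_def using k[of p b]
          by (cases "b = x") (simp_all only: if_True simp_thms insert_iff cong: conj_cong)
        thus ?thesis by auto
      qed
      hence "card (S j) = card (?P X \<gamma>)" by (simp add: card_image inj_on_def)
      moreover have "card (?P X \<gamma>) * zee \<gamma> = fact (card X)"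
        by (rule insert.IH) (use insert.prems \<alpha> card_i True \<gamma>0 in auto)
      ultimately show ?thesis by (simp add: \<alpha> zee_add_mset True algebra_simps)
    next
      case False
      define i where "i = j - 1"
      have i: "j = Suc i" "i > 0" using False j0 by (auto simp: i_def)
      \<comment> \<open>x enters a cycle of length i = j - 1, so p has type \<beta> and b is any of
        the \<open>i * count \<beta> i\<close> points in such cycles. Exactly this factor turns
        \<open>zee \<gamma>\<close> into \<open>zee \<beta>\<close>.\<close>
      define \<beta> where "\<beta> = add_mset i \<gamma>"
      have "S j = (SIGMA p:?P X \<beta>. {b \<in> X. card (orbit p b) = i})"
      proof -
        have "orbit_sizes X p - {#i#} = \<gamma> \<longleftrightarrow> orbit_sizes X p = \<beta>"
          if "p permutes X" "b \<in> X" "card (orbit p b) = i" for p b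
        proof -
          have "i \<in># orbit_sizes X p" using that insert.hyps(1) by (auto simp: orbit_sizes_def)
          thus ?thesis by (auto simp: \<beta>_def)
        qed
        thus ?thesis using i insert.hyps(2) by (auto simp: S_def \<gamma>_def split: if_splits)
      qed
      hence "card (S j) = (\<Sum>p\<in>?P X \<beta>. card {b \<in> X. card (orbit p b) = i})"
        using insert.hyps(1) by (simp add: finite_permutations)
      also have "\<dots> = (\<Sum>p\<in>?P X \<beta>. i * count \<beta> i)"
        using card_orbit_size insert.hyps(1) by (intro sum.cong) auto
      finally have cS: "card (S j) = card (?P X \<beta>) * (i * count \<beta> i)" by simp
      have IH: "card (?P X \<beta>) * zee \<beta> = fact (card X)"
        by (rule insert.IH) (use insert.prems \<alpha> card_i i \<gamma>0 in \<open>auto simp: \<beta>_def\<close>)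
      have "card (S j) * zee \<alpha> = card (?P X \<beta>) * (i * Suc (count \<gamma> i) * zee \<gamma>) * (j * count \<alpha> j)"
        by (simp add: cS \<beta>_def \<alpha> zee_add_mset algebra_simps)
      also have "\<dots> = fact (card X) * (j * count \<alpha> j)"
        by (simp only: IH[symmetric] \<beta>_def zee_add_mset)
      finally show ?thesis by (simp add: algebra_simps)
    qed
  qed
  have "card (?P (insert x X) \<alpha>) * zee \<alpha> = (\<Sum>j\<in>set_mset \<alpha>. j * count \<alpha> j) * fact (card X)"
    by (simp add: card_P sum_distrib_right card_S)
  also have "(\<Sum>j\<in>set_mset \<alpha>. j * count \<alpha> j) = \<Sum>\<^sub># \<alpha>"
    by (rule sum_mult_count) auto
  finally show ?case using insert.hyps insert.prems by (simp add: algebra_simps)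
qed

lemma funpow_permutes: "\<sigma> permutes X \<Longrightarrow> \<sigma> ^^ k permutes X"
  by (induction k) (auto simp: permutes_id permutes_compose id_def[symmetric])

text \<open>On an invariant set the cocycle rule of \<open>inv_sign_comp\<close> becomes plain
  multiplicativity.\<close>

lemma inv_sign_funpow:
  assumes "\<sigma> permutes X" "finite I" "\<sigma> ` I = I"
  shows "inv_sign (\<sigma> ^^ k) I = inv_sign \<sigma> I ^ k"
proof (induction k)
  case 0
  show ?case using inv_sign_id[of I] by (simp add: id_def)
next
  case (Suc k)
  have img: "(\<sigma> ^^ k) ` I = I"
  proof (induction k)
    case (Suc k)
    have "(\<sigma> ^^ Suc k) ` I = \<sigma> ` (\<sigma> ^^ k) ` I" by (simp only: funpow.simps image_comp)
    thus ?case by (simp only: Suc.IH assms(3))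
  qed simp
  have "inv_sign (\<sigma> \<circ> \<sigma> ^^ k) I = inv_sign \<sigma> ((\<sigma> ^^ k) ` I) * inv_sign (\<sigma> ^^ k) I"
    using assms(1,2) by (intro inv_sign_comp) (auto intro: permutes_inj_on funpow_permutes)
  thus ?case by (simp only: img Suc.IH funpow.simps power_Suc)
qed

text \<open>An odd power of \<sigma> is the identity, so the sign, being 1 or -1, is 1. The exponent
  m is the product of the orbit sizes, an odd common multiple of the cycle lengths. Hence \<sigma>
  of odd type fixes e_I itself whenever it preserves I.\<close>

lemma inv_sign_orbits_odd:
  assumes \<sigma>: "\<sigma> permutes X" "finite X" and odd: "\<forall>i\<in>#orbit_sizes X \<sigma>. odd i"
    and I: "finite I" "\<sigma> ` I = I"
  shows "inv_sign \<sigma> I = 1"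
proof -
  define m where "m = (\<Prod>W\<in>orbit \<sigma> ` X. card W)"
  have "odd m"
    unfolding m_def using odd \<sigma>(2) by (auto simp: orbit_sizes_def even_prod_iff)
  have fp: "(\<sigma> ^^ m) x = x" for x
  proof (cases "x \<in> X")
    case True
    hence "card (orbit \<sigma> x) dvd m"
      unfolding m_def using \<sigma>(2) by (intro dvd_prodI) auto
    then obtain r where r: "m = card (orbit \<sigma> x) * r" by auto
    have "((\<sigma> ^^ card (orbit \<sigma> x)) ^^ r) x = x"
      by (induction r) (use orbit_enum(2)[OF \<sigma>] in auto)
    thus ?thesis by (simp add: r funpow_mult)
  next
    case False
    have "\<sigma> ^^ m permutes X" using \<sigma>(1) by (rule funpow_permutes)
    thus ?thesis using False by (simp add: permutes_not_in)
  qed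
  have "inv_sign \<sigma> I ^ m = inv_sign (\<sigma> ^^ m) I" using inv_sign_funpow[OF \<sigma>(1) I] by simp
  also have "\<sigma> ^^ m = id" using fp by auto
  also have "inv_sign id I = 1" by (rule inv_sign_id)
  finally have "inv_sign \<sigma> I ^ m = 1" .
  moreover have "inv_sign \<sigma> I = 1 \<or> inv_sign \<sigma> I = -1"
    using inv_sign_square[of \<sigma> I] by (simp add: square_eq_1_iff)
  ultimately show ?thesis using \<open>odd m\<close> by auto
qed

text \<open>Iteration from x identifies \<sigma> on the orbit with the cyclic shift of {..<m}. The
  enumeration h may scramble the order, but its sign occurs on both sides and squares to 1.\<close>

lemma inv_sign_orbit:
  assumes "\<sigma> permutes X" "finite X"
  shows "inv_sign \<sigma> (orbit \<sigma> x) = (-1) ^ (card (orbit \<sigma> x) - 1)"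
proof -
  let ?m = "card (orbit \<sigma> x)"
  let ?h = "\<lambda>i. (\<sigma> ^^ i) x" and ?c = "\<lambda>i. Suc i mod ?m"
  note h = orbit_enum[OF assms, of x]
  have hinj: "inj_on ?h {..<?m}" and himg: "?h ` {..<?m} = orbit \<sigma> x"
    using h(1) by (auto simp: bij_betw_def)
  have \<sigma>inj: "inj_on \<sigma> A" for A using assms(1) by (metis permutes_inj inj_on_subset subset_UNIV)
  have step: "(\<sigma> \<circ> ?h) i = (?h \<circ> ?c) i" if "i \<in> {..<?m}" for i
    using orbit_enum_step[OF assms, of i x] that by simp
  have "inj_on (?h \<circ> ?c) {..<?m}"
    using comp_inj_on[OF hinj \<sigma>inj] inj_on_cong[of "{..<?m}" "\<sigma> \<circ> ?h" "?h \<circ> ?c"] step by blast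
  hence cinj: "inj_on ?c {..<?m}" by (rule inj_on_imageI2)
  have cimg: "?c ` {..<?m} = {..<?m}"
    by (rule endo_inj_surj[OF _ _ cinj]) (use h(3) in auto)
  have "inv_sign \<sigma> (orbit \<sigma> x) * inv_sign ?h {..<?m} = inv_sign (\<sigma> \<circ> ?h) {..<?m}"
    using inv_sign_comp[OF _ hinj \<sigma>inj] himg by simp
  also have "\<dots> = inv_sign (?h \<circ> ?c) {..<?m}" using step by (rule inv_sign_cong)
  also have "\<dots> = inv_sign ?h {..<?m} * inv_sign ?c {..<?m}"
    using inv_sign_comp[of "{..<?m}" ?c ?h] cinj cimg hinj by simp
  finally have "inv_sign \<sigma> (orbit \<sigma> x) * (inv_sign ?h {..<?m} * inv_sign ?h {..<?m}) =
      inv_sign ?c {..<?m} * (inv_sign ?h {..<?m} * inv_sign ?h {..<?m})"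
    by (simp add: mult_ac)
  thus ?thesis by (simp only: inv_sign_square inv_sign_cycle mult_1_right)
qed

lemma cycle_type_orbit_sizes: "cycle_type n \<sigma> = orbit_sizes {1..n} \<sigma>"
  by (simp add: cycle_type_def orbit_sizes_def)

lemma card_cycle_type:
  assumes "\<alpha> \<in> odd_partitions n"
  shows "card {\<sigma>. \<sigma> permutes {1..n} \<and> cycle_type n \<sigma> = \<alpha>} * zee \<alpha> = fact n"
  using card_permutes_orbit_sizes[of "{1..n}" \<alpha>] assms
  by (force simp: odd_partitions_def cycle_type_orbit_sizes)

text \<open>The choice succeeds because the number of candidates, multiplied by \<open>zee\<close>,
  is n! and so is not 0.\<close>

lemma perm_of_type:
  assumes "\<alpha> \<in> odd_partitions n"
  shows "perm_of_type n \<alpha> permutes {1..n} \<and> cycle_type n (perm_of_type n \<alpha>) = \<alpha>"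
proof -
  have "card {\<sigma>. \<sigma> permutes {1..n} \<and> cycle_type n \<sigma> = \<alpha>} \<noteq> 0"
    using card_cycle_type[OF assms] by (metis fact_nonzero mult_0)
  hence "\<exists>\<sigma>. \<sigma> permutes {1..n} \<and> cycle_type n \<sigma> = \<alpha>" by (metis (mono_tags, lifting) card.empty empty_Collect_eq)
  thus ?thesis unfolding perm_of_type_def by (rule someI_ex)
qed

text \<open>The permutations of type \<alpha> number n!/z_\<alpha>, so the average over the group
  collapses to the weights 1/z_\<alpha> of \<open>ch_minus\<close>. Invariance is demanded only in
  odd classes, since the application controls the signs \<open>u\<close> only there.\<close>

lemma sum_class_function:
  fixes F :: "(nat \<Rightarrow> nat) \<Rightarrow> complex"
  assumes conj: "\<And>\<sigma> \<tau> \<pi>. \<sigma> permutes {1..n} \<Longrightarrow> \<tau> permutes {1..n} \<Longrightarrow> \<pi> permutes {1..n} \<Longrightarrow>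
      \<pi> \<circ> \<sigma> = \<tau> \<circ> \<pi> \<Longrightarrow> cycle_type n \<sigma> \<in> odd_partitions n \<Longrightarrow>
      cycle_type n \<tau> = cycle_type n \<sigma> \<Longrightarrow> F \<sigma> = F \<tau>"
    and zero: "\<And>\<sigma>. \<sigma> permutes {1..n} \<Longrightarrow> cycle_type n \<sigma> \<notin> odd_partitions n \<Longrightarrow> F \<sigma> = 0"
  shows "(\<Sum>\<sigma> | \<sigma> permutes {1..n}. F \<sigma>) / fact n =
     (\<Sum>\<alpha>\<in>odd_partitions n. F (perm_of_type n \<alpha>) / of_nat (zee \<alpha>))"
proof -
  let ?G = "{\<sigma>. \<sigma> permutes {1..n}}"
  let ?P = "\<lambda>\<alpha>. {\<sigma>. \<sigma> permutes {1..n} \<and> cycle_type n \<sigma> = \<alpha>}"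
  have finG: "finite ?G" by (simp add: finite_permutations)
  have "odd_partitions n \<subseteq> cycle_type n ` ?G" using perm_of_type by (auto simp: image_iff) metis
  hence fin: "finite (odd_partitions n)" using finG finite_subset by blast
  have "(\<Sum>\<sigma>\<in>?G. F \<sigma>) = (\<Sum>\<sigma>\<in>{\<sigma> \<in> ?G. cycle_type n \<sigma> \<in> odd_partitions n}. F \<sigma>)"
    using finG zero by (intro sum.mono_neutral_right) auto
  also have "\<dots> = (\<Sum>\<alpha>\<in>odd_partitions n. \<Sum>\<sigma>\<in>{\<sigma> \<in> {\<sigma> \<in> ?G. cycle_type n \<sigma> \<in> odd_partitions n}. cycle_type n \<sigma> = \<alpha>}. F \<sigma>)"
    using finG fin by (intro sum.group[symmetric]) auto
  also have "\<dots> = (\<Sum>\<alpha>\<in>odd_partitions n. \<Sum>\<sigma>\<in>?P \<alpha>. F (perm_of_type n \<alpha>))"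
  proof (intro sum.cong)
    fix \<alpha> assume \<alpha>: "\<alpha> \<in> odd_partitions n"
    show "{\<sigma> \<in> {\<sigma> \<in> ?G. cycle_type n \<sigma> \<in> odd_partitions n}. cycle_type n \<sigma> = \<alpha>} = ?P \<alpha>"
      using \<alpha> by auto
    fix \<sigma> assume \<sigma>: "\<sigma> \<in> ?P \<alpha>"
    note \<tau> = perm_of_type[OF \<alpha>]
    obtain \<pi> where "\<pi> permutes {1..n}" "\<pi> \<circ> \<sigma> = perm_of_type n \<alpha> \<circ> \<pi>"
      using same_cycle_type_imp_conjugate[of \<sigma> n "perm_of_type n \<alpha>"] \<sigma> \<tau> by auto
    thus "F \<sigma> = F (perm_of_type n \<alpha>)" using \<sigma> \<tau> \<alpha> conj by simp
  qed auto
  also have "\<dots> = (\<Sum>\<alpha>\<in>odd_partitions n. F (perm_of_type n \<alpha>) / of_nat (zee \<alpha>) * fact n)"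
  proof (rule sum.cong[OF refl])
    fix \<alpha> assume \<alpha>: "\<alpha> \<in> odd_partitions n"
    have "of_nat (card (?P \<alpha>)) * of_nat (zee \<alpha>) = (fact n :: complex)"
      by (simp only: card_cycle_type[OF \<alpha>] of_nat_fact flip: of_nat_mult)
    moreover have "zee \<alpha> \<noteq> 0" using card_cycle_type[OF \<alpha>] by (metis fact_nonzero mult_0_right)
    ultimately show "(\<Sum>\<sigma>\<in>?P \<alpha>. F (perm_of_type n \<alpha>)) = F (perm_of_type n \<alpha>) / of_nat (zee \<alpha>) * fact n"
      by (subst \<open>_ = fact n\<close>[symmetric]) (simp add: field_simps)
  qed
  also have "\<dots> = (\<Sum>\<alpha>\<in>odd_partitions n. F (perm_of_type n \<alpha>) / of_nat (zee \<alpha>)) * fact n"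
    by (rule sum_distrib_right[symmetric])
  finally show ?thesis by simp
qed

section \<open>Modules over the Hecke-Clifford algebra\<close>

context vector_space
begin

text \<open>The trace of an idempotent is its rank: the maps \<open>ev x\<close> are coordinates of an ambient
  coordinate space and \<open>E x\<close> is the image of the \<open>x\<close>-th basis vector under a projection onto \<open>H\<close>.\<close>

lemma dim_eq_sum_coordinates:
  fixes ev :: "'x \<Rightarrow> 'b \<Rightarrow> 'a" and E :: "'x \<Rightarrow> 'b"
  assumes H: "subspace H" and X: "finite X"
    and ev_add: "\<And>x f g. f \<in> H \<Longrightarrow> g \<in> H \<Longrightarrow> ev x (f + g) = ev x f + ev x g"
    and ev_scale: "\<And>x c f. f \<in> H \<Longrightarrow> ev x (scale c f) = c * ev x f"
    and E: "\<And>x. x \<in> X \<Longrightarrow> E x \<in> H"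
    and expand: "\<And>f. f \<in> H \<Longrightarrow> f = (\<Sum>x\<in>X. scale (ev x f) (E x))"
  shows "of_nat (dim H) = (\<Sum>x\<in>X. ev x (E x))"
proof -
  obtain C where C: "C \<subseteq> H" "independent C" "H \<subseteq> span C" "card C = dim H"
    using basis_exists by blast
  have spanC: "span C = H" using C H by (simp add: span_minimal subset_antisym)
  have "H \<subseteq> span (E ` X)"
  proof
    fix f assume f: "f \<in> H"
    have "(\<Sum>x\<in>X. scale (ev x f) (E x)) \<in> span (E ` X)"
      by (intro span_sum span_scale span_base imageI)
    thus "f \<in> span (E ` X)" using expand[OF f] by simp
  qed
  hence finC: "finite C" using independent_span_bound[of "E ` X" C] C X by auto
  have ev_sum: "ev x (\<Sum>i\<in>I. scale (c i) (v i)) = (\<Sum>i\<in>I. c i * ev x (v i))"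
    if "finite I" "\<And>i. i \<in> I \<Longrightarrow> v i \<in> H" for x and I :: "'b set" and c v
    using that
  proof (induction I rule: finite_induct)
    case empty
    have "ev x (scale 0 0) = 0" using ev_scale[of 0 x 0] H subspace_0 by auto
    thus ?case by simp
  next
    case (insert i I)
    have "(\<Sum>i\<in>I. scale (c i) (v i)) \<in> H"
      using insert.prems H by (intro subspace_sum subspace_scale) auto
    with insert H show ?case by (simp add: ev_add ev_scale subspace_scale)
  qed
  let ?\<phi> = "representation C"
  have "(\<Sum>x\<in>X. ev x (E x)) = (\<Sum>x\<in>X. \<Sum>w\<in>C. ?\<phi> (E x) w * ev x w)"
  proof (rule sum.cong[OF refl])
    fix x assume x: "x \<in> X"
    have "(\<Sum>w\<in>C. scale (?\<phi> (E x) w) w) = E x"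
      by (rule sum_representation_eq) (use C E[OF x] spanC finC in auto)
    thus "ev x (E x) = (\<Sum>w\<in>C. ?\<phi> (E x) w * ev x w)"
      using ev_sum[of C "\<lambda>w. w" x "?\<phi> (E x)"] finC C(1) by auto
  qed
  \<comment> \<open>After the swap, the inner sum is a coordinate of the expansion of the basis
    vector w of H, and that expansion is w itself.\<close>
  also have "\<dots> = (\<Sum>w\<in>C. \<Sum>x\<in>X. ev x w * ?\<phi> (E x) w)"
    by (subst sum.swap) (simp add: mult.commute)
  also have "\<dots> = (\<Sum>w\<in>C. ?\<phi> (\<Sum>x\<in>X. scale (ev x w) (E x)) w)"
    using C(2) E spanC
    by (subst representation_sum) (auto simp: representation_scale span_scale)
  also have "\<dots> = (\<Sum>w\<in>C. ?\<phi> w w)"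
    using expand C(1) by (intro sum.cong refl) (metis subsetD)
  also have "\<dots> = (\<Sum>w\<in>C. 1)"
    using C(2) by (intro sum.cong refl) (simp add: representation_basis)
  finally show ?thesis using C(4) by simp
qed

end

lemma fscale_apply [simp]: "fscale c f x = c * f x"
  by (simp add: fscale_def)

lemma cl_mult_cl_perm_bvec:
  assumes "\<sigma> permutes {1..n}" "I \<subseteq> {1..n}" "J \<subseteq> {1..n}"
  shows "cl_mult n (bvec I) (cl_perm n \<sigma> (bvec J)) =
    fscale (inv_sign \<sigma> J * merge_sign I (\<sigma> ` J)) (bvec (sym_diff I (\<sigma> ` J)))"
proof -
  have "\<sigma> ` J \<subseteq> {1..n}" using assms by (metis image_mono permutes_image)
  thus ?thesis using assms
    by (simp only: cl_perm_bvec cl_mult_fscale cl_mult_bvec) (simp add: fun_eq_iff mult.assoc)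
qed

lemma tensor_fscale_bvec:
  "tensor (fscale c (bvec x)) (fscale d (bvec y)) = fscale (c * d) (bvec (x, y))"
  by (auto simp: tensor_def bvec_def fun_eq_iff)

lemma hc_mult_bvec:
  assumes "(I, \<sigma>) \<in> hc_basis n" "(J, \<tau>) \<in> hc_basis n"
  shows "hc_mult n (bvec (I, \<sigma>)) (bvec (J, \<tau>)) =
    fscale (inv_sign \<sigma> J * merge_sign I (\<sigma> ` J)) (bvec (sym_diff I (\<sigma> ` J), \<sigma> \<circ> \<tau>))"
proof -
  have fin: "finite (hc_basis n)" by (simp add: hc_basis_def finite_permutations)
  have \<sigma>: "\<sigma> permutes {1..n}" "I \<subseteq> {1..n}" "J \<subseteq> {1..n}" using assms by (auto simp: hc_basis_def)
  let ?T = "\<lambda>a b. tensor (cl_mult n (bvec (fst a)) (cl_perm n (snd a) (bvec (fst b)))) (bvec (snd a \<circ> snd b))"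
  have "hc_mult n (bvec (I, \<sigma>)) (bvec (J, \<tau>)) =
      (\<Sum>a\<in>hc_basis n. \<Sum>b\<in>hc_basis n. fscale (bvec (I, \<sigma>) a * bvec (J, \<tau>) b) (?T a b))"
    by (simp add: hc_mult_def split_def)
  also have "\<dots> = (\<Sum>a\<in>hc_basis n. fscale (bvec (I, \<sigma>) a) (?T a (J, \<tau>)))"
    using fin assms(2) by (intro sum.cong refl) (subst sum_fscale_bvec, auto)
  also have "\<dots> = ?T (I, \<sigma>) (J, \<tau>)"
    using fin assms(1) by (rule sum_fscale_bvec')
  also have "\<dots> = fscale (inv_sign \<sigma> J * merge_sign I (\<sigma> ` J)) (bvec (sym_diff I (\<sigma> ` J), \<sigma> \<circ> \<tau>))"
    using tensor_fscale_bvec[of _ _ 1 "\<sigma> \<circ> \<tau>"]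
    by (simp only: fst_conv snd_conv cl_mult_cl_perm_bvec[OF \<sigma>]) (simp add: fscale_def)
  finally show ?thesis .
qed

text \<open>The group permutes the basis (\<open>op\<close>) up to signs (\<open>u\<close>), as it
  does on S^iV, \<and>^jV and their tensor products. The trace of \<sigma> is then the sum of
  \<open>u \<sigma> y\<close> over the fixed basis elements y; \<open>u_comp\<close> is the cocycle
  rule for the signs.\<close>

locale monomial_rep =
  fixes n :: nat and M :: "'b srep"
    and op :: "(nat \<Rightarrow> nat) \<Rightarrow> 'b \<Rightarrow> 'b" and u :: "(nat \<Rightarrow> nat) \<Rightarrow> 'b \<Rightarrow> complex"
  assumes finite_basis: "finite (basis M)"
    and op_in: "\<sigma> permutes {1..n} \<Longrightarrow> y \<in> basis M \<Longrightarrow> op \<sigma> y \<in> basis M"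
    and op_id: "y \<in> basis M \<Longrightarrow> op id y = y"
    and op_comp: "\<sigma> permutes {1..n} \<Longrightarrow> \<tau> permutes {1..n} \<Longrightarrow> y \<in> basis M \<Longrightarrow>
        op (\<sigma> \<circ> \<tau>) y = op \<sigma> (op \<tau> y)"
    and u_comp: "\<sigma> permutes {1..n} \<Longrightarrow> \<tau> permutes {1..n} \<Longrightarrow> y \<in> basis M \<Longrightarrow>
        u (\<sigma> \<circ> \<tau>) y = u \<sigma> (op \<tau> y) * u \<tau> y"
    and u_square: "u \<sigma> y * u \<sigma> y = 1"
    and rho_bvec: "\<sigma> permutes {1..n} \<Longrightarrow> y \<in> basis M \<Longrightarrow>
        rho M \<sigma> (bvec y) = fscale (u \<sigma> y) (bvec (op \<sigma> y))"
begin

abbreviation "N \<equiv> cl_tensor n M"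

lemma op_inverse:
  assumes "\<sigma> permutes {1..n}" "y \<in> basis M"
  shows "op \<sigma> (op (inv \<sigma>) y) = y" "op (inv \<sigma>) (op \<sigma> y) = y"
  using assms op_comp[of \<sigma> "inv \<sigma>" y] op_comp[of "inv \<sigma>" \<sigma> y] op_id
  by (simp_all add: permutes_inv permutes_inv_o)

lemma op_eq_iff:
  assumes "\<sigma> permutes {1..n}" "y \<in> basis M" "z \<in> basis M"
  shows "op \<sigma> y = op \<sigma> z \<longleftrightarrow> y = z"
  using assms op_inverse by metis

lemma u_id: "y \<in> basis M \<Longrightarrow> u id y = 1"
  using u_comp[of id id y] u_square[of id y] op_id[of y] by (simp add: permutes_id)

lemma act_tensor_bvec:
  assumes "(J, \<sigma>) \<in> hc_basis n"
  shows "act N (bvec (J, \<sigma>)) h =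
    (\<Sum>(L, y)\<in>Pow {1..n} \<times> basis M. fscale (h (L, y) * inv_sign \<sigma> L * merge_sign J (\<sigma> ` L) * u \<sigma> y)
       (bvec (sym_diff J (\<sigma> ` L), op \<sigma> y)))"
proof -
  have fin: "finite (hc_basis n)" by (simp add: hc_basis_def finite_permutations)
  have \<sigma>: "\<sigma> permutes {1..n}" "J \<subseteq> {1..n}" using assms by (auto simp: hc_basis_def)
  let ?T = "\<lambda>g. tensor_map (Pow {1..n}) (basis M)
      (\<lambda>v. cl_mult n (bvec (fst g)) (cl_perm n (snd g) v)) (rho M (snd g)) h"
  have "act N (bvec (J, \<sigma>)) h = (\<Sum>g\<in>hc_basis n. fscale (bvec (J, \<sigma>) g) (?T g))"
    by (simp add: cl_tensor_def split_def)
  also have "\<dots> = ?T (J, \<sigma>)" using fin assms by (rule sum_fscale_bvec')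
  also have "\<dots> = (\<Sum>(L, y)\<in>Pow {1..n} \<times> basis M. fscale (h (L, y))
      (tensor (fscale (inv_sign \<sigma> L * merge_sign J (\<sigma> ` L)) (bvec (sym_diff J (\<sigma> ` L))))
        (fscale (u \<sigma> y) (bvec (op \<sigma> y)))))"
    unfolding tensor_map_def
  proof (intro sum.cong refl, clarify)
    fix L y assume L: "L \<subseteq> {1..n}" and y: "y \<in> basis M"
    have "cl_mult n (bvec J) (cl_perm n \<sigma> (bvec L)) =
        fscale (inv_sign \<sigma> L * merge_sign J (\<sigma> ` L)) (bvec (sym_diff J (\<sigma> ` L)))"
      using \<sigma> L by (rule cl_mult_cl_perm_bvec)
    thus "fscale (h (L, y)) (tensor (cl_mult n (bvec (fst (J, \<sigma>))) (cl_perm n (snd (J, \<sigma>)) (bvec L)))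
          (rho M (snd (J, \<sigma>)) (bvec y))) =
        fscale (h (L, y))
      (tensor (fscale (inv_sign \<sigma> L * merge_sign J (\<sigma> ` L)) (bvec (sym_diff J (\<sigma> ` L))))
        (fscale (u \<sigma> y) (bvec (op \<sigma> y))))"
      using rho_bvec[OF \<sigma>(1) y] by simp
  qed
  also have "\<dots> = (\<Sum>(L, y)\<in>Pow {1..n} \<times> basis M.
      fscale (h (L, y) * inv_sign \<sigma> L * merge_sign J (\<sigma> ` L) * u \<sigma> y)
       (bvec (sym_diff J (\<sigma> ` L), op \<sigma> y)))"
    by (intro sum.cong refl) (auto simp: tensor_fscale_bvec fun_eq_iff)
  finally show ?thesis .
qed

text \<open>The element c_J \<sigma> permutes the basis up to signs, so exactly one summand of
  \<open>act_tensor_bvec\<close> reaches the given index.\<close>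

lemma act_tensor_apply:
  assumes J: "(J, \<sigma>) \<in> hc_basis n" and L: "L \<subseteq> {1..n}" and y: "y \<in> basis M"
  shows "act N (bvec (J, \<sigma>)) h (sym_diff J (\<sigma> ` L), op \<sigma> y) =
    h (L, y) * inv_sign \<sigma> L * merge_sign J (\<sigma> ` L) * u \<sigma> y"
proof -
  have \<sigma>: "\<sigma> permutes {1..n}" using J by (auto simp: hc_basis_def)
  let ?c = "\<lambda>L y. h (L, y) * inv_sign \<sigma> L * merge_sign J (\<sigma> ` L) * u \<sigma> y"
  have eq: "sym_diff J (\<sigma> ` L) = sym_diff J (\<sigma> ` L') \<longleftrightarrow> L' = L" for L'
  proof -
    have "sym_diff J (\<sigma> ` L) = sym_diff J (\<sigma> ` L') \<longleftrightarrow> \<sigma> ` L = \<sigma> ` L'" by blast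
    thus ?thesis using permutes_inj[OF \<sigma>] by (auto simp: inj_image_eq_iff)
  qed
  have "act N (bvec (J, \<sigma>)) h (sym_diff J (\<sigma> ` L), op \<sigma> y) =
    (\<Sum>p\<in>Pow {1..n} \<times> basis M. if p = (L, y) then ?c L y else 0)"
    unfolding act_tensor_bvec[OF J] sum_fun_apply
    by (intro sum.cong refl) (auto simp: bvec_def eq op_eq_iff[OF \<sigma>] y split: if_splits)
  also have "\<dots> = ?c L y" using L y finite_basis by simp
  finally show ?thesis .
qed

lemma act_tensor_sum:
  "act N a h = (\<Sum>g\<in>hc_basis n. fscale (a g) (act N (bvec g) h))"
proof -
  have fin: "finite (hc_basis n)" by (simp add: hc_basis_def finite_permutations)
  let ?T = "\<lambda>g. tensor_map (Pow {1..n}) (basis M)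
      (\<lambda>v. cl_mult n (bvec (fst g)) (cl_perm n (snd g) v)) (rho M (snd g)) h"
  have *: "act N a h = (\<Sum>g\<in>hc_basis n. fscale (a g) (?T g))" for a
    by (simp add: cl_tensor_def split_def)
  have "act N (bvec g) h = ?T g" if "g \<in> hc_basis n" for g
    unfolding * using fin that by (rule sum_fscale_bvec')
  thus ?thesis unfolding *[of a] by simp
qed

lemma smult_tensor [simp]: "smult N = fscale"
  by (simp add: cl_tensor_def)

lemma part_tensor:
  "part N k = coord_space ({I \<in> Pow {1..n}. card I mod 2 = k} \<times> basis M)"
  by (simp add: cl_tensor_def)

lemma tensor_apply_outside:
  assumes "h \<in> sm_carrier N" "\<not> (I \<subseteq> {1..n} \<and> y \<in> basis M)"
  shows "h (I, y) = 0"
proof -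
  obtain f g where fg: "f \<in> part N 0" "g \<in> part N 1" "h = f + g"
    using assms(1) unfolding sm_carrier_def by blast
  have "f (I, y) = 0" "g (I, y) = 0"
    using fg(1,2) assms(2) unfolding part_tensor coord_space_def by blast+
  thus ?thesis using fg(3) by simp
qed

end

text \<open>The projection to the part of parity k along the other part, whose index is 1 - k. A
  supermodule records its parts only as subsets, so the component is chosen; directness of the sum
  makes it unique in \<open>pr_eqI\<close>.\<close>

definition grade_proj :: "'v::ab_group_add supermodule \<Rightarrow> nat \<Rightarrow> 'v \<Rightarrow> 'v" where
  "grade_proj D k x = (SOME y. y \<in> part D k \<and> x - y \<in> part D (1 - k))"

context hc_module
begin

sublocale V: vector_space "smult M"
  by (rule vector_space)

abbreviation "carr \<equiv> sm_carrier M"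
abbreviation "pr \<equiv> grade_proj M"

lemma sub0: "V.subspace (part M 0)" and sub1: "V.subspace (part M 1)"
  using subspace_part by auto

lemma subspace_carrier: "V.subspace carr"
  unfolding sm_carrier_def by (rule V.subspace_sums[OF sub0 sub1])

lemma part_subset: "k \<in> {0, 1} \<Longrightarrow> part M k \<subseteq> carr"
  using V.subspace_0[OF sub0] V.subspace_0[OF sub1] unfolding sm_carrier_def by force

lemma pr_eqI:
  assumes "k \<in> {0, 1}" "y \<in> part M k" "z \<in> part M (1 - k)"
  shows "pr k (y + z) = y"
  unfolding grade_proj_def
proof (rule some_equality)
  show "y \<in> part M k \<and> y + z - y \<in> part M (1 - k)" using assms by simp
  fix y' assume y': "y' \<in> part M k \<and> y + z - y' \<in> part M (1 - k)"
  have "1 - k \<in> {0, 1}" using assms(1) by auto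
  hence "y + z - y' - z \<in> part M (1 - k)"
    using y' assms V.subspace_diff[OF subspace_part] by blast
  moreover have "y - y' \<in> part M k"
    using y' assms V.subspace_diff[OF subspace_part] by blast
  ultimately have "y - y' \<in> part M 0 \<inter> part M 1" using assms(1) by auto
  thus "y' = y" unfolding direct by simp
qed

lemma pr_decomp:
  assumes "k \<in> {0, 1}" "x \<in> carr"
  shows pr_in: "pr k x \<in> part M k" and pr_sum': "pr k x + pr (1 - k) x = x"
proof -
  obtain y z where yz: "y \<in> part M k" "z \<in> part M (1 - k)" "x = y + z"
  proof -
    obtain a b where "a \<in> part M 0" "b \<in> part M 1" "x = a + b"
      using assms(2) by (auto simp: sm_carrier_def)
    with assms(1) that[of a b] that[of b a] show thesis by (auto simp: add.commute)
  qed
  have "pr k x = y" using pr_eqI[OF assms(1) yz(1,2)] yz(3) by simp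
  moreover have "pr (1 - k) x = z"
    using pr_eqI[of "1 - k" z y] yz assms(1) by (auto simp: add.commute)
  ultimately show "pr k x \<in> part M k" "pr k x + pr (1 - k) x = x" using yz by simp_all
qed

lemma pr_carrier: "k \<in> {0, 1} \<Longrightarrow> x \<in> carr \<Longrightarrow> pr k x \<in> carr"
  using pr_in part_subset by blast

lemma pr_sum: "x \<in> carr \<Longrightarrow> pr 0 x + pr 1 x = x"
  using pr_sum'[of 0 x] by simp

lemma pr_part:
  assumes "k \<in> {0, 1}" "l \<in> {0, 1}" "x \<in> part M l"
  shows "pr k x = (if k = l then x else 0)"
proof (cases "k = l")
  case True
  have "0 \<in> part M (1 - k)" using V.subspace_0[OF subspace_part[of "1 - k"]] assms(1) by auto
  thus ?thesis using pr_eqI[of k x 0] assms True by simp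
next
  case False
  hence "l = 1 - k" using assms by auto
  moreover have "0 \<in> part M k" using V.subspace_0[OF subspace_part] assms by auto
  ultimately show ?thesis using pr_eqI[of k 0 x] assms False by simp
qed

lemma pr_add:
  assumes k: "k \<in> {0, 1}" and x: "x \<in> carr" and y: "y \<in> carr"
  shows "pr k (x + y) = pr k x + pr k y"
proof -
  have k': "1 - k \<in> {0, 1}" using k by auto
  have "x + y = (pr k x + pr k y) + (pr (1 - k) x + pr (1 - k) y)"
    by (subst (1) pr_sum'[OF k x, symmetric], subst (1) pr_sum'[OF k y, symmetric]) (simp only: add_ac)
  moreover have "pr k x + pr k y \<in> part M k" "pr (1 - k) x + pr (1 - k) y \<in> part M (1 - k)"
    using k k' x y by (auto intro!: V.subspace_add[OF subspace_part] pr_in)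
  ultimately show ?thesis using pr_eqI[OF k] by simp
qed

lemma pr_smult:
  assumes k: "k \<in> {0, 1}" and x: "x \<in> carr"
  shows "pr k (smult M c x) = smult M c (pr k x)"
proof -
  have k': "1 - k \<in> {0, 1}" using k by auto
  have "smult M c x = smult M c (pr k x) + smult M c (pr (1 - k) x)"
    by (simp only: V.scale_right_distrib[symmetric] pr_sum'[OF k x])
  moreover have "smult M c (pr k x) \<in> part M k" "smult M c (pr (1 - k) x) \<in> part M (1 - k)"
    using k k' x by (auto intro!: V.subspace_scale[OF subspace_part] pr_in)
  ultimately show ?thesis using pr_eqI[OF k] by simp
qed

lemma bvec_hc: "g \<in> hc_basis n \<Longrightarrow> bvec g \<in> coord_space (hc_basis n)"
  by (auto simp: coord_space_def bvec_def)

lemma bvec_hc_part: "(I, \<sigma>) \<in> hc_basis n \<Longrightarrow> bvec (I, \<sigma>) \<in> hc_part n (card I mod 2)"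
  by (auto simp: coord_space_def bvec_def hc_part_def)

lemma act_bvec_part:
  assumes "(I, \<sigma>) \<in> hc_basis n" "l \<in> {0, 1}" "x \<in> part M l"
  shows "act M (bvec (I, \<sigma>)) x \<in> part M ((card I + l) mod 2)"
proof -
  have "act M (bvec (I, \<sigma>)) x \<in> part M ((card I mod 2 + l) mod 2)"
    using assms bvec_hc_part by (intro graded) auto
  thus ?thesis by (simp add: mod_add_left_eq)
qed

lemma act_bvec_carrier:
  assumes g: "g \<in> hc_basis n" and x: "x \<in> carr"
  shows "act M (bvec g) x \<in> carr"
proof -
  obtain I \<sigma> where I: "g = (I, \<sigma>)" by (cases g)
  have "act M (bvec g) (pr k x) \<in> carr" if k: "k \<in> {0, 1}" for k
  proof -
    have "(card I + k) mod 2 \<in> {0, 1}" by auto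
    moreover have "act M (bvec g) (pr k x) \<in> part M ((card I + k) mod 2)"
      unfolding I by (rule act_bvec_part[OF g[unfolded I] k pr_in[OF k x]])
    ultimately show ?thesis by (rule subsetD[OF part_subset])
  qed
  hence "act M (bvec g) (pr 0 x) \<in> carr" "act M (bvec g) (pr 1 x) \<in> carr" by blast+
  moreover have "act M (bvec g) x = act M (bvec g) (pr 0 x) + act M (bvec g) (pr 1 x)"
    using act_add_right[OF bvec_hc[OF g] pr_carrier[OF _ x] pr_carrier[OF _ x], of 0 1]
    by (simp only: pr_sum[OF x] insert_iff simp_thms)
  ultimately show ?thesis using V.subspace_add[OF subspace_carrier] by simp
qed

text \<open>c_I \<sigma> shifts parity by |I|, so the component of parity k of the result comes from
  the component of parity k - |I|, which modulo 2 is k + |I|.\<close>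

lemma pr_act_bvec:
  assumes g: "(I, \<sigma>) \<in> hc_basis n" and x: "x \<in> carr" and k: "k \<in> {0, 1}"
  shows "pr k (act M (bvec (I, \<sigma>)) x) = act M (bvec (I, \<sigma>)) (pr ((k + card I) mod 2) x)"
proof -
  let ?l = "(k + card I) mod 2"
  have l: "?l \<in> {0, 1}" and l': "1 - ?l \<in> {0, 1}" by auto
  have "act M (bvec (I, \<sigma>)) x = act M (bvec (I, \<sigma>)) (pr ?l x) + act M (bvec (I, \<sigma>)) (pr (1 - ?l) x)"
    using act_add_right[OF bvec_hc[OF g] pr_carrier[OF l x] pr_carrier[OF l' x]]
    by (simp only: pr_sum'[OF l x])
  moreover have "(card I + ?l) mod 2 = k" "(card I + (1 - ?l)) mod 2 = 1 - k"
    using k by auto presburger+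
  hence "act M (bvec (I, \<sigma>)) (pr ?l x) \<in> part M k" "act M (bvec (I, \<sigma>)) (pr (1 - ?l) x) \<in> part M (1 - k)"
    using act_bvec_part[OF g l pr_in[OF l x]] act_bvec_part[OF g l' pr_in[OF l' x]] by auto
  ultimately show ?thesis using pr_eqI[OF k] by simp
qed

lemma act_zero_left: "x \<in> carr \<Longrightarrow> act M 0 x = 0"
proof -
  assume "x \<in> carr"
  moreover have "fscale 0 (0 :: hc) = 0" "(0 :: hc) \<in> coord_space (hc_basis n)"
    by (simp_all add: fun_eq_iff coord_space_def)
  ultimately show ?thesis using act_smult_left[of 0 x 0] by simp
qed

lemma act_sum:
  assumes a: "a \<in> coord_space (hc_basis n)" and x: "x \<in> carr"
  shows "act M a x = (\<Sum>g\<in>hc_basis n. smult M (a g) (act M (bvec g) x))"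
proof -
  have fin: "finite (hc_basis n)" by (simp add: hc_basis_def finite_permutations)
  have *: "act M (\<Sum>g\<in>G. fscale (a g) (bvec g)) x = (\<Sum>g\<in>G. smult M (a g) (act M (bvec g) x)) \<and>
      (\<Sum>g\<in>G. fscale (a g) (bvec g)) \<in> coord_space (hc_basis n)"
    if "finite G" "G \<subseteq> hc_basis n" for G
    using that
  proof (induction G rule: finite_induct)
    case empty
    show ?case
      by (simp only: sum.empty act_zero_left[OF x]) (simp add: coord_space_def)
  next
    case (insert g G)
    have g: "bvec g \<in> coord_space (hc_basis n)" "fscale (a g) (bvec g) \<in> coord_space (hc_basis n)"
      using insert.prems by (auto simp: coord_space_def bvec_def)
    have IH: "act M (\<Sum>g\<in>G. fscale (a g) (bvec g)) x = (\<Sum>g\<in>G. smult M (a g) (act M (bvec g) x))"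
      "(\<Sum>g\<in>G. fscale (a g) (bvec g)) \<in> coord_space (hc_basis n)"
      using conjunct1[OF insert.IH] conjunct2[OF insert.IH] insert.prems by blast+
    have "fscale (a g) (bvec g) + (\<Sum>g\<in>G. fscale (a g) (bvec g)) \<in> coord_space (hc_basis n)"
      using g(2) IH(2) unfolding coord_space_def mem_Collect_eq plus_fun_def by auto
    thus ?case
      by (simp only: sum.insert[OF insert.hyps] act_add_left[OF g(2) IH(2) x] act_smult_left[OF g(1) x] IH(1))
  qed
  have "(\<Sum>g\<in>hc_basis n. fscale (a g) (bvec g)) = a"
  proof
    fix g
    have "(\<Sum>g'\<in>hc_basis n. fscale (a g') (bvec g')) g = (\<Sum>g'\<in>hc_basis n. if g' = g then a g else 0)"
      unfolding sum_fun_apply by (intro sum.cong) (auto simp: bvec_def)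
    also have "\<dots> = a g" using fin a by (cases g) (auto simp: coord_space_def)
    finally show "(\<Sum>g'\<in>hc_basis n. fscale (a g') (bvec g')) g = a g" .
  qed
  thus ?thesis using *[OF fin order_refl] by simp
qed

section \<open>The actions of the Clifford elements and of the group\<close>

definition "cl_act I = act M (bvec (I, id))"
definition "gp_act \<sigma> = act M (bvec ({}, \<sigma>))"

lemma hc_basis_cl: "I \<subseteq> {1..n} \<Longrightarrow> (I, id) \<in> hc_basis n"
  by (simp add: hc_basis_def permutes_id)

lemma hc_basis_gp: "\<sigma> permutes {1..n} \<Longrightarrow> ({}, \<sigma>) \<in> hc_basis n"
  by (simp add: hc_basis_def)

lemma act_bvec_bvec:
  assumes "(I, \<sigma>) \<in> hc_basis n" "(J, \<tau>) \<in> hc_basis n" "x \<in> carr"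
  shows "act M (bvec (I, \<sigma>)) (act M (bvec (J, \<tau>)) x) =
    smult M (inv_sign \<sigma> J * merge_sign I (\<sigma> ` J)) (act M (bvec (sym_diff I (\<sigma> ` J), \<sigma> \<circ> \<tau>)) x)"
proof -
  have "(sym_diff I (\<sigma> ` J), \<sigma> \<circ> \<tau>) \<in> hc_basis n"
    using assms permutes_in_image[of \<sigma> "{1..n}"] unfolding hc_basis_def
    by (simp only: mem_Sigma_iff mem_Collect_eq Pow_iff permutes_compose) blast
  thus ?thesis
    using act_mult[OF bvec_hc[OF assms(1)] bvec_hc[OF assms(2)] assms(3)]
    by (simp add: hc_mult_bvec[OF assms(1,2)] act_smult_left bvec_hc assms(3))
qed

lemma cl_act_bvec:
  assumes "K \<subseteq> {1..n}" "(J, \<sigma>) \<in> hc_basis n" "x \<in> carr"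
  shows "cl_act K (act M (bvec (J, \<sigma>)) x) = smult M (merge_sign K J) (act M (bvec (sym_diff K J, \<sigma>)) x)"
  using act_bvec_bvec[OF hc_basis_cl[OF assms(1)] assms(2,3)] by (simp add: cl_act_def inv_sign_id)

lemma gp_act_cl_act:
  assumes "\<sigma> permutes {1..n}" "L \<subseteq> {1..n}" "x \<in> carr"
  shows "gp_act \<sigma> (cl_act L x) = smult M (inv_sign \<sigma> L) (act M (bvec (\<sigma> ` L, \<sigma>)) x)"
  using act_bvec_bvec[OF hc_basis_gp[OF assms(1)] hc_basis_cl[OF assms(2)] assms(3)]
  by (simp add: cl_act_def gp_act_def)

lemma gp_act_gp_act:
  assumes "\<sigma> permutes {1..n}" "\<tau> permutes {1..n}" "x \<in> carr"
  shows "gp_act \<sigma> (gp_act \<tau> x) = gp_act (\<sigma> \<circ> \<tau>) x"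
  using act_bvec_bvec[OF hc_basis_gp[OF assms(1)] hc_basis_gp[OF assms(2)] assms(3)]
  by (simp add: gp_act_def inv_sign_def)

lemma act_empty_id: "x \<in> carr \<Longrightarrow> act M (bvec ({}, id)) x = x"
  using act_one by (simp add: hc_one_def)

lemma cl_act_empty: "x \<in> carr \<Longrightarrow> cl_act {} x = x"
  by (simp add: cl_act_def act_empty_id)

lemma cl_act_carrier: "I \<subseteq> {1..n} \<Longrightarrow> x \<in> carr \<Longrightarrow> cl_act I x \<in> carr"
  unfolding cl_act_def by (intro act_bvec_carrier hc_basis_cl)

lemma gp_act_carrier: "\<sigma> permutes {1..n} \<Longrightarrow> x \<in> carr \<Longrightarrow> gp_act \<sigma> x \<in> carr"
  unfolding gp_act_def by (intro act_bvec_carrier hc_basis_gp)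

lemma pr_cl_act:
  "I \<subseteq> {1..n} \<Longrightarrow> x \<in> carr \<Longrightarrow> k \<in> {0, 1} \<Longrightarrow> pr k (cl_act I x) = cl_act I (pr ((k + card I) mod 2) x)"
  unfolding cl_act_def by (intro pr_act_bvec hc_basis_cl)

lemma pr_gp_act:
  "\<sigma> permutes {1..n} \<Longrightarrow> x \<in> carr \<Longrightarrow> k \<in> {0, 1} \<Longrightarrow> pr k (gp_act \<sigma> x) = gp_act \<sigma> (pr k x)"
  unfolding gp_act_def using pr_act_bvec[of "{}" \<sigma> x k] hc_basis_gp by auto

lemma cl_act_add: "I \<subseteq> {1..n} \<Longrightarrow> x \<in> carr \<Longrightarrow> y \<in> carr \<Longrightarrow> cl_act I (x + y) = cl_act I x + cl_act I y"
  unfolding cl_act_def by (intro act_add_right bvec_hc hc_basis_cl)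

lemma cl_act_smult: "I \<subseteq> {1..n} \<Longrightarrow> x \<in> carr \<Longrightarrow> cl_act I (smult M c x) = smult M c (cl_act I x)"
  unfolding cl_act_def by (intro act_smult_right bvec_hc hc_basis_cl)

lemma gp_act_add: "\<sigma> permutes {1..n} \<Longrightarrow> x \<in> carr \<Longrightarrow> y \<in> carr \<Longrightarrow> gp_act \<sigma> (x + y) = gp_act \<sigma> x + gp_act \<sigma> y"
  unfolding gp_act_def by (intro act_add_right bvec_hc hc_basis_gp)

lemma gp_act_smult: "\<sigma> permutes {1..n} \<Longrightarrow> x \<in> carr \<Longrightarrow> gp_act \<sigma> (smult M c x) = smult M c (gp_act \<sigma> x)"
  unfolding gp_act_def by (intro act_smult_right bvec_hc hc_basis_gp)

lemma zero_carrier: "0 \<in> carr"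
  using V.subspace_0[OF subspace_carrier] .

lemma cl_act_zero: "I \<subseteq> {1..n} \<Longrightarrow> cl_act I 0 = 0"
  using cl_act_smult[of I 0 0] zero_carrier by simp

end

section \<open>Traces and homomorphisms\<close>

lemma minus_one_power_mult_mod_2: "(-1 :: complex) ^ (k * (m mod 2)) = (-1) ^ (k * m)"
  by (cases "even k"; cases "even m") (auto simp: power_mult mod_2_eq_odd)

context monomial_rep
begin

lemma act_tensor_add: "act N a (h + h') = act N a h + act N a h'"
  by (auto simp: cl_tensor_def tensor_map_def fun_eq_iff sum_fun_apply sum_distrib_left
      sum.distrib[symmetric] algebra_simps intro!: sum.cong)

lemma act_tensor_fscale: "act N a (fscale c h) = fscale c (act N a h)"
  by (auto simp: cl_tensor_def tensor_map_def fun_eq_iff sum_fun_apply sum_distrib_left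
      algebra_simps intro!: sum.cong)

end

locale hom_to_cl_tensor = hc_module n D + monomial_rep n M op u
  for n :: nat and D :: "'v::ab_group_add supermodule" and M :: "'b srep"
    and op :: "(nat \<Rightarrow> nat) \<Rightarrow> 'b \<Rightarrow> 'b" and u :: "(nat \<Rightarrow> nat) \<Rightarrow> 'b \<Rightarrow> complex" +
  assumes finite_dim: "sm_finite_dim D"
begin

text \<open>The same choice as inside \<open>trace_on\<close>, so that \<open>tr\<close> is
  literally the trace occurring in \<open>ch_minus\<close>.\<close>

definition "lin_basis = (SOME B. V.independent B \<and> V.span B = carr)"

lemma lin_basis: "V.independent lin_basis" "V.span lin_basis = carr" "finite lin_basis"
proof -
  obtain B where B: "B \<subseteq> carr" "V.independent B" "carr \<subseteq> V.span B"
    using V.basis_exists[of carr] by metis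
  have "V.span B = carr"
    by (rule subset_antisym[OF V.span_minimal[OF B(1) subspace_carrier] B(3)])
  hence "\<exists>B. V.independent B \<and> V.span B = carr" using B(2) by blast
  hence *: "V.independent lin_basis \<and> V.span lin_basis = carr"
    unfolding lin_basis_def by (rule someI_ex)
  thus "V.independent lin_basis" "V.span lin_basis = carr" by blast+
  obtain C where "finite C" "V.span C = carr" using finite_dim by (auto simp: sm_finite_dim_def)
  thus "finite lin_basis"
    using V.independent_span_bound[of C lin_basis] * V.span_superset[of lin_basis] by auto
qed

lemma lin_basis_carrier: "b \<in> lin_basis \<Longrightarrow> b \<in> carr"
  using lin_basis(2) V.span_base by blast

abbreviation "coord \<equiv> V.representation lin_basis"

definition "tr T = (\<Sum>b\<in>lin_basis. coord (T b) b)"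

lemma trace_on_eq_tr: "trace_on (smult D) carr T = tr T"
  by (simp add: trace_on_def tr_def lin_basis_def Let_def)

lemma sum_coord: "x \<in> carr \<Longrightarrow> (\<Sum>b\<in>lin_basis. smult D (coord x b) b) = x"
  by (rule V.sum_representation_eq) (use lin_basis in auto)

text \<open>Linearity is asked for only on the carrier, off which module maps are unconstrained; the
  induction over the basis therefore keeps the partial sums inside the carrier.\<close>

lemma linear_expand:
  fixes T :: "'v \<Rightarrow> 'w::ab_group_add" and sc :: "complex \<Rightarrow> 'w \<Rightarrow> 'w"
  assumes add: "\<And>x y. x \<in> carr \<Longrightarrow> y \<in> carr \<Longrightarrow> T (x + y) = T x + T y"
    and scale: "\<And>c x. x \<in> carr \<Longrightarrow> T (smult D c x) = sc c (T x)"
    and x: "x \<in> carr"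
  shows "T x = (\<Sum>b\<in>lin_basis. sc (coord x b) (T b))"
proof -
  have T0: "T 0 = 0" using add[of 0 0] zero_carrier by simp
  have *: "T (\<Sum>b\<in>B. smult D (c b) b) = (\<Sum>b\<in>B. sc (c b) (T b)) \<and> (\<Sum>b\<in>B. smult D (c b) b) \<in> carr"
    if "finite B" "B \<subseteq> lin_basis" for B c
    using that
  proof (induction B rule: finite_induct)
    case empty
    show ?case using T0 zero_carrier by simp
  next
    case (insert b B)
    have b: "b \<in> carr" "smult D (c b) b \<in> carr"
      using insert.prems lin_basis_carrier V.subspace_scale[OF subspace_carrier] by auto
    moreover have "(\<Sum>b\<in>B. smult D (c b) b) \<in> carr" using insert by blast
    ultimately show ?case
      using insert add[OF b(2)] scale[OF b(1)] V.subspace_add[OF subspace_carrier] by simp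
  qed
  show ?thesis using *[OF lin_basis(3) order_refl, of "coord x"] sum_coord[OF x] by simp
qed

lemma coord_add: "x \<in> carr \<Longrightarrow> y \<in> carr \<Longrightarrow> coord (x + y) b = coord x b + coord y b"
  using lin_basis by (simp add: V.representation_add)

lemma coord_smult: "x \<in> carr \<Longrightarrow> coord (smult D c x) b = c * coord x b"
  using lin_basis by (simp add: V.representation_scale)

definition "linear_on_carrier T \<longleftrightarrow>
    (\<forall>x\<in>carr. T x \<in> carr) \<and> (\<forall>x\<in>carr. \<forall>y\<in>carr. T (x + y) = T x + T y) \<and>
    (\<forall>c. \<forall>x\<in>carr. T (smult D c x) = smult D c (T x))"

lemma tr_comp:
  assumes S: "linear_on_carrier S" and T: "\<And>x. x \<in> carr \<Longrightarrow> T x \<in> carr"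
  shows "tr (S \<circ> T) = (\<Sum>b\<in>lin_basis. \<Sum>b'\<in>lin_basis. coord (T b) b' * coord (S b') b)"
  unfolding tr_def comp_def
proof (rule sum.cong[OF refl])
  fix b assume b: "b \<in> lin_basis"
  show "coord (S (T b)) b = (\<Sum>b'\<in>lin_basis. coord (T b) b' * coord (S b') b)"
    by (rule linear_expand[where T = "\<lambda>x. coord (S x) b"])
       (use S T lin_basis_carrier[OF b] in \<open>auto simp: linear_on_carrier_def coord_add coord_smult\<close>)
qed

lemma tr_commute:
  assumes "linear_on_carrier S" "linear_on_carrier T"
  shows "tr (S \<circ> T) = tr (T \<circ> S)"
  by (subst (1 2) tr_comp, use assms in \<open>auto simp: linear_on_carrier_def\<close>)
     (subst sum.swap, simp add: mult.commute)

lemma tr_cong: "(\<And>x. x \<in> carr \<Longrightarrow> S x = T x) \<Longrightarrow> tr S = tr T"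
  unfolding tr_def using lin_basis_carrier by (intro sum.cong) auto

lemma tr_smult: "linear_on_carrier T \<Longrightarrow> tr (\<lambda>x. smult D c (T x)) = c * tr T"
  using lin_basis_carrier
  by (auto simp: tr_def sum_distrib_left linear_on_carrier_def coord_smult intro!: sum.cong)

lemma linear_gp_act: "\<sigma> permutes {1..n} \<Longrightarrow> linear_on_carrier (gp_act \<sigma>)"
  by (auto simp: linear_on_carrier_def gp_act_carrier gp_act_add gp_act_smult)

lemma linear_cl_act: "I \<subseteq> {1..n} \<Longrightarrow> linear_on_carrier (cl_act I)"
  by (auto simp: linear_on_carrier_def cl_act_carrier cl_act_add cl_act_smult)

lemma linear_comp: "linear_on_carrier S \<Longrightarrow> linear_on_carrier T \<Longrightarrow> linear_on_carrier (S \<circ> T)"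
  by (auto simp: linear_on_carrier_def)

text \<open>\<sigma> = \<pi>^-1 (\<pi> \<sigma>) and \<tau> = (\<pi> \<sigma>) \<pi>^-1 are products
  of the same two factors in opposite orders.\<close>

lemma tr_conjugate:
  assumes "\<sigma> permutes {1..n}" "\<tau> permutes {1..n}" "\<pi> permutes {1..n}" "\<pi> \<circ> \<sigma> = \<tau> \<circ> \<pi>"
  shows "tr (gp_act \<sigma>) = tr (gp_act \<tau>)"
proof -
  have i: "inv \<pi> permutes {1..n}" and ps: "\<pi> \<circ> \<sigma> permutes {1..n}"
    using assms by (simp_all add: permutes_inv permutes_compose)
  have e: "inv \<pi> \<circ> (\<pi> \<circ> \<sigma>) = \<sigma>" "(\<pi> \<circ> \<sigma>) \<circ> inv \<pi> = \<tau>"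
    by (simp only: comp_assoc[symmetric] permutes_inv_o[OF assms(3)] id_comp)
      (simp only: assms(4) comp_assoc permutes_inv_o[OF assms(3)] comp_id)
  have "tr (gp_act \<sigma>) = tr (gp_act (inv \<pi>) \<circ> gp_act (\<pi> \<circ> \<sigma>))"
    by (rule tr_cong) (simp add: gp_act_gp_act[OF i ps] e)
  also have "\<dots> = tr (gp_act (\<pi> \<circ> \<sigma>) \<circ> gp_act (inv \<pi>))"
    using i ps by (intro tr_commute linear_gp_act)
  also have "\<dots> = tr (gp_act \<tau>)"
    by (rule tr_cong) (simp add: gp_act_gp_act[OF ps i] e)
  finally show ?thesis .
qed

text \<open>If \<open>\<sigma>\<close> maps \<open>c\<^sub>I\<close> to \<open>-c\<^sub>I\<close>, then \<open>c\<^sub>I\<close> conjugates \<open>\<sigma>\<close> to \<open>-\<sigma>\<close> up to a scalar.\<close>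

lemma tr_eq_0:
  assumes \<sigma>: "\<sigma> permutes {1..n}" and I: "I \<subseteq> {1..n}" "\<sigma> ` I = I" "inv_sign \<sigma> I = -1"
  shows "tr (gp_act \<sigma>) = 0"
proof -
  let ?c = "cl_act I" and ?s = "gp_act \<sigma>" and ?m = "merge_sign I I"
  have sc: "?s (?c x) = smult D (-1) (?c (?s x))" if "x \<in> carr" for x
    using gp_act_cl_act[OF \<sigma> I(1) that] cl_act_bvec[OF I(1) hc_basis_gp[OF \<sigma>] that] I
    by (simp add: gp_act_def)
  have cc: "?c (?c x) = smult D ?m x" if "x \<in> carr" for x
    using cl_act_bvec[OF I(1) hc_basis_cl[OF I(1)] that] act_empty_id[OF that] by (simp add: cl_act_def)
  note lin = linear_cl_act[OF I(1)] linear_gp_act[OF \<sigma>]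
  \<comment> \<open>The trace of \<sigma> c_I c_I is evaluated in two ways: c_I c_I is the scalar
    ?m, while moving one c_I cyclically to the front and the other one past \<sigma> gives the
    scalar -?m.\<close>
  have "?m * tr ?s = tr (\<lambda>x. smult D ?m (?s x))" by (rule tr_smult[OF lin(2), symmetric])
  also have "\<dots> = tr ((?s \<circ> ?c) \<circ> ?c)"
    by (rule tr_cong) (use I(1) \<sigma> in \<open>simp add: cc gp_act_smult\<close>)
  also have "\<dots> = tr (?c \<circ> (?s \<circ> ?c))"
    using lin by (intro tr_commute linear_comp)
  also have "\<dots> = tr (\<lambda>x. smult D (-1 * ?m) (?s x))"
    by (rule tr_cong) (simp only: o_apply sc cl_act_smult[OF I(1)] cl_act_carrier[OF I(1)]
      gp_act_carrier[OF \<sigma>] cc V.scale_scale)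
  also have "\<dots> = -1 * ?m * tr ?s" by (rule tr_smult[OF lin(2)])
  finally have "?m * tr ?s = 0" by simp
  moreover have "?m \<noteq> 0" using merge_sign_square[of I I] by auto
  ultimately show ?thesis by simp
qed

section \<open>Homomorphisms into the Clifford module and their components at the empty set\<close>

abbreviation "hom_scale \<equiv> (\<lambda>c f (x :: 'v). fscale c (f x :: nat set \<times> 'b \<Rightarrow> complex))"

sublocale H: vector_space hom_scale
  by unfold_locales (auto simp: fun_eq_iff algebra_simps)

lemma dim_Hom_eq: "dim_Hom n D N = H.dim (hc_Hom n D N)"
  by (simp add: dim_Hom_def)

lemma subspace_hc_Hom_part: "H.subspace (hc_Hom_part n D N k)"
proof (rule H.subspaceI)
  have act0: "act N a 0 = 0" for a
    using act_tensor_fscale[of a 0 0] by (simp add: fscale_def zero_fun_def)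
  show "0 \<in> hc_Hom_part n D N k"
    by (auto simp: hc_Hom_part_def act0 part_tensor coord_space_def fun_eq_iff)
next
  fix f g assume f: "f \<in> hc_Hom_part n D N k" and g: "g \<in> hc_Hom_part n D N k"
  show "f + g \<in> hc_Hom_part n D N k"
    unfolding hc_Hom_part_def mem_Collect_eq
  proof (intro conjI ballI allI impI, goal_cases)
    case (3 l x)
    hence "f x \<in> part N ((k + l) mod 2)" "g x \<in> part N ((k + l) mod 2)"
      using f g unfolding hc_Hom_part_def by blast+
    thus ?case by (auto simp: part_tensor coord_space_def)
  next
    case (4 l a x)
    hence "f (act D a x) = fscale ((-1) ^ (k * l)) (act N a (f x))"
      "g (act D a x) = fscale ((-1) ^ (k * l)) (act N a (g x))"
      using f g unfolding hc_Hom_part_def by (simp_all only: mem_Collect_eq smult_tensor)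
    thus ?case by (simp add: act_tensor_add fun_eq_iff algebra_simps)
  qed (use f g in \<open>auto simp: hc_Hom_part_def fun_eq_iff algebra_simps\<close>)
next
  fix c f assume f: "f \<in> hc_Hom_part n D N k"
  show "hom_scale c f \<in> hc_Hom_part n D N k"
    unfolding hc_Hom_part_def mem_Collect_eq
  proof (intro conjI ballI allI impI, goal_cases)
    case (3 l x)
    hence "f x \<in> part N ((k + l) mod 2)"
      using f unfolding hc_Hom_part_def by blast
    thus ?case by (auto simp: part_tensor coord_space_def)
  next
    case (4 l a x)
    hence "f (act D a x) = fscale ((-1) ^ (k * l)) (act N a (f x))"
      using f unfolding hc_Hom_part_def by (simp only: mem_Collect_eq smult_tensor)
    thus ?case by (simp add: act_tensor_fscale fun_eq_iff algebra_simps)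
  qed (use f in \<open>auto simp: hc_Hom_part_def fun_eq_iff algebra_simps\<close>)
qed

lemma subspace_hc_Hom: "H.subspace (hc_Hom n D N)"
  unfolding hc_Hom_def by (intro H.subspace_sums subspace_hc_Hom_part)

context
  fixes k f
  assumes k: "k \<in> {0, 1 :: nat}" and f: "f \<in> hc_Hom_part n D N k"
begin

lemmas hom_conditions = f[unfolded hc_Hom_part_def mem_Collect_eq smult_tensor]

lemma hom_add: "x \<in> carr \<Longrightarrow> y \<in> carr \<Longrightarrow> f (x + y) = f x + f y"
  by (rule hom_conditions[THEN conjunct1, rule_format])

lemma hom_smult: "x \<in> carr \<Longrightarrow> f (smult D c x) = fscale c (f x)"
  by (rule hom_conditions[THEN conjunct2, THEN conjunct1, rule_format])

lemma hom_part: "l \<in> {0, 1} \<Longrightarrow> x \<in> part D l \<Longrightarrow> f x \<in> part N ((k + l) mod 2)"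
  by (rule hom_conditions[THEN conjunct2, THEN conjunct2, THEN conjunct1, rule_format])

lemma hom_act: "l \<in> {0, 1} \<Longrightarrow> a \<in> hc_part n l \<Longrightarrow> x \<in> carr \<Longrightarrow>
    f (act D a x) = fscale ((-1) ^ (k * l)) (act N a (f x))"
  by (rule hom_conditions[THEN conjunct2, THEN conjunct2, THEN conjunct2, THEN conjunct1, rule_format])

lemma hom_outside: "x \<notin> carr \<Longrightarrow> f x = 0"
  by (rule hom_conditions[THEN conjunct2, THEN conjunct2, THEN conjunct2, THEN conjunct2, rule_format])

lemma hom_act_bvec:
  assumes "(J, \<sigma>) \<in> hc_basis n" "x \<in> carr"
  shows "f (act D (bvec (J, \<sigma>)) x) = fscale ((-1) ^ (k * card J)) (act N (bvec (J, \<sigma>)) (f x))"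
proof -
  have "card J mod 2 \<in> {0, 1}" by auto
  from hom_act[OF this bvec_hc_part[OF assms(1)] assms(2)] show ?thesis
    by (simp only: minus_one_power_mult_mod_2)
qed

lemma hom_gp_act:
  assumes "\<sigma> permutes {1..n}" "x \<in> carr" "y \<in> basis M"
  shows "f (gp_act \<sigma> x) ({}, op \<sigma> y) = u \<sigma> y * f x ({}, y)"
  using hom_act_bvec[OF hc_basis_gp[OF assms(1)] assms(2)]
    act_tensor_apply[OF hc_basis_gp[OF assms(1)] _ assms(3), of "{}" "f x"]
  by (simp add: gp_act_def inv_sign_def)

text \<open>The index {} is even, so a map of parity k reaches it only from the part of D of parity
  k.\<close>

lemma hom_pr:
  assumes "x \<in> carr"
  shows "f (pr k x) ({}, y) = f x ({}, y)" "f (pr (1 - k) x) ({}, y) = 0"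
proof -
  have k': "1 - k \<in> {0, 1}" using k by auto
  have "f (pr (1 - k) x) \<in> part N ((k + (1 - k)) mod 2)"
    using pr_in[OF k' assms] by (rule hom_part[OF k'])
  moreover have "(k + (1 - k)) mod 2 = 1" using k by auto
  ultimately show 0: "f (pr (1 - k) x) ({}, y) = 0"
    by (auto simp: part_tensor coord_space_def)
  have "f x = f (pr k x) + f (pr (1 - k) x)"
    using hom_add[OF pr_carrier[OF k assms] pr_carrier[OF k' assms]]
    by (simp only: pr_sum'[OF k assms])
  from fun_cong[OF this, of "({}, y)"] show "f (pr k x) ({}, y) = f x ({}, y)"
    by (simp only: plus_fun_apply 0 add_0_right)
qed

lemma hom_carrier: "f x \<in> sm_carrier N"
proof (cases "x \<in> carr")
  case True
  have "f x = f (pr k x) + f (pr (1 - k) x)"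
    using hom_add[OF pr_carrier[OF k True] pr_carrier[of "1 - k", OF _ True]] k
    by (simp only: pr_sum'[OF k True]) auto
  moreover have "f (pr k x) \<in> part N 0"
    using hom_part[OF k pr_in[OF k True]] k by auto
  moreover have "f (pr (1 - k) x) \<in> part N 1"
    using hom_part[OF _ pr_in[of "1 - k", OF _ True]] k by auto
  ultimately show ?thesis unfolding sm_carrier_def by blast
next
  case False
  have "(0 :: nat set \<times> 'b \<Rightarrow> complex) = 0 + 0" by simp
  moreover have "0 \<in> part N 0" "0 \<in> part N 1" by (auto simp: part_tensor coord_space_def)
  ultimately show ?thesis unfolding hom_outside[OF False] sm_carrier_def by blast
qed

text \<open>Acting by c_I moves the component at I to the empty set, with the scalar c_I^2 =
  \<open>merge_sign I I\<close>; the other sign comes from passing c_I through a map of parity k. So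
  f is determined by its components at the empty set, and the right-hand side is the formula used
  for \<open>induced_hom\<close>.\<close>

lemma hom_expand:
  assumes "x \<in> carr" "I \<subseteq> {1..n}" "y \<in> basis M"
  shows "f x (I, y) = merge_sign I I * (-1) ^ (k * card I) * f (pr k (cl_act I x)) ({}, y)"
proof -
  have "f (cl_act I x) ({}, y) = (-1) ^ (k * card I) * (f x (I, y) * merge_sign I I)"
    using hom_act_bvec[OF hc_basis_cl[OF assms(2)] assms(1)]
      act_tensor_apply[OF hc_basis_cl[OF assms(2)] assms(2,3), of "f x"]
    by (simp add: cl_act_def inv_sign_id u_id op_id assms(3))
  hence "merge_sign I I * (-1) ^ (k * card I) * f (cl_act I x) ({}, y) =
      f x (I, y) * (merge_sign I I * merge_sign I I) * ((-1) ^ (k * card I) * (-1) ^ (k * card I))"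
    by simp
  also have "\<dots> = f x (I, y)"
    by (simp add: merge_sign_square flip: power_mult_distrib)
  finally show ?thesis using hom_pr(1) cl_act_carrier assms by simp
qed

end

end

section \<open>The dimension of the space of homomorphisms\<close>

context hom_to_cl_tensor
begin

definition equivariant :: "('v \<Rightarrow> 'b \<Rightarrow> complex) \<Rightarrow> bool" where
  "equivariant \<psi> \<longleftrightarrow>
    (\<forall>x\<in>carr. \<forall>x'\<in>carr. \<psi> (x + x') = \<psi> x + \<psi> x') \<and>
    (\<forall>c. \<forall>x\<in>carr. \<psi> (smult D c x) = fscale c (\<psi> x)) \<and>
    (\<forall>\<sigma> x y. \<sigma> permutes {1..n} \<longrightarrow> x \<in> carr \<longrightarrow> y \<in> basis M \<longrightarrow>
       \<psi> (gp_act \<sigma> x) (op \<sigma> y) = u \<sigma> y * \<psi> x y)"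

text \<open>Frobenius reciprocity for \<open>Cl\<^sub>n \<otimes> M = Ind M\<close>: a homomorphism of parity \<open>k\<close> is determined by
  its \<open>c\<^sub>\<emptyset>\<close>-component \<open>\<psi>\<close>, an equivariant map supported on the part of degree \<open>k\<close>.\<close>

definition induced_hom :: "nat \<Rightarrow> ('v \<Rightarrow> 'b \<Rightarrow> complex) \<Rightarrow> 'v \<Rightarrow> nat set \<times> 'b \<Rightarrow> complex" where
  "induced_hom k \<psi> x = (\<lambda>(I, y). if x \<in> carr \<and> I \<subseteq> {1..n} \<and> y \<in> basis M
     then merge_sign I I * (-1) ^ (k * card I) * \<psi> (pr k (cl_act I x)) y else 0)"

lemma equivariant_zero: "equivariant \<psi> \<Longrightarrow> \<psi> 0 y = 0"
proof -
  assume "equivariant \<psi>"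
  hence "\<psi> (0 + 0) = \<psi> 0 + \<psi> 0" using zero_carrier unfolding equivariant_def by blast
  hence "\<psi> 0 = \<psi> 0 + \<psi> 0" by simp
  from fun_cong[OF this, of y] show ?thesis by simp
qed

text \<open>Both sides equal \<open>merge_sign K (sym_diff J K)\<close>: the left by
  multiplicativity in the second argument, the right by multiplicativity in the first. This is the
  sign identity that makes \<open>induced_hom\<close> compatible with c_J.\<close>

lemma merge_sign_shift:
  assumes "finite J" "finite K"
  shows "merge_sign K K * merge_sign K J = merge_sign J (sym_diff J K) * merge_sign (sym_diff J K) (sym_diff J K)"
proof -
  let ?L = "sym_diff J K"
  have L: "finite ?L" using assms by simp
  have K: "sym_diff J ?L = K" "sym_diff K J = ?L" by blast+
  have "merge_sign K K * merge_sign K J = merge_sign K ?L"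
    using merge_sign_sym_diff_right[OF assms(2,2,1)] K(2) by simp
  also have "\<dots> = merge_sign (sym_diff J ?L) ?L" by (simp only: K(1))
  also have "\<dots> = merge_sign J ?L * merge_sign ?L ?L"
    by (rule merge_sign_sym_diff_left[OF L assms(1) L])
  finally show ?thesis .
qed

lemma card_sym_diff_parity:
  assumes "finite J" "finite K"
  shows "even (card (sym_diff J K) + card J + card K)"
proof -
  have "card (sym_diff J K) = card (J - K) + card (K - J)"
    using assms by (intro card_Un_disjoint) auto
  moreover have "card J = card (J - K) + card (J \<inter> K)" "card K = card (K - J) + card (J \<inter> K)"
    using assms by (metis add.commute card_Int_Diff, metis Int_commute add.commute card_Int_Diff)
  ultimately show ?thesis by presburger
qed

lemma sym_diff_preimage:
  assumes "\<sigma> permutes {1..n}" "J \<subseteq> {1..n}" "K \<subseteq> {1..n}"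
  obtains L where "L \<subseteq> {1..n}" "\<sigma> ` L = sym_diff J K" "sym_diff J (\<sigma> ` L) = K"
proof -
  let ?L = "inv \<sigma> ` sym_diff J K"
  have "?L \<subseteq> inv \<sigma> ` {1..n}" using assms by (intro image_mono) blast
  also have "\<dots> = {1..n}" using assms by (intro permutes_image permutes_inv)
  finally have "?L \<subseteq> {1..n}" .
  moreover have "\<sigma> ` ?L = sym_diff J K"
    using permutes_surj[OF assms(1)] by (simp add: image_comp surj_iff)
  moreover have "sym_diff J (sym_diff J K) = K" by blast
  ultimately show thesis using that by metis
qed

text \<open>Both sides are compared at the basis element (K, z). On the right only L = \<sigma>^-1
  (\<open>sym_diff J K\<close>) and y = \<sigma>^-1 z contribute; on the left, c_K c_J \<sigma> is a
  multiple of \<sigma> c_L, and equivariance moves \<psi> past \<sigma>.\<close>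

lemma induced_hom_act_bvec:
  assumes \<psi>: "equivariant \<psi>" and k: "k \<in> {0, 1}"
    and g: "(J, \<sigma>) \<in> hc_basis n" and x: "x \<in> carr"
  shows "induced_hom k \<psi> (act D (bvec (J, \<sigma>)) x) =
     fscale ((-1) ^ (k * card J)) (act N (bvec (J, \<sigma>)) (induced_hom k \<psi> x))"
proof (rule ext, clarify)
  fix K z
  have \<sigma>: "\<sigma> permutes {1..n}" and J: "J \<subseteq> {1..n}" using g by (auto simp: hc_basis_def)
  have fin: "finite J" "finite A" if "A \<subseteq> {1..n}" for A using J that finite_subset by blast+
  let ?f = "induced_hom k \<psi>"
  show "?f (act D (bvec (J, \<sigma>)) x) (K, z) = fscale ((-1) ^ (k * card J)) (act N (bvec (J, \<sigma>)) (?f x)) (K, z)"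
  proof (cases "K \<subseteq> {1..n} \<and> z \<in> basis M")
    case True
    hence K: "K \<subseteq> {1..n}" and z: "z \<in> basis M" by auto
    obtain L where L: "L \<subseteq> {1..n}" "\<sigma> ` L = sym_diff J K" "sym_diff J (\<sigma> ` L) = K"
      using sym_diff_preimage[OF \<sigma> J K] .
    define y where "y = op (inv \<sigma>) z"
    have y: "y \<in> basis M" "op \<sigma> y = z"
      using op_in[OF permutes_inv[OF \<sigma>] z] op_inverse[OF \<sigma> z] by (auto simp: y_def)
    have KJ: "sym_diff K J = \<sigma> ` L" using L(2) by blast
    have cL: "card L = card (sym_diff J K)"
      using card_image[OF permutes_inj_on[OF \<sigma>], of L] L(2) by simp
    have fL: "finite L" "finite K" "finite J" using fin(2) L K J by auto
    have clL: "cl_act L x \<in> carr" using L(1) x by (rule cl_act_carrier)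
    have "cl_act K (act D (bvec (J, \<sigma>)) x) = smult D (merge_sign K J) (act D (bvec (\<sigma> ` L, \<sigma>)) x)"
      using cl_act_bvec[OF K g x] by (simp only: KJ)
    \<comment> \<open>The square of a sign is inserted: one factor is used up in rewriting
      c_(\<sigma> L) \<sigma> as \<sigma> c_L, the other survives and matches the sign in the action
      on the Clifford module.\<close>
    also have "act D (bvec (\<sigma> ` L, \<sigma>)) x = smult D (inv_sign \<sigma> L * inv_sign \<sigma> L) (act D (bvec (\<sigma> ` L, \<sigma>)) x)"
      by (simp add: inv_sign_square)
    also have "\<dots> = smult D (inv_sign \<sigma> L) (gp_act \<sigma> (cl_act L x))"
      by (simp add: gp_act_cl_act[OF \<sigma> L(1) x])
    finally have "cl_act K (act D (bvec (J, \<sigma>)) x) = smult D (merge_sign K J * inv_sign \<sigma> L) (gp_act \<sigma> (cl_act L x))"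
      by simp
    hence "pr k (cl_act K (act D (bvec (J, \<sigma>)) x)) =
        smult D (merge_sign K J * inv_sign \<sigma> L) (gp_act \<sigma> (pr k (cl_act L x)))"
      by (simp only: pr_smult[OF k gp_act_carrier[OF \<sigma> clL]] pr_gp_act[OF \<sigma> clL k])
    moreover have "gp_act \<sigma> (pr k (cl_act L x)) \<in> carr"
      by (intro gp_act_carrier \<sigma> pr_carrier k clL)
    ultimately have "\<psi> (pr k (cl_act K (act D (bvec (J, \<sigma>)) x))) z =
        merge_sign K J * inv_sign \<sigma> L * \<psi> (gp_act \<sigma> (pr k (cl_act L x))) (op \<sigma> y)"
      using \<psi> y(2) unfolding equivariant_def by simp
    also have "\<psi> (gp_act \<sigma> (pr k (cl_act L x))) (op \<sigma> y) = u \<sigma> y * \<psi> (pr k (cl_act L x)) y"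
      using \<psi> \<sigma> y(1) pr_carrier[OF k clL] unfolding equivariant_def by blast
    finally have lhs: "?f (act D (bvec (J, \<sigma>)) x) (K, z) = merge_sign K K * (-1) ^ (k * card K) *
        (merge_sign K J * inv_sign \<sigma> L * (u \<sigma> y * \<psi> (pr k (cl_act L x)) y))"
      using K z act_bvec_carrier[OF g x] by (simp add: induced_hom_def)
    have "act N (bvec (J, \<sigma>)) (?f x) (K, z) =
        ?f x (L, y) * inv_sign \<sigma> L * merge_sign J (\<sigma> ` L) * u \<sigma> y"
      using act_tensor_apply[OF g L(1) y(1), of "?f x"] by (simp only: L(3) y(2))
    also have "?f x (L, y) = merge_sign L L * (-1) ^ (k * card L) * \<psi> (pr k (cl_act L x)) y"
      using x L(1) y(1) by (simp add: induced_hom_def)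
    finally have rhs: "act N (bvec (J, \<sigma>)) (?f x) (K, z) =
        merge_sign L L * (-1) ^ (k * card L) * \<psi> (pr k (cl_act L x)) y * inv_sign \<sigma> L *
        merge_sign J (\<sigma> ` L) * u \<sigma> y" .
    \<comment> \<open>The square of c_L depends only on |L|, which is the cardinality of
      \<open>sym_diff J K\<close>; so \<open>merge_sign_shift\<close> applies.\<close>
    have "merge_sign L L = merge_sign (sym_diff J K) (sym_diff J K)"
      using fL cL by (simp add: merge_sign_diag)
    hence ms: "merge_sign K K * merge_sign K J = merge_sign J (\<sigma> ` L) * merge_sign L L"
      using merge_sign_shift[OF fL(3,2)] L(2) by simp
    have "even (card L + card J + card K)"
      using card_sym_diff_parity[OF fL(3,2)] by (simp only: cL)
    hence "even (k * card K) = even (k * card J + k * card L)" by auto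
    hence pw: "(-1 :: complex) ^ (k * card K) = (-1) ^ (k * card J) * (-1) ^ (k * card L)"
      unfolding power_add[symmetric] minus_one_power_iff by simp
    have "?f (act D (bvec (J, \<sigma>)) x) (K, z) =
        (merge_sign K K * merge_sign K J) * (-1) ^ (k * card K) * inv_sign \<sigma> L * u \<sigma> y *
          \<psi> (pr k (cl_act L x)) y"
      unfolding lhs by (simp only: mult_ac)
    also have "\<dots> = (-1) ^ (k * card J) * act N (bvec (J, \<sigma>)) (?f x) (K, z)"
      unfolding rhs ms pw by (simp only: mult_ac)
    finally show ?thesis by simp
  next
    case False
    have "act N (bvec (J, \<sigma>)) (?f x) (K, z) = 0"
    proof -
      have "bvec (sym_diff J (\<sigma> ` L), op \<sigma> y) (K, z) = 0" if "L \<subseteq> {1..n}" "y \<in> basis M" for L y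
      proof -
        have "\<sigma> ` L \<subseteq> {1..n}" using that \<sigma> by (metis image_mono permutes_image)
        hence "sym_diff J (\<sigma> ` L) \<subseteq> {1..n}" using J by blast
        thus ?thesis using False op_in[OF \<sigma> that(2)] unfolding bvec_def by auto
      qed
      thus ?thesis unfolding act_tensor_bvec[OF g] sum_fun_apply by (intro sum.neutral) auto
    qed
    moreover have "?f (act D (bvec (J, \<sigma>)) x) (K, z) = 0"
      using False by (auto simp: induced_hom_def)
    ultimately show ?thesis by simp
  qed
qed

lemma induced_hom_add:
  assumes "equivariant \<psi>" "k \<in> {0, 1}" "x \<in> carr" "x' \<in> carr"
  shows "induced_hom k \<psi> (x + x') = induced_hom k \<psi> x + induced_hom k \<psi> x'"
proof (rule ext, clarify)
  fix I y
  have c: "x + x' \<in> carr" using assms V.subspace_add[OF subspace_carrier] by blast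
  have *: "\<psi> (pr k (cl_act I (x + x'))) = \<psi> (pr k (cl_act I x)) + \<psi> (pr k (cl_act I x'))"
    if I: "I \<subseteq> {1..n}"
  proof -
    have "pr k (cl_act I (x + x')) = pr k (cl_act I x) + pr k (cl_act I x')"
      using assms I by (simp only: cl_act_add pr_add cl_act_carrier)
    thus ?thesis using assms pr_carrier[OF assms(2) cl_act_carrier[OF I]] unfolding equivariant_def by simp
  qed
  show "induced_hom k \<psi> (x + x') (I, y) = (induced_hom k \<psi> x + induced_hom k \<psi> x') (I, y)"
    using assms c * by (simp add: induced_hom_def algebra_simps)
qed

lemma induced_hom_smult:
  assumes "equivariant \<psi>" "k \<in> {0, 1}" "x \<in> carr"
  shows "induced_hom k \<psi> (smult D c x) = fscale c (induced_hom k \<psi> x)"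
proof (rule ext, clarify)
  fix I y
  have s: "smult D c x \<in> carr" using assms V.subspace_scale[OF subspace_carrier] by blast
  have *: "\<psi> (pr k (cl_act I (smult D c x))) = fscale c (\<psi> (pr k (cl_act I x)))"
    if I: "I \<subseteq> {1..n}"
  proof -
    have "pr k (cl_act I (smult D c x)) = smult D c (pr k (cl_act I x))"
      using assms I by (simp only: cl_act_smult pr_smult cl_act_carrier)
    thus ?thesis using assms pr_carrier[OF assms(2) cl_act_carrier[OF I]] unfolding equivariant_def by simp
  qed
  show "induced_hom k \<psi> (smult D c x) (I, y) = fscale c (induced_hom k \<psi> x) (I, y)"
    using assms s * by (simp add: induced_hom_def algebra_simps)
qed

text \<open>For homogeneous a of parity l, only those c_J \<sigma> with |J| of parity l have a
  nonzero coefficient, so the signs found for basis elements coincide and the rule extends linearly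
  to a.\<close>

lemma induced_hom_in_Hom:
  assumes \<psi>: "equivariant \<psi>" and k: "k \<in> {0, 1}"
  shows "induced_hom k \<psi> \<in> hc_Hom_part n D N k"
  unfolding hc_Hom_part_def mem_Collect_eq smult_tensor
proof (intro conjI ballI allI impI, goal_cases)
  case (1 x y)
  thus ?case using \<psi> k by (intro induced_hom_add)
next
  case (2 c x)
  thus ?case using \<psi> k by (intro induced_hom_smult)
next
  case (3 l x)
  have x: "x \<in> carr" using 3 part_subset by blast
  \<comment> \<open>Components at sets I of the wrong parity vanish: they involve the projection of
    the homogeneous x to the parity that it does not have.\<close>
  have 0: "\<psi> (pr k (cl_act I x)) y = 0"
    if I: "I \<subseteq> {1..n}" and ne: "card I mod 2 \<noteq> (k + l) mod 2" for I y
  proof -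
    have m: "(k + card I) mod 2 \<in> {0, 1}" by auto
    have "(k + card I) mod 2 \<noteq> l" using ne k 3(1) by auto presburger+
    hence "pr ((k + card I) mod 2) x = 0"
      using pr_part[OF m 3] by simp
    hence "pr k (cl_act I x) = 0"
      by (simp only: pr_cl_act[OF I x k] cl_act_zero[OF I])
    thus ?thesis using equivariant_zero[OF \<psi>] by simp
  qed
  show ?case
    unfolding part_tensor coord_space_def mem_Collect_eq
  proof (intro allI impI)
    fix p assume p: "p \<notin> {I \<in> Pow {1..n}. card I mod 2 = (k + l) mod 2} \<times> basis M"
    obtain I y where Iy: "p = (I, y)" by (cases p)
    show "induced_hom k \<psi> x p = 0"
    proof (cases "I \<subseteq> {1..n} \<and> y \<in> basis M")
      case True
      hence "\<psi> (pr k (cl_act I x)) y = 0" using p Iy by (intro 0) auto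
      thus ?thesis by (simp add: induced_hom_def Iy)
    qed (auto simp: induced_hom_def Iy)
  qed
next
  case (4 l a x)
  let ?f = "induced_hom k \<psi>"
  have fin: "finite (hc_basis n)" by (simp add: hc_basis_def finite_permutations)
  have a: "a \<in> coord_space (hc_basis n)" using 4(2) by (auto simp: hc_part_def coord_space_def)
  have c: "act D (bvec g) x \<in> carr" if "g \<in> hc_basis n" for g
    using that 4(3) by (rule act_bvec_carrier)
  have sum: "?f (\<Sum>g\<in>G. smult D (a g) (act D (bvec g) x)) =
      (\<Sum>g\<in>G. fscale (a g) (?f (act D (bvec g) x))) \<and> (\<Sum>g\<in>G. smult D (a g) (act D (bvec g) x)) \<in> carr"
    if "finite G" "G \<subseteq> hc_basis n" for G
    using that
  proof (induction G rule: finite_induct)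
    case empty
    have "?f 0 = ?f 0 + ?f 0" using induced_hom_add[OF \<psi> k zero_carrier zero_carrier] by simp
    hence "?f 0 = 0" by (metis add_cancel_right_right)
    thus ?case using zero_carrier by (simp only: sum.empty)
  next
    case (insert g G)
    have g: "act D (bvec g) x \<in> carr" using insert.prems c by blast
    have g': "smult D (a g) (act D (bvec g) x) \<in> carr"
      using g V.subspace_scale[OF subspace_carrier] by blast
    have IH: "?f (\<Sum>g\<in>G. smult D (a g) (act D (bvec g) x)) = (\<Sum>g\<in>G. fscale (a g) (?f (act D (bvec g) x)))"
      "(\<Sum>g\<in>G. smult D (a g) (act D (bvec g) x)) \<in> carr"
      using conjunct1[OF insert.IH] conjunct2[OF insert.IH] insert.prems by blast+
    show ?case
      by (simp only: sum.insert[OF insert.hyps] induced_hom_add[OF \<psi> k g' IH(2)]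
          induced_hom_smult[OF \<psi> k g] IH(1) V.subspace_add[OF subspace_carrier g' IH(2)] simp_thms)
  qed
  have "?f (act D a x) = (\<Sum>g\<in>hc_basis n. fscale (a g) (?f (act D (bvec g) x)))"
    unfolding act_sum[OF a 4(3)] using sum[OF fin order_refl] by (rule conjunct1)
  also have "\<dots> = (\<Sum>g\<in>hc_basis n. fscale ((-1) ^ (k * l)) (fscale (a g) (act N (bvec g) (?f x))))"
  proof (rule sum.cong[OF refl], clarify)
    fix J \<sigma> assume g: "(J, \<sigma>) \<in> hc_basis n"
    show "fscale (a (J, \<sigma>)) (?f (act D (bvec (J, \<sigma>)) x)) =
        fscale ((-1) ^ (k * l)) (fscale (a (J, \<sigma>)) (act N (bvec (J, \<sigma>)) (?f x)))"
    proof (cases "card J mod 2 = l")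
      case True
      hence "(-1 :: complex) ^ (k * card J) = (-1) ^ (k * l)"
        using minus_one_power_mult_mod_2[of k "card J"] by simp
      thus ?thesis using induced_hom_act_bvec[OF \<psi> k g 4(3)] by (simp add: fun_eq_iff)
    next
      case False
      hence "a (J, \<sigma>) = 0" using 4(2) g unfolding hc_part_def coord_space_def by auto
      thus ?thesis by (simp add: fun_eq_iff)
    qed
  qed
  also have "\<dots> = fscale ((-1) ^ (k * l)) (act N a (?f x))"
    unfolding act_tensor_sum[of a] by (simp add: fun_eq_iff sum_fun_apply sum_distrib_left)
  finally show ?case .
next
  case (5 x)
  thus ?case by (auto simp: induced_hom_def fun_eq_iff)
qed

text \<open>The average of \<open>e\<^sub>y \<otimes> b\<^sup>*\<close> over the group.\<close>

definition averaged :: "'v \<times> 'b \<Rightarrow> 'v \<Rightarrow> 'b \<Rightarrow> complex" where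
  "averaged = (\<lambda>(b, y) x y'. (\<Sum>\<sigma> | \<sigma> permutes {1..n}.
     if y' \<in> basis M \<and> op \<sigma> y' = y then u \<sigma> y' * coord (gp_act \<sigma> x) b else 0) / fact n)"

lemma averaged_equivariant: "equivariant (averaged (b, y))"
  unfolding equivariant_def
proof (intro conjI ballI allI impI, goal_cases)
  case (1 x x')
  thus ?case
    by (auto simp: averaged_def fun_eq_iff gp_act_add gp_act_carrier coord_add algebra_simps
        add_divide_distrib[symmetric] sum.distrib[symmetric] intro!: sum.cong)
next
  case (2 c x)
  thus ?case
    by (auto simp: averaged_def fun_eq_iff gp_act_smult gp_act_carrier coord_smult sum_distrib_left
        intro!: sum.cong)
next
  case (3 \<tau> x y')
  let ?G = "{\<sigma>. \<sigma> permutes {1..n}}"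
  let ?t = "\<lambda>\<sigma>. if op \<sigma> y' = y then u \<sigma> y' * coord (gp_act \<sigma> x) b else 0"
  note \<tau> = 3(1) and x = 3(2) and y' = 3(3)
  have bij: "bij_betw (\<lambda>\<sigma>. \<sigma> \<circ> \<tau>) ?G ?G"
  proof (rule bij_betw_byWitness[where f' = "\<lambda>\<sigma>. \<sigma> \<circ> inv \<tau>"])
    show "\<forall>\<sigma>\<in>?G. \<sigma> \<circ> \<tau> \<circ> inv \<tau> = \<sigma>" "\<forall>\<sigma>\<in>?G. \<sigma> \<circ> inv \<tau> \<circ> \<tau> = \<sigma>"
      by (simp_all only: comp_assoc permutes_inv_o[OF \<tau>] comp_id) simp_all
  qed (use \<tau> permutes_inv[OF \<tau>] in \<open>auto intro: permutes_compose\<close>)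
  have "averaged (b, y) (gp_act \<tau> x) (op \<tau> y') = (\<Sum>\<sigma>\<in>?G. u \<tau> y' * ?t (\<sigma> \<circ> \<tau>)) / fact n"
    unfolding averaged_def prod.case
  proof (intro arg_cong2[where f = "(/)"] sum.cong refl)
    fix \<sigma> assume "\<sigma> \<in> ?G"
    hence \<sigma>: "\<sigma> permutes {1..n}" by simp
    \<comment> \<open>The sign \<open>u \<tau> y'\<close> squares to 1 and is inserted twice: the
      cocycle rule absorbs one copy, and the other becomes the factor demanded by
      equivariance.\<close>
    have "u \<sigma> (op \<tau> y') = u \<sigma> (op \<tau> y') * (u \<tau> y' * u \<tau> y')" by (simp add: u_square)
    also have "\<dots> = u \<tau> y' * u (\<sigma> \<circ> \<tau>) y'" by (simp add: u_comp[OF \<sigma> \<tau> y'])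
    finally show "(if op \<tau> y' \<in> basis M \<and> op \<sigma> (op \<tau> y') = y
        then u \<sigma> (op \<tau> y') * coord (gp_act \<sigma> (gp_act \<tau> x)) b else 0) = u \<tau> y' * ?t (\<sigma> \<circ> \<tau>)"
      using op_in[OF \<tau> y'] op_comp[OF \<sigma> \<tau> y'] gp_act_gp_act[OF \<sigma> \<tau> x] by simp
  qed
  also have "(\<Sum>\<sigma>\<in>?G. u \<tau> y' * ?t (\<sigma> \<circ> \<tau>)) = (\<Sum>\<sigma>\<in>?G. u \<tau> y' * ?t \<sigma>)"
    by (rule sum.reindex_bij_betw[OF bij, where g = "\<lambda>\<sigma>. u \<tau> y' * ?t \<sigma>"])
  also have "\<dots> / fact n = u \<tau> y' * averaged (b, y) x y'"
    using y' by (simp add: averaged_def sum_distrib_left[symmetric])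
  finally show ?case .
qed

text \<open>The maps \<open>averaged p\<close> are averages of matrix units, and an equivariant
  \<phi> is its own average; so \<phi> expands with its matrix entries as coefficients. Each of the
  n! permutations contributes the same value \<open>\<phi> w y'\<close>.\<close>

lemma averaged_expand:
  assumes add: "\<And>x x'. x \<in> carr \<Longrightarrow> x' \<in> carr \<Longrightarrow> \<phi> (x + x') = \<phi> x + \<phi> x'"
    and smult: "\<And>c x. x \<in> carr \<Longrightarrow> \<phi> (smult D c x) = fscale c (\<phi> x)"
    and equiv: "\<And>\<sigma> x y. \<sigma> permutes {1..n} \<Longrightarrow> x \<in> carr \<Longrightarrow> y \<in> basis M \<Longrightarrow>
       \<phi> (gp_act \<sigma> x) (op \<sigma> y) = u \<sigma> y * \<phi> x y"
    and w: "w \<in> carr" and y': "y' \<in> basis M"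
  shows "(\<Sum>p\<in>lin_basis \<times> basis M. \<phi> (fst p) (snd p) * averaged p w y') = \<phi> w y'"
proof -
  let ?G = "{\<sigma>. \<sigma> permutes {1..n}}"
  have "(\<Sum>p\<in>lin_basis \<times> basis M. \<phi> (fst p) (snd p) * averaged p w y') =
    (\<Sum>p\<in>lin_basis \<times> basis M. \<Sum>\<sigma>\<in>?G. 
      (if op \<sigma> y' = snd p then u \<sigma> y' * coord (gp_act \<sigma> w) (fst p) * \<phi> (fst p) (snd p) else 0) / fact n)"
    using y' by (auto simp: averaged_def sum_divide_distrib sum_distrib_left split_def intro!: sum.cong)
  also have "\<dots> = (\<Sum>\<sigma>\<in>?G. (\<Sum>b\<in>lin_basis. \<Sum>y\<in>basis M.
      if op \<sigma> y' = y then u \<sigma> y' * coord (gp_act \<sigma> w) b * \<phi> b y else 0) / fact n)"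
    by (subst sum.swap) (simp add: sum.cartesian_product split_def sum_divide_distrib)
  also have "\<dots> = (\<Sum>\<sigma>\<in>?G. \<phi> w y' / fact n)"
  proof (rule sum.cong[OF refl])
    fix \<sigma> assume "\<sigma> \<in> ?G"
    hence \<sigma>: "\<sigma> permutes {1..n}" by simp
    have "(\<Sum>b\<in>lin_basis. \<Sum>y\<in>basis M.
        if op \<sigma> y' = y then u \<sigma> y' * coord (gp_act \<sigma> w) b * \<phi> b y else 0) =
      (\<Sum>b\<in>lin_basis. u \<sigma> y' * coord (gp_act \<sigma> w) b * \<phi> b (op \<sigma> y'))"
      using finite_basis op_in[OF \<sigma> y'] by simp
    also have "\<dots> = u \<sigma> y' * (\<Sum>b\<in>lin_basis. coord (gp_act \<sigma> w) b * \<phi> b (op \<sigma> y'))"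
      by (simp add: sum_distrib_left mult.assoc)
    also have "(\<Sum>b\<in>lin_basis. coord (gp_act \<sigma> w) b * \<phi> b (op \<sigma> y')) = \<phi> (gp_act \<sigma> w) (op \<sigma> y')"
      by (rule linear_expand[where T = "\<lambda>x. \<phi> x (op \<sigma> y')", symmetric])
         (simp_all add: add smult gp_act_carrier[OF \<sigma> w])
    also have "u \<sigma> y' * \<dots> = (u \<sigma> y' * u \<sigma> y') * \<phi> w y'" by (simp add: equiv[OF \<sigma> w y'])
    finally show "(\<Sum>b\<in>lin_basis. \<Sum>y\<in>basis M.
        if op \<sigma> y' = y then u \<sigma> y' * coord (gp_act \<sigma> w) b * \<phi> b y else 0) / fact n = \<phi> w y' / fact n"
      by (simp add: u_square)
  qed
  also have "\<dots> = \<phi> w y'"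
  proof -
    have "card ?G = fact n" by (rule card_permutations) auto
    thus ?thesis by (simp only: sum_constant of_nat_fact) simp
  qed
  finally show ?thesis .
qed

text \<open>\<open>dim_eq_sum_coordinates\<close> is applied to the projection that averages a
  linear map from D to M and extends the result to a homomorphism. Its trace, taken over the matrix
  units (b, y), is the average of the products of the traces on M and on D.\<close>

lemma dim_Hom_character:
  "of_nat (dim_Hom n D N) =
    (\<Sum>\<sigma> | \<sigma> permutes {1..n}. (\<Sum>y | y \<in> basis M \<and> op \<sigma> y = y. u \<sigma> y) * tr (gp_act \<sigma>)) / fact n"
proof -
  let ?X = "lin_basis \<times> basis M"
  define ev :: "'v \<times> 'b \<Rightarrow> ('v \<Rightarrow> nat set \<times> 'b \<Rightarrow> complex) \<Rightarrow> complex"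
    where "ev p f = f (fst p) ({}, snd p)" for p f
  \<comment> \<open>The extensions of both parities are added: \<open>induced_hom k\<close> sees
    only the part of D of parity k, so together their component at the empty set is
    \<open>averaged p\<close> on all of D.\<close>
  define E where "E p = induced_hom 0 (averaged p) + induced_hom 1 (averaged p)" for p
  have finX: "finite ?X" using lin_basis(3) finite_basis by simp
  have E_Hom: "E p \<in> hc_Hom n D N" for p
    unfolding E_def hc_Hom_def using induced_hom_in_Hom[OF averaged_equivariant]
    by (cases p) blast
  have expand: "f = (\<Sum>p\<in>?X. hom_scale (ev p f) (E p))" if f: "f \<in> hc_Hom n D N" for f
  proof -
    obtain f0 f1 where f01: "f0 \<in> hc_Hom_part n D N 0" "f1 \<in> hc_Hom_part n D N 1" "f = f0 + f1"
      using f unfolding hc_Hom_def by blast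
    have f0: "0 \<in> {0, 1 :: nat}" and f1: "1 \<in> {0, 1 :: nat}" by auto
    note f0 = f0 f01(1) and f1 = f1 f01(2)
    define \<phi> where "\<phi> x y = f x ({}, y)" for x y
    have \<phi>: "(\<Sum>p\<in>?X. \<phi> (fst p) (snd p) * averaged p w y') = \<phi> w y'"
      if "w \<in> carr" "y' \<in> basis M" for w y'
    proof (rule averaged_expand[OF _ _ _ that])
      fix x x' assume "x \<in> carr" "x' \<in> carr"
      thus "\<phi> (x + x') = \<phi> x + \<phi> x'"
        by (simp add: \<phi>_def f01(3) hom_add[OF f0] hom_add[OF f1] fun_eq_iff)
    next
      fix c x assume "x \<in> carr"
      thus "\<phi> (smult D c x) = fscale c (\<phi> x)"
        by (simp add: \<phi>_def f01(3) hom_smult[OF f0] hom_smult[OF f1] fun_eq_iff algebra_simps)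
    next
      fix \<sigma> x y assume "\<sigma> permutes {1..n}" "x \<in> carr" "y \<in> basis M"
      thus "\<phi> (gp_act \<sigma> x) (op \<sigma> y) = u \<sigma> y * \<phi> x y"
        by (simp add: \<phi>_def f01(3) hom_gp_act[OF f0] hom_gp_act[OF f1] algebra_simps)
    qed
    show ?thesis
    proof (rule ext, rule ext, clarify)
      fix x I y
      have "(\<Sum>p\<in>?X. hom_scale (ev p f) (E p)) x (I, y) = (\<Sum>p\<in>?X. \<phi> (fst p) (snd p) * E p x (I, y))"
        by (simp add: sum_fun_apply ev_def \<phi>_def)
      also have "\<dots> = f x (I, y)"
      proof (cases "x \<in> carr \<and> I \<subseteq> {1..n} \<and> y \<in> basis M")
        case True
        hence x: "x \<in> carr" and I: "I \<subseteq> {1..n}" and y: "y \<in> basis M" by auto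
        let ?w = "\<lambda>k. pr k (cl_act I x)" and ?s = "\<lambda>k. merge_sign I I * (-1) ^ (k * card I)"
        have cl: "cl_act I x \<in> carr" using I x by (rule cl_act_carrier)
        have w: "?w 0 \<in> carr" "?w 1 \<in> carr" using cl by (auto intro: pr_carrier)
        have "(\<Sum>p\<in>?X. \<phi> (fst p) (snd p) * E p x (I, y)) =
          ?s 0 * (\<Sum>p\<in>?X. \<phi> (fst p) (snd p) * averaged p (?w 0) y) +
          ?s 1 * (\<Sum>p\<in>?X. \<phi> (fst p) (snd p) * averaged p (?w 1) y)"
          using True by (simp add: E_def induced_hom_def sum_distrib_left sum.distrib[symmetric] algebra_simps)
        also have "\<dots> = ?s 0 * \<phi> (?w 0) y + ?s 1 * \<phi> (?w 1) y"
          by (simp only: \<phi>[OF w(1) y] \<phi>[OF w(2) y])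
        \<comment> \<open>By \<open>hom_pr\<close>, at the empty set only f0 is seen on the even
          part and only f1 on the odd part, so the cross terms vanish.\<close>
        also have "\<phi> (?w 0) y = f0 (?w 0) ({}, y)"
          using hom_pr(2)[OF f1 cl] by (simp add: \<phi>_def f01(3))
        also have "\<phi> (?w 1) y = f1 (?w 1) ({}, y)"
          using hom_pr(2)[OF f0 cl] by (simp add: \<phi>_def f01(3))
        also have "?s 0 * f0 (?w 0) ({}, y) + ?s 1 * f1 (?w 1) ({}, y) = f x (I, y)"
          using hom_expand[OF f0 x I y] hom_expand[OF f1 x I y] by (simp add: f01(3))
        finally show ?thesis .
      next
        case False
        hence "E p x (I, y) = 0" for p by (auto simp: E_def induced_hom_def)
        moreover have "f x (I, y) = 0"
        proof (cases "x \<in> carr")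
          case True
          with False have "f0 x (I, y) = 0" "f1 x (I, y) = 0"
            using tensor_apply_outside[OF hom_carrier[OF f0]] tensor_apply_outside[OF hom_carrier[OF f1]]
            by blast+
          thus ?thesis by (simp add: f01(3))
        next
          case False
          thus ?thesis using hom_outside[OF f0] hom_outside[OF f1] by (simp add: f01(3))
        qed
        ultimately show ?thesis by simp
      qed
      finally show "f x (I, y) = (\<Sum>p\<in>?X. hom_scale (ev p f) (E p)) x (I, y)" by simp
    qed
  qed
  have "of_nat (dim_Hom n D N) = (\<Sum>p\<in>?X. ev p (E p))"
    unfolding dim_Hom_eq
    by (rule H.dim_eq_sum_coordinates[OF subspace_hc_Hom finX _ _ E_Hom expand]) (simp_all add: ev_def)
  also have "\<dots> = (\<Sum>p\<in>?X. averaged p (fst p) (snd p))"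
  proof (rule sum.cong[OF refl])
    fix p assume "p \<in> ?X"
    then obtain b y where p: "p = (b, y)" "b \<in> lin_basis" "y \<in> basis M" by auto
    have b: "b \<in> carr" using lin_basis_carrier p by blast
    have "equivariant (averaged p)" using averaged_equivariant p(1) by blast
    hence "averaged p (pr 0 b + pr 1 b) = averaged p (pr 0 b) + averaged p (pr 1 b)"
      using pr_carrier b unfolding equivariant_def by blast
    hence "averaged p b y = averaged p (pr 0 b) y + averaged p (pr 1 b) y"
      by (simp only: pr_sum[OF b] plus_fun_apply)
    thus "ev p (E p) = averaged p (fst p) (snd p)"
      using b p by (simp add: ev_def E_def induced_hom_def cl_act_empty)
  qed
  also have "\<dots> = (\<Sum>\<sigma> | \<sigma> permutes {1..n}. (\<Sum>p\<in>?X.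
      if op \<sigma> (snd p) = snd p then u \<sigma> (snd p) * coord (gp_act \<sigma> (fst p)) (fst p) else 0)) / fact n"
    by (subst sum.swap) (auto simp: averaged_def split_def sum_divide_distrib intro!: sum.cong)
  also have "\<dots> = (\<Sum>\<sigma> | \<sigma> permutes {1..n}. (\<Sum>y | y \<in> basis M \<and> op \<sigma> y = y. u \<sigma> y) * tr (gp_act \<sigma>)) / fact n"
  proof (intro arg_cong2[where f = "(/)"] sum.cong refl)
    fix \<sigma>
    have "(\<Sum>p\<in>?X. if op \<sigma> (snd p) = snd p then u \<sigma> (snd p) * coord (gp_act \<sigma> (fst p)) (fst p) else 0)
      = (\<Sum>b\<in>lin_basis. \<Sum>y\<in>basis M. (if op \<sigma> y = y then u \<sigma> y else 0) * coord (gp_act \<sigma> b) b)"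
      unfolding sum.cartesian_product by (auto intro!: sum.cong)
    also have "\<dots> = (\<Sum>y\<in>basis M. if op \<sigma> y = y then u \<sigma> y else 0) * tr (gp_act \<sigma>)"
      unfolding tr_def by (subst sum.swap) (simp add: sum_product)
    also have "(\<Sum>y\<in>basis M. if op \<sigma> y = y then u \<sigma> y else 0) = (\<Sum>y | y \<in> basis M \<and> op \<sigma> y = y. u \<sigma> y)"
      using finite_basis by (intro sum.inter_filter[symmetric])
    finally show "(\<Sum>p\<in>?X. if op \<sigma> (snd p) = snd p then u \<sigma> (snd p) * coord (gp_act \<sigma> (fst p)) (fst p) else 0)
      = (\<Sum>y | y \<in> basis M \<and> op \<sigma> y = y. u \<sigma> y) * tr (gp_act \<sigma>)" .
  qed
  finally show ?thesis .
qed

end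

section \<open>Fixed points and orbits\<close>

lemma permutes_orbit_in_X: "\<sigma> permutes X \<Longrightarrow> x \<in> X \<Longrightarrow> y \<in> orbit \<sigma> x \<Longrightarrow> y \<in> X"
  by (rule subsetD[OF permutes_orbit_subset])

lemma size_multiset_sum: "size (\<Sum>x\<in>A. f x :: 'b multiset) = (\<Sum>x\<in>A. size (f x))"
  by (induction A rule: infinite_finite_induct) simp_all

lemma sum_over_orbits:
  fixes F :: "'a set \<Rightarrow> nat"
  assumes "\<sigma> permutes X" "finite X"
  shows "(\<Sum>x\<in>X. F (orbit \<sigma> x)) = (\<Sum>W\<in>orbit \<sigma> ` X. card W * F W)"
proof -
  have "(\<Sum>x\<in>X. F (orbit \<sigma> x)) = (\<Sum>W\<in>orbit \<sigma> ` X. \<Sum>x | x \<in> X \<and> orbit \<sigma> x = W. F (orbit \<sigma> x))"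
    using assms(2) by (rule sum.image_gen)
  also have "\<dots> = (\<Sum>W\<in>orbit \<sigma> ` X. card W * F W)"
  proof (rule sum.cong[OF refl])
    fix W assume W: "W \<in> orbit \<sigma> ` X"
    then obtain w where w: "w \<in> X" "W = orbit \<sigma> w" by auto
    have "{x. x \<in> X \<and> orbit \<sigma> x = W} = W"
    proof (intro equalityI subsetI)
      fix x assume "x \<in> {x. x \<in> X \<and> orbit \<sigma> x = W}"
      thus "x \<in> W" using permutes_self_in_orbit[OF assms, of x] by auto
    next
      fix x assume "x \<in> W"
      thus "x \<in> {x. x \<in> X \<and> orbit \<sigma> x = W}"
        using w permutes_orbit_in_X[OF assms(1) w(1)] permutes_orbit_eq[OF assms, of x w] by simp
    qed
    moreover have "(\<Sum>x | x \<in> X \<and> orbit \<sigma> x = W. F (orbit \<sigma> x)) = (\<Sum>x | x \<in> X \<and> orbit \<sigma> x = W. F W)"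
      by (intro sum.cong) auto
    ultimately show "(\<Sum>x | x \<in> X \<and> orbit \<sigma> x = W. F (orbit \<sigma> x)) = card W * F W" by simp
  qed
  finally show ?thesis .
qed

text \<open>Encodes fixed basis elements: a multiset fixed by \<sigma> is a multiplicity for each
  orbit (B all numbers), an invariant subset a value 0 or 1 for each orbit. An orbit W adds card W *
  f W to the size. Extensional functions are taken so that each choice is counted once.\<close>

definition orbit_functions :: "('a \<Rightarrow> 'a) \<Rightarrow> 'a set \<Rightarrow> nat set \<Rightarrow> nat \<Rightarrow> ('a set \<Rightarrow> nat) set" where
  "orbit_functions \<sigma> X B i = {f \<in> orbit \<sigma> ` X \<rightarrow>\<^sub>E B. (\<Sum>W\<in>orbit \<sigma> ` X. card W * f W) = i}"

lemma orbit_functions_ext: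
  assumes "f \<in> orbit_functions \<sigma> X B i" "g \<in> orbit_functions \<sigma> X B j"
    and "\<And>x. x \<in> X \<Longrightarrow> f (orbit \<sigma> x) = g (orbit \<sigma> x)"
  shows "f = g"
proof (rule PiE_ext)
  show "f \<in> orbit \<sigma> ` X \<rightarrow>\<^sub>E B" "g \<in> orbit \<sigma> ` X \<rightarrow>\<^sub>E B"
    using assms(1,2) by (simp_all add: orbit_functions_def)
qed (use assms(3) in auto)

lemma constant_on_orbit:
  assumes "\<And>x. F (\<sigma> x) = F x" "y \<in> orbit \<sigma> x"
  shows "F y = F x"
  using assms(2) by induction (simp_all add: assms(1))

text \<open>A function constant along \<sigma> descends to the orbits by evaluation at a chosen
  representative.\<close>

lemma constant_on_orbits_factor:
  assumes \<sigma>: "\<sigma> permutes X" "finite X" and F: "\<And>x. F (\<sigma> x) = F x" "\<And>x. x \<in> X \<Longrightarrow> F x \<in> B"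
  obtains f where "f \<in> orbit_functions \<sigma> X B (\<Sum>x\<in>X. F x)" "\<And>x. x \<in> X \<Longrightarrow> f (orbit \<sigma> x) = F x"
proof -
  define f where "f = restrict (\<lambda>W. F (SOME w. w \<in> W)) (orbit \<sigma> ` X)"
  have f: "f (orbit \<sigma> x) = F x" if "x \<in> X" for x
  proof -
    have "(SOME w. w \<in> orbit \<sigma> x) \<in> orbit \<sigma> x"
      using permutes_self_in_orbit[OF \<sigma>] by (rule someI)
    thus ?thesis using that constant_on_orbit[of F \<sigma>, OF F(1)] by (simp add: f_def)
  qed
  have "f \<in> orbit \<sigma> ` X \<rightarrow>\<^sub>E B"
  proof (rule PiE_I)
    fix W assume "W \<in> orbit \<sigma> ` X"
    thus "f W \<in> B" using f F(2) by auto
  qed (simp add: f_def)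
  moreover have "(\<Sum>W\<in>orbit \<sigma> ` X. card W * f W) = (\<Sum>x\<in>X. F x)"
    using f by (subst sum_over_orbits[OF \<sigma>, symmetric]) (intro sum.cong, auto)
  ultimately show thesis using that f by (simp add: orbit_functions_def)
qed

text \<open>A multiset is fixed exactly if its multiplicities are constant on orbits.\<close>

lemma card_fixed_multisets:
  assumes \<sigma>: "\<sigma> permutes X" "finite X"
  shows "card {m. (set_mset m \<subseteq> X \<and> size m = i) \<and> image_mset \<sigma> m = m} = card (orbit_functions \<sigma> X UNIV i)"
proof -
  let ?\<Phi> = "\<lambda>f. \<Sum>x\<in>X. replicate_mset (f (orbit \<sigma> x)) x"
  have inj: "inj \<sigma>" using permutes_inj[OF \<sigma>(1)] .
  have count_image: "count (image_mset \<sigma> m) (\<sigma> x) = count m x" for m x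
    using inj by (induction m) (auto simp: inj_eq)
  have cnt: "count (?\<Phi> f) y = (if y \<in> X then f (orbit \<sigma> y) else 0)" for f y
    using \<sigma>(2) by (simp add: count_sum)
  have "bij_betw ?\<Phi> (orbit_functions \<sigma> X UNIV i)
      {m. (set_mset m \<subseteq> X \<and> size m = i) \<and> image_mset \<sigma> m = m}"
    unfolding bij_betw_def
  proof
    show "inj_on ?\<Phi> (orbit_functions \<sigma> X UNIV i)"
    proof (rule inj_onI)
      fix f g assume f: "f \<in> orbit_functions \<sigma> X UNIV i" and g: "g \<in> orbit_functions \<sigma> X UNIV i"
        and eq: "?\<Phi> f = ?\<Phi> g"
      have "f (orbit \<sigma> x) = g (orbit \<sigma> x)" if "x \<in> X" for x
        using arg_cong[OF eq, of "\<lambda>m. count m x"] that by (simp only: cnt if_True)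
      with f g show "f = g" by (rule orbit_functions_ext)
    qed
    show "?\<Phi> ` orbit_functions \<sigma> X UNIV i = {m. (set_mset m \<subseteq> X \<and> size m = i) \<and> image_mset \<sigma> m = m}"
    proof (intro equalityI subsetI)
      fix m assume "m \<in> ?\<Phi> ` orbit_functions \<sigma> X UNIV i"
      then obtain f where f: "f \<in> orbit_functions \<sigma> X UNIV i" "m = ?\<Phi> f" by auto
      have "set_mset m \<subseteq> X"
      proof
        fix y assume "y \<in># m"
        hence "count m y \<noteq> 0" by simp
        thus "y \<in> X" unfolding f(2) cnt by (simp split: if_splits)
      qed
      moreover have "size m = i"
        using f(1) sum_over_orbits[OF \<sigma>, of f] by (simp add: f(2) size_multiset_sum orbit_functions_def)
      moreover have "image_mset \<sigma> m = m"
      proof (rule multiset_eqI)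
        fix z
        obtain x where x: "z = \<sigma> x" using permutes_surj[OF \<sigma>(1)] by (metis surjD)
        have "orbit \<sigma> (\<sigma> x) = orbit \<sigma> x" by (rule permutes_orbit_eq[OF \<sigma> orbit.base])
        thus "count (image_mset \<sigma> m) z = count m z"
          unfolding x count_image f(2) cnt using permutes_in_image[OF \<sigma>(1)] by simp
      qed
      ultimately show "m \<in> {m. (set_mset m \<subseteq> X \<and> size m = i) \<and> image_mset \<sigma> m = m}" by simp
    next
      fix m assume m: "m \<in> {m. (set_mset m \<subseteq> X \<and> size m = i) \<and> image_mset \<sigma> m = m}"
      have inv: "count m (\<sigma> x) = count m x" for x
        using count_image[of m x] m by simp
      obtain f where f: "f \<in> orbit_functions \<sigma> X UNIV (\<Sum>x\<in>X. count m x)"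
        "\<And>x. x \<in> X \<Longrightarrow> f (orbit \<sigma> x) = count m x"
        using constant_on_orbits_factor[OF \<sigma>, of "count m" UNIV] inv by blast
      have "(\<Sum>x\<in>X. count m x) = size m"
        using m \<sigma>(2) by (auto simp: size_multiset_overloaded_eq not_in_iff intro!: sum.mono_neutral_right)
      with f(1) m have "f \<in> orbit_functions \<sigma> X UNIV i" by simp
      moreover have "m = ?\<Phi> f"
      proof (rule multiset_eqI)
        fix y
        have "y \<in> X" if "count m y \<noteq> 0" using m that by (auto simp: count_eq_zero_iff)
        thus "count m y = count (?\<Phi> f) y" unfolding cnt using f(2) by (cases "y \<in> X") (simp, metis)
      qed
      ultimately show "m \<in> ?\<Phi> ` orbit_functions \<sigma> X UNIV i" by blast
    qed
  qed
  thus ?thesis by (simp add: bij_betw_same_card)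
qed

lemma card_fixed_subsets:
  assumes \<sigma>: "\<sigma> permutes X" "finite X"
  shows "card {I. (I \<subseteq> X \<and> card I = j) \<and> \<sigma> ` I = I} = card (orbit_functions \<sigma> X {0, 1} j)"
proof -
  let ?\<Psi> = "\<lambda>f. {x \<in> X. f (orbit \<sigma> x) = Suc 0}"
  have vals: "f (orbit \<sigma> x) \<in> {0, 1}" if "f \<in> orbit_functions \<sigma> X {0, 1} j" "x \<in> X" for f x
    using that by (auto simp: orbit_functions_def)
  have "bij_betw ?\<Psi> (orbit_functions \<sigma> X {0, 1} j) {I. (I \<subseteq> X \<and> card I = j) \<and> \<sigma> ` I = I}"
    unfolding bij_betw_def
  proof
    show "inj_on ?\<Psi> (orbit_functions \<sigma> X {0, 1} j)"
    proof (rule inj_onI)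
      fix f g assume f: "f \<in> orbit_functions \<sigma> X {0, 1} j" and g: "g \<in> orbit_functions \<sigma> X {0, 1} j"
        and eq: "?\<Psi> f = ?\<Psi> g"
      have "f (orbit \<sigma> x) = g (orbit \<sigma> x)" if "x \<in> X" for x
        using arg_cong[OF eq, of "\<lambda>m. x \<in> m"] that vals[OF f that] vals[OF g that] by auto
      with f g show "f = g" by (rule orbit_functions_ext)
    qed
    show "?\<Psi> ` orbit_functions \<sigma> X {0, 1} j = {I. (I \<subseteq> X \<and> card I = j) \<and> \<sigma> ` I = I}"
    proof (intro equalityI subsetI)
      fix I assume "I \<in> ?\<Psi> ` orbit_functions \<sigma> X {0, 1} j"
      then obtain f where f: "f \<in> orbit_functions \<sigma> X {0, 1} j" "I = ?\<Psi> f" by auto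
      have I: "I \<subseteq> X" "finite I" using f(2) \<sigma>(2) by auto
      have "card I = (\<Sum>x\<in>X. if f (orbit \<sigma> x) = Suc 0 then 1 else 0)"
        using \<sigma>(2) f(2) by (simp add: sum.If_cases Int_def)
      also have "\<dots> = (\<Sum>x\<in>X. f (orbit \<sigma> x))"
        using vals[OF f(1)] by (intro sum.cong) auto
      also have "\<dots> = j" using f(1) sum_over_orbits[OF \<sigma>, of f] by (simp add: orbit_functions_def)
      finally have "card I = j" .
      moreover have "\<sigma> ` I \<subseteq> I"
      proof
        fix z assume "z \<in> \<sigma> ` I"
        then obtain x where x: "z = \<sigma> x" "x \<in> I" by auto
        have "orbit \<sigma> (\<sigma> x) = orbit \<sigma> x" by (rule permutes_orbit_eq[OF \<sigma> orbit.base])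
        thus "z \<in> I" using x f(2) permutes_in_image[OF \<sigma>(1)] by simp
      qed
      hence "\<sigma> ` I = I" using I(2) permutes_inj_on[OF \<sigma>(1)] by (intro endo_inj_surj)
      ultimately show "I \<in> {I. (I \<subseteq> X \<and> card I = j) \<and> \<sigma> ` I = I}" using I by simp
    next
      fix I assume I: "I \<in> {I. (I \<subseteq> X \<and> card I = j) \<and> \<sigma> ` I = I}"
      have inv: "\<sigma> x \<in> I \<longleftrightarrow> x \<in> I" for x
        using I permutes_inj[OF \<sigma>(1)] by (metis (mono_tags, lifting) inj_image_mem_iff mem_Collect_eq)
      obtain f where f: "f \<in> orbit_functions \<sigma> X {0, 1} (\<Sum>x\<in>X. if x \<in> I then 1 else 0)"
        "\<And>x. x \<in> X \<Longrightarrow> f (orbit \<sigma> x) = (if x \<in> I then 1 else 0)"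
      proof (rule constant_on_orbits_factor[OF \<sigma>, of "\<lambda>x. if x \<in> I then 1 else 0" "{0, 1}"])
        show "(if \<sigma> x \<in> I then 1 else 0) = (if x \<in> I then 1 else 0 :: nat)" for x by (simp only: inv)
      qed auto
      have "(\<Sum>x\<in>X. if x \<in> I then 1 else 0 :: nat) = j"
        using I \<sigma>(2) by (auto simp: sum.If_cases Int_absorb1)
      with f(1) have "f \<in> orbit_functions \<sigma> X {0, 1} j" by simp
      moreover have "I = ?\<Psi> f" using I f(2) by auto
      ultimately show "I \<in> ?\<Psi> ` orbit_functions \<sigma> X {0, 1} j" by blast
    qed
  qed
  thus ?thesis by (simp add: bij_betw_same_card)
qed

text \<open>Here e lists the variables by their exponents of t and s. Attaching a variable to each
  orbit amounts to choosing its two exponents independently, so the count splits into one factor for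
  each tensor factor.\<close>

lemma card_pair_orbit_functions:
  fixes e :: "nat \<Rightarrow> nat \<times> nat"
  assumes e: "bij_betw e UNIV (A \<times> B)"
  shows "card {g \<in> orbit \<sigma> ` X \<rightarrow>\<^sub>E UNIV. (\<Sum>W\<in>orbit \<sigma> ` X. card W * fst (e (g W))) = i \<and>
       (\<Sum>W\<in>orbit \<sigma> ` X. card W * snd (e (g W))) = j} =
     card (orbit_functions \<sigma> X A i) * card (orbit_functions \<sigma> X B j)"
proof -
  let ?O = "orbit \<sigma> ` X"
  let ?G = "{g \<in> ?O \<rightarrow>\<^sub>E UNIV. (\<Sum>W\<in>?O. card W * fst (e (g W))) = i \<and>
       (\<Sum>W\<in>?O. card W * snd (e (g W))) = j}"
  let ?F = "\<lambda>g. (restrict (\<lambda>W. fst (e (g W))) ?O, restrict (\<lambda>W. snd (e (g W))) ?O)"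
  let ?T = "orbit_functions \<sigma> X A i \<times> orbit_functions \<sigma> X B j"
  have e_in: "e k \<in> A \<times> B" for k using e by (auto simp: bij_betw_def)
  have "bij_betw ?F ?G ?T"
    unfolding bij_betw_def
  proof
    show "inj_on ?F ?G"
    proof (rule inj_onI)
      fix g h assume g: "g \<in> ?G" and h: "h \<in> ?G" and eq: "?F g = ?F h"
      show "g = h"
      proof (rule PiE_ext)
        show "g \<in> ?O \<rightarrow>\<^sub>E UNIV" "h \<in> ?O \<rightarrow>\<^sub>E UNIV" using g h by simp_all
        fix W assume W: "W \<in> ?O"
        from eq have "fst (?F g) W = fst (?F h) W" "snd (?F g) W = snd (?F h) W" by simp_all
        hence "e (g W) = e (h W)" using W by (simp add: prod_eq_iff)
        thus "g W = h W" using e by (auto simp: bij_betw_def inj_on_def)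
      qed
    qed
    show "?F ` ?G = ?T"
    proof (intro equalityI subsetI)
      fix p assume "p \<in> ?F ` ?G"
      then obtain g where g: "g \<in> ?G" "p = ?F g" by auto
      have "fst (e k) \<in> A" "snd (e k) \<in> B" for k using e_in[of k] by auto
      thus "p \<in> ?T" using g by (auto simp: orbit_functions_def)
    next
      fix p assume "p \<in> ?T"
      then obtain f h where p: "p = (f, h)" "f \<in> orbit_functions \<sigma> X A i" "h \<in> orbit_functions \<sigma> X B j" by auto
      have fh: "f \<in> ?O \<rightarrow>\<^sub>E A" "h \<in> ?O \<rightarrow>\<^sub>E B" using p by (auto simp: orbit_functions_def)
      define g where "g = restrict (\<lambda>W. inv_into UNIV e (f W, h W)) ?O"
      have eg: "e (g W) = (f W, h W)" if "W \<in> ?O" for W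
      proof -
        have "(f W, h W) \<in> A \<times> B" using fh that by auto
        hence "e (inv_into UNIV e (f W, h W)) = (f W, h W)"
          using e by (simp add: bij_betw_inv_into_right)
        thus ?thesis using that by (simp add: g_def)
      qed
      have "?F g = (f, h)"
        using fh eg by (auto simp: fun_eq_iff restrict_def PiE_def extensional_def)
      moreover have "g \<in> ?G"
      proof -
        have "(\<Sum>W\<in>?O. card W * fst (e (g W))) = (\<Sum>W\<in>?O. card W * f W)"
          "(\<Sum>W\<in>?O. card W * snd (e (g W))) = (\<Sum>W\<in>?O. card W * h W)"
          using eg by (simp_all cong: sum.cong)
        thus ?thesis using p by (auto simp: orbit_functions_def g_def)
      qed
      ultimately show "p \<in> ?F ` ?G" using p(1) by (metis (no_types, lifting) image_eqI)
    qed
  qed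
  hence "card ?G = card ?T" by (rule bij_betw_same_card)
  thus ?thesis by (simp add: card_cartesian_product)
qed

section \<open>Monomials and scalars among the formal series\<close>

lemma mcoeff_Mfps [simp]: "mcoeff (Mfps f) = f"
  by (simp add: Mfps_inverse)

lemma mconst_simps [simp]: "mconst 0 = 0" "mconst 1 = 1"
  by (rule mfps_eqI, simp add: mconst_def zero_mfps.rep_eq one_mfps.rep_eq)+

lemma mcoeff_mconst_mult:
  fixes f :: "'x mfps"
  shows "mcoeff (mconst c * f) m = c * mcoeff f m"
proof -
  have "mcoeff (mconst c * f) m = (\<Sum>p\<in>{({#} :: 'x multiset, m)}. c * mcoeff f (snd p))"
    unfolding times_mfps.rep_eq mconst_def mcoeff_Mfps
    by (rule sum.mono_neutral_cong_right) (auto simp: finite_multiset_splits split: if_splits)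
  thus ?thesis by simp
qed

abbreviation monomial :: "'x multiset \<Rightarrow> 'x mfps" where
  "monomial m \<equiv> Mfps (bvec m)"

lemma monomial_mult: "monomial a * monomial b = monomial (a + b)"
proof (rule mfps_eqI)
  fix m :: "'a multiset"
  have "mcoeff (monomial a * monomial b) m = (\<Sum>p\<in>{(c, d). c + d = m}. if p = (a, b) then 1 else 0)"
    unfolding times_mfps.rep_eq mcoeff_Mfps by (intro sum.cong) (auto simp: bvec_def split: if_splits)
  also have "\<dots> = mcoeff (monomial (a + b)) m"
    using finite_multiset_splits[of m] by (auto simp: bvec_def)
  finally show "mcoeff (monomial a * monomial b) m = mcoeff (monomial (a + b)) m" .
qed

lemma monomial_empty: "monomial {#} = 1"
  by (rule mfps_eqI) (simp add: one_mfps.rep_eq bvec_def)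

lemma prod_mset_monomial: "(\<Prod>x\<in>#m. monomial {#f x#}) = monomial (image_mset f m)"
  by (induction m) (simp_all add: monomial_empty monomial_mult)

lemma prod_monomial: "(\<Prod>x\<in>A. monomial (f x)) = monomial (\<Sum>x\<in>A. f x)"
  by (induction A rule: infinite_finite_induct) (simp_all add: monomial_empty monomial_mult)

section \<open>Monomial representations\<close>

lemma perm_rep_bvec: "\<sigma> permutes {1..n} \<Longrightarrow> rho (perm_rep n) \<sigma> (bvec x) = bvec (\<sigma> x)"
  by (auto simp: perm_rep_def bvec_def fun_eq_iff permutes_inv_eq)

lemma linear_form_bvec:
  assumes "finite X" "x \<in> X"
  shows "linear_form X (bvec x) = monomial {#x#}"
proof -
  have "linear_form X (bvec x) = (\<Sum>y\<in>X. if y = x then monomial {#x#} else 0)"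
    unfolding linear_form_def by (intro sum.cong) (auto simp: bvec_def[of x])
  thus ?thesis using assms by simp
qed

lemma finite_multisets_of_size: "finite X \<Longrightarrow> finite {m. set_mset m \<subseteq> X \<and> size m = i}"
proof (rule finite_subset)
  show "{m. set_mset m \<subseteq> X \<and> size m = i} \<subseteq> mset ` {xs. set xs \<subseteq> X \<and> length xs = i}"
  proof
    fix m assume m: "m \<in> {m. set_mset m \<subseteq> X \<and> size m = i}"
    obtain xs where "m = mset xs" using ex_mset by metis
    with m show "m \<in> mset ` {xs. set xs \<subseteq> X \<and> length xs = i}" by auto
  qed
qed (simp add: finite_lists_length_eq)

lemma basis_sym_power: "basis (sym_power i (perm_rep n)) = {m. set_mset m \<subseteq> {1..n} \<and> size m = i}"
  by (simp add: sym_power_def perm_rep_def Let_def)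

lemma sym_power_monomial_rep:
  "monomial_rep n (sym_power i (perm_rep n)) image_mset (\<lambda>_ _. 1)"
proof
  show "finite (basis (sym_power i (perm_rep n)))"
    unfolding basis_sym_power by (rule finite_multisets_of_size) simp
next
  fix \<sigma> m assume \<sigma>: "\<sigma> permutes {1..n}" and m: "m \<in> basis (sym_power i (perm_rep n))"
  have "\<sigma> ` set_mset m \<subseteq> {1..n}"
    using m image_mono[of "set_mset m" "{1..n}" \<sigma>] permutes_image[OF \<sigma>] by (simp add: basis_sym_power)
  thus "image_mset \<sigma> m \<in> basis (sym_power i (perm_rep n))" using m by (simp add: basis_sym_power)
next
  fix \<sigma> m assume \<sigma>: "\<sigma> permutes {1..n}" and m: "m \<in> basis (sym_power i (perm_rep n))"
  let ?B = "basis (sym_power i (perm_rep n))"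
  have fin: "finite ?B" unfolding basis_sym_power by (rule finite_multisets_of_size) simp
  have mX: "set_mset m \<subseteq> {1..n}" using m by (simp add: basis_sym_power)
  have "rho (sym_power i (perm_rep n)) \<sigma> (bvec m) = (\<Sum>m'\<in>?B. fscale (bvec m m')
      (mcoeff (\<Prod>x\<in>#m'. linear_form {1..n} (rho (perm_rep n) \<sigma> (bvec x)))))"
    by (simp add: basis_sym_power) (simp add: sym_power_def Let_def perm_rep_def)
  also have "\<dots> = mcoeff (\<Prod>x\<in>#m. linear_form {1..n} (rho (perm_rep n) \<sigma> (bvec x)))"
    by (rule sum_fscale_bvec'[OF fin m])
  also have "(\<Prod>x\<in>#m. linear_form {1..n} (rho (perm_rep n) \<sigma> (bvec x))) = (\<Prod>x\<in>#m. monomial {#\<sigma> x#})"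
  proof (intro arg_cong[where f = prod_mset] image_mset_cong)
    fix x assume "x \<in># m"
    hence "\<sigma> x \<in> {1..n}" using mX permutes_in_image[OF \<sigma>] by blast
    thus "linear_form {1..n} (rho (perm_rep n) \<sigma> (bvec x)) = monomial {#\<sigma> x#}"
      by (simp only: perm_rep_bvec[OF \<sigma>] linear_form_bvec finite_atLeastAtMost)
  qed
  finally show "rho (sym_power i (perm_rep n)) \<sigma> (bvec m) = fscale 1 (bvec (image_mset \<sigma> m))"
    by (simp add: prod_mset_monomial fscale_def)
next
  fix \<sigma> \<tau> :: "nat \<Rightarrow> nat" and m
  show "image_mset (\<sigma> \<circ> \<tau>) m = image_mset \<sigma> (image_mset \<tau> m)"
    by (simp only: image_mset.compositionality)
qed simp_all

lemma ext_vec_bvec: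
  assumes "finite X" "x \<in> X"
  shows "ext_vec X (bvec x) = bvec {x}"
  unfolding ext_vec_def by (rule sum_fscale_bvec'[OF assms])

lemma wedge_bvec:
  assumes "finite X" "y \<in> X" "J \<subseteq> X" "y \<notin> J"
  shows "wedge X (bvec {y}) (fscale c (bvec J)) = fscale (c * merge_sign {y} J) (bvec (insert y J))"
proof -
  let ?T = "\<lambda>I J. if I \<inter> J = {} then fscale (c * merge_sign I J) (bvec (I \<union> J)) else 0"
  have "wedge X (bvec {y}) (fscale c (bvec J)) =
      (\<Sum>I\<in>Pow X. \<Sum>J'\<in>Pow X. fscale (bvec {y} I * bvec J J') (?T I J'))"
    unfolding wedge_def by (intro sum.cong refl) (auto simp: fun_eq_iff)
  also have "\<dots> = (\<Sum>I\<in>Pow X. fscale (bvec {y} I) (?T I J))"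
    using assms by (intro sum.cong refl sum_fscale_bvec) auto
  also have "\<dots> = ?T {y} J"
    using assms by (intro sum_fscale_bvec') auto
  finally show ?thesis using assms by simp
qed

lemma basis_ext_power: "basis (ext_power j (perm_rep n)) = {I. I \<subseteq> {1..n} \<and> card I = j}"
  by (simp add: ext_power_def perm_rep_def Let_def)

lemma ext_power_monomial_rep:
  "monomial_rep n (ext_power j (perm_rep n)) (`) inv_sign"
proof
  show fin: "finite (basis (ext_power j (perm_rep n)))"
    unfolding basis_ext_power by (rule finite_subset[of _ "Pow {1..n}"]) auto
  fix \<sigma> I assume \<sigma>: "\<sigma> permutes {1..n}" and I: "I \<in> basis (ext_power j (perm_rep n))"
  have finI: "finite I" using I finite_subset by (auto simp: basis_ext_power)
  have IX: "I \<subseteq> {1..n}" using I by (simp add: basis_ext_power)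
  have \<sigma>I: "\<sigma> ` I \<subseteq> {1..n}" using image_mono[OF IX, of \<sigma>] permutes_image[OF \<sigma>] by simp
  show "\<sigma> ` I \<in> basis (ext_power j (perm_rep n))"
    using I \<sigma>I card_image[OF permutes_inj_on[OF \<sigma>]] by (simp add: basis_ext_power)
  have "rho (ext_power j (perm_rep n)) \<sigma> (bvec I) = (\<Sum>I'\<in>basis (ext_power j (perm_rep n)). fscale (bvec I I')
      (foldr (wedge {1..n}) (map (\<lambda>x. ext_vec {1..n} (rho (perm_rep n) \<sigma> (bvec x))) (sorted_list_of_set I'))
        (bvec {})))"
    by (simp add: basis_ext_power) (simp add: ext_power_def Let_def perm_rep_def)
  also have "\<dots> = foldr (wedge {1..n}) (map (\<lambda>x. ext_vec {1..n} (rho (perm_rep n) \<sigma> (bvec x))) (sorted_list_of_set I)) (bvec {})"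
    by (rule sum_fscale_bvec'[OF fin I])
  also have "map (\<lambda>x. ext_vec {1..n} (rho (perm_rep n) \<sigma> (bvec x))) (sorted_list_of_set I) =
      map (\<lambda>x. bvec {\<sigma> x}) (sorted_list_of_set I)"
  proof (rule map_cong[OF refl])
    fix x assume "x \<in> set (sorted_list_of_set I)"
    hence "\<sigma> x \<in> {1..n}" using finI \<sigma>I by auto
    thus "ext_vec {1..n} (rho (perm_rep n) \<sigma> (bvec x)) = bvec {\<sigma> x}"
      by (simp only: perm_rep_bvec[OF \<sigma>] ext_vec_bvec finite_atLeastAtMost)
  qed
  also have "foldr (wedge {1..n}) (map (\<lambda>x. bvec {\<sigma> x}) (sorted_list_of_set I)) (bvec {}) =
      fscale (inv_sign \<sigma> (set (sorted_list_of_set I))) (bvec (\<sigma> ` set (sorted_list_of_set I)))"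
    by (rule foldr_singletons[where X = "{1..n}", OF wedge_bvec])
       (use finI \<sigma>I permutes_inj_on[OF \<sigma>] in simp_all)
  finally show "rho (ext_power j (perm_rep n)) \<sigma> (bvec I) = fscale (inv_sign \<sigma> I) (bvec (\<sigma> ` I))"
    using finI by simp
next
  fix \<sigma> \<tau> I assume *: "\<sigma> permutes {1..n}" "\<tau> permutes {1..n}" "I \<in> basis (ext_power j (perm_rep n))"
  have "finite I" using *(3) finite_subset by (auto simp: basis_ext_power)
  thus "inv_sign (\<sigma> \<circ> \<tau>) I = inv_sign \<sigma> (\<tau> ` I) * inv_sign \<tau> I"
    using *(1,2) permutes_inj_on by (intro inv_sign_comp) blast+
qed (auto simp: inv_sign_square)

lemma tensor_monomial_rep:
  assumes "monomial_rep n V op\<^sub>1 u\<^sub>1" "monomial_rep n W op\<^sub>2 u\<^sub>2"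
  shows "monomial_rep n (tensor_rep V W) (\<lambda>\<sigma>. map_prod (op\<^sub>1 \<sigma>) (op\<^sub>2 \<sigma>)) (\<lambda>\<sigma> p. u\<^sub>1 \<sigma> (fst p) * u\<^sub>2 \<sigma> (snd p))"
proof -
  interpret V: monomial_rep n V op\<^sub>1 u\<^sub>1 by fact
  interpret W: monomial_rep n W op\<^sub>2 u\<^sub>2 by fact
  have B: "basis (tensor_rep V W) = basis V \<times> basis W" by (simp add: tensor_rep_def)
  show ?thesis
  proof
    show "finite (basis (tensor_rep V W))" using V.finite_basis W.finite_basis by (simp add: B)
  next
    fix \<sigma> p assume "\<sigma> permutes {1..n}" "p \<in> basis (tensor_rep V W)"
    thus "map_prod (op\<^sub>1 \<sigma>) (op\<^sub>2 \<sigma>) p \<in> basis (tensor_rep V W)"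
      using V.op_in W.op_in unfolding B by (cases p) auto
  next
    fix p assume "p \<in> basis (tensor_rep V W)"
    thus "map_prod (op\<^sub>1 id) (op\<^sub>2 id) p = p" using V.op_id W.op_id unfolding B by (cases p) auto
  next
    fix \<sigma> \<tau> p assume *: "\<sigma> permutes {1..n}" "\<tau> permutes {1..n}" "p \<in> basis (tensor_rep V W)"
    obtain x y where p: "p = (x, y)" "x \<in> basis V" "y \<in> basis W" using *(3) B by auto
    show "map_prod (op\<^sub>1 (\<sigma> \<circ> \<tau>)) (op\<^sub>2 (\<sigma> \<circ> \<tau>)) p = map_prod (op\<^sub>1 \<sigma>) (op\<^sub>2 \<sigma>) (map_prod (op\<^sub>1 \<tau>) (op\<^sub>2 \<tau>) p)"
      by (simp only: p map_prod_simp V.op_comp[OF *(1,2) p(2)] W.op_comp[OF *(1,2) p(3)])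
    show "u\<^sub>1 (\<sigma> \<circ> \<tau>) (fst p) * u\<^sub>2 (\<sigma> \<circ> \<tau>) (snd p) =
       u\<^sub>1 \<sigma> (fst (map_prod (op\<^sub>1 \<tau>) (op\<^sub>2 \<tau>) p)) * u\<^sub>2 \<sigma> (snd (map_prod (op\<^sub>1 \<tau>) (op\<^sub>2 \<tau>) p)) * (u\<^sub>1 \<tau> (fst p) * u\<^sub>2 \<tau> (snd p))"
      by (simp only: p fst_conv snd_conv map_prod_simp V.u_comp[OF *(1,2) p(2)] W.u_comp[OF *(1,2) p(3)] mult_ac)
  next
    fix \<sigma> p
    have "u\<^sub>1 \<sigma> (fst p) * u\<^sub>2 \<sigma> (snd p) * (u\<^sub>1 \<sigma> (fst p) * u\<^sub>2 \<sigma> (snd p)) =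
      (u\<^sub>1 \<sigma> (fst p) * u\<^sub>1 \<sigma> (fst p)) * (u\<^sub>2 \<sigma> (snd p) * u\<^sub>2 \<sigma> (snd p))" by (simp only: mult_ac)
    thus "u\<^sub>1 \<sigma> (fst p) * u\<^sub>2 \<sigma> (snd p) * (u\<^sub>1 \<sigma> (fst p) * u\<^sub>2 \<sigma> (snd p)) = 1"
      by (simp only: V.u_square W.u_square mult_1)
  next
    fix \<sigma> p assume *: "\<sigma> permutes {1..n}" "p \<in> basis (tensor_rep V W)"
    obtain x y where p: "p = (x, y)" "x \<in> basis V" "y \<in> basis W" using *(2) B by auto
    have "rho (tensor_rep V W) \<sigma> (bvec p) = (\<Sum>q\<in>basis V \<times> basis W.
        fscale (bvec (x, y) q) (tensor (rho V \<sigma> (bvec (fst q))) (rho W \<sigma> (bvec (snd q)))))"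
      by (simp add: tensor_rep_def tensor_map_def split_def p)
    also have "\<dots> = tensor (rho V \<sigma> (bvec x)) (rho W \<sigma> (bvec y))"
      by (subst sum_fscale_bvec') (use p V.finite_basis W.finite_basis in auto)
    finally show "rho (tensor_rep V W) \<sigma> (bvec p) =
        fscale (u\<^sub>1 \<sigma> (fst p) * u\<^sub>2 \<sigma> (snd p)) (bvec (map_prod (op\<^sub>1 \<sigma>) (op\<^sub>2 \<sigma>) p))"
      by (simp only: V.rho_bvec[OF *(1) p(2)] W.rho_bvec[OF *(1) p(3)] tensor_fscale_bvec p(1)
          fst_conv snd_conv map_prod_simp)
  qed
qed

section \<open>Specialization\<close>

text \<open>Sets all variables outside V to 0. This is multiplicative, preserves the coefficients of
  monomials in V, and for finite V turns a power sum into a finite sum of monomials, so that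
  products of power sums can be expanded.\<close>

definition restrict_vars :: "'x set \<Rightarrow> 'x mfps \<Rightarrow> 'x mfps" where
  "restrict_vars V f = Mfps (\<lambda>m. if set_mset m \<subseteq> V then mcoeff f m else 0)"

lemma restrict_vars_one: "restrict_vars V 1 = 1"
  by (rule mfps_eqI) (auto simp: restrict_vars_def one_mfps.rep_eq)

lemma restrict_vars_mult: "restrict_vars V (f * g) = restrict_vars V f * restrict_vars V g"
proof (rule mfps_eqI)
  fix m
  show "mcoeff (restrict_vars V (f * g)) m = mcoeff (restrict_vars V f * restrict_vars V g) m"
  proof (cases "set_mset m \<subseteq> V")
    case True
    hence "set_mset a \<subseteq> V" "set_mset b \<subseteq> V" if "a + b = m" for a b using that by auto
    thus ?thesis using True
      unfolding restrict_vars_def times_mfps.rep_eq mcoeff_Mfps by (auto intro!: sum.cong)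
  next
    case False
    hence "\<not> set_mset a \<subseteq> V \<or> \<not> set_mset b \<subseteq> V" if "a + b = m" for a b using that by auto
    hence "(\<Sum>(a, b) | a + b = m. (if set_mset a \<subseteq> V then mcoeff f a else 0) *
        (if set_mset b \<subseteq> V then mcoeff g b else 0)) = 0"
      by (intro sum.neutral) auto
    thus ?thesis using False unfolding restrict_vars_def times_mfps.rep_eq mcoeff_Mfps by simp
  qed
qed

lemma restrict_vars_prod: "restrict_vars V (\<Prod>x\<in>A. f x) = (\<Prod>x\<in>A. restrict_vars V (f x))"
  by (induction A rule: infinite_finite_induct) (simp_all add: restrict_vars_one restrict_vars_mult)

lemma restrict_vars_powersum:
  assumes "finite V" "r > 0"
  shows "restrict_vars V (powersum r) = (\<Sum>x\<in>V. monomial (replicate_mset r x))"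
proof (rule mfps_eqI)
  fix m
  have inj: "replicate_mset r x = replicate_mset r y \<longleftrightarrow> x = y" for x y :: 'a
    using assms(2) by (metis count_replicate_mset neq0_conv)
  show "mcoeff (restrict_vars V (powersum r)) m = mcoeff (\<Sum>x\<in>V. monomial (replicate_mset r x)) m"
  proof (cases "\<exists>x. m = replicate_mset r x")
    case True
    then obtain x where x: "m = replicate_mset r x" by blast
    have "mcoeff (\<Sum>x\<in>V. monomial (replicate_mset r x)) m = (\<Sum>y\<in>V. if y = x then 1 else 0)"
      unfolding mcoeff_sum by (intro sum.cong) (auto simp: bvec_def x inj)
    thus ?thesis using assms by (auto simp: restrict_vars_def powersum_def x)
  next
    case False
    thus ?thesis by (auto simp: restrict_vars_def powersum_def mcoeff_sum bvec_def)
  qed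
qed

text \<open>Once the variables outside V are discarded, each factor is a finite sum, and expanding
  the product means choosing one variable \<open>g W\<close> for each factor.\<close>

lemma mcoeff_prod_powersum:
  assumes "finite A" "finite V" "\<And>W. W \<in> A \<Longrightarrow> r W > 0" "set_mset m \<subseteq> V"
  shows "mcoeff (\<Prod>W\<in>A. powersum (r W)) m =
    of_nat (card {g \<in> A \<rightarrow>\<^sub>E V. (\<Sum>W\<in>A. replicate_mset (r W) (g W)) = m})"
proof -
  have "mcoeff (\<Prod>W\<in>A. powersum (r W)) m = mcoeff (restrict_vars V (\<Prod>W\<in>A. powersum (r W))) m"
    using assms(4) by (simp add: restrict_vars_def)
  also have "restrict_vars V (\<Prod>W\<in>A. powersum (r W)) = (\<Prod>W\<in>A. \<Sum>x\<in>V. monomial (replicate_mset (r W) x))"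
    unfolding restrict_vars_prod using assms by (intro prod.cong refl restrict_vars_powersum)
  also have "\<dots> = (\<Sum>g\<in>A \<rightarrow>\<^sub>E V. monomial (\<Sum>W\<in>A. replicate_mset (r W) (g W)))"
    using assms(1,2) by (subst prod_sum_PiE) (simp_all add: prod_monomial)
  also have "mcoeff \<dots> m = (\<Sum>g\<in>A \<rightarrow>\<^sub>E V. if (\<Sum>W\<in>A. replicate_mset (r W) (g W)) = m then 1 else 0)"
    unfolding mcoeff_sum by (intro sum.cong) (auto simp: bvec_def)
  also have "\<dots> = of_nat (card {g \<in> A \<rightarrow>\<^sub>E V. (\<Sum>W\<in>A. replicate_mset (r W) (g W)) = m})"
    using assms(1,2) by (simp add: sum.If_cases finite_PiE Int_def)
  finally show ?thesis .
qed

text \<open>The exponents of t and s in the specialization of the monomial m, when the variable k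
  has the exponents \<open>e k\<close>.\<close>

definition weight :: "(nat \<Rightarrow> nat \<times> nat) \<Rightarrow> nat multiset \<Rightarrow> nat \<times> nat" where
  "weight e m = (\<Sum>k\<in>#m. fst (e k), \<Sum>k\<in>#m. snd (e k))"

lemma nth_prod_mset_vars:
  assumes y: "\<And>k. y k = tvar ^ fst (e k) * svar ^ snd (e k)"
  shows "fps_nth (fps_nth (\<Prod>k\<in>#m. y k) i) j = (if weight e m = (i, j) then 1 else 0)"
proof -
  have "(\<Prod>k\<in>#m. y k) = tvar ^ fst (weight e m) * svar ^ snd (weight e m)"
    by (induction m) (simp_all add: weight_def y power_add mult_ac del: fps_const_power)
  also have "\<dots> = fps_X ^ fst (weight e m) * fps_const (fps_X ^ snd (weight e m))"
    by (simp only: fps_const_power)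
  finally show ?thesis by (auto simp: prod_eq_iff)
qed

text \<open>Fixing the size n makes this set finite for injective e: with (i, j) alone, arbitrarily
  many copies of a variable with exponents (0, 0), which is specialized to 1, could be
  added.\<close>

definition weight_set :: "(nat \<Rightarrow> nat \<times> nat) \<Rightarrow> nat \<Rightarrow> nat \<Rightarrow> nat \<Rightarrow> nat multiset set" where
  "weight_set e n i j = {m. size m = n \<and> weight e m = (i, j)}"

lemma weight_set_vars:
  assumes "m \<in> weight_set e n i j"
  shows "set_mset m \<subseteq> {k. fst (e k) \<le> i \<and> snd (e k) \<le> j}"
proof
  fix k assume "k \<in># m"
  then obtain m' where "m = add_mset k m'" by (meson multi_member_split)
  thus "k \<in> {k. fst (e k) \<le> i \<and> snd (e k) \<le> j}"
    using assms by (auto simp: weight_set_def weight_def)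
qed

lemma finite_small_vars:
  fixes e :: "nat \<Rightarrow> nat \<times> nat"
  assumes "inj e"
  shows "finite {k. fst (e k) \<le> i \<and> snd (e k) \<le> j}"
proof (rule finite_subset)
  show "{k. fst (e k) \<le> i \<and> snd (e k) \<le> j} \<subseteq> e -` ({..i} \<times> {..j})" by (auto simp: mem_Times_iff)
  show "finite (e -` ({..i} \<times> {..j}))" by (intro finite_vimageI[OF _ assms] finite_cartesian_product finite_atMost)
qed

lemma finite_weight_set:
  assumes "inj e"
  shows "finite (weight_set e n i j)"
proof (rule finite_subset[OF _ finite_multisets_of_size[OF finite_small_vars[OF assms, of i j], of n]], rule subsetI)
  fix m assume "m \<in> weight_set e n i j"
  thus "m \<in> {m. set_mset m \<subseteq> {k. fst (e k) \<le> i \<and> snd (e k) \<le> j} \<and> size m = n}"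
    using weight_set_vars[of m e n i j] by (simp add: weight_set_def)
qed

text \<open>By homogeneity the support of the sum in \<open>mfps_eval\<close> lies in a finite
  \<open>weight_set\<close>, so that the sum has its intended value and not the default 0 of an
  infinite sum.\<close>

lemma mfps_eval_homogeneous:
  assumes y: "\<And>k. y k = tvar ^ fst (e k) * svar ^ snd (e k)" and e: "inj e"
    and f: "\<And>m. size m \<noteq> n \<Longrightarrow> mcoeff f m = 0"
  shows "fps_nth (fps_nth (mfps_eval f y) i) j = (\<Sum>m\<in>weight_set e n i j. mcoeff f m)"
proof -
  have "fps_nth (fps_nth (mfps_eval f y) i) j =
      (\<Sum>m | mcoeff f m * (if weight e m = (i, j) then 1 else 0) \<noteq> 0. mcoeff f m * (if weight e m = (i, j) then 1 else 0))"
    by (simp only: mfps_eval_def fps_nth_Abs_fps nth_prod_mset_vars[OF y])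
  also have "\<dots> = (\<Sum>m\<in>weight_set e n i j. mcoeff f m)"
    by (rule sum.mono_neutral_cong_left[OF finite_weight_set[OF e]])
       (use f in \<open>auto simp: weight_set_def split: if_splits\<close>)
  finally show ?thesis .
qed

lemma weight_replicate_sum:
  "weight e (\<Sum>W\<in>A. replicate_mset (r W) (g W)) =
     (\<Sum>W\<in>A. r W * fst (e (g W)), \<Sum>W\<in>A. r W * snd (e (g W)))"
proof -
  have add: "weight e (m + m') = (fst (weight e m) + fst (weight e m'), snd (weight e m) + snd (weight e m'))" for m m'
    by (simp add: weight_def)
  have rep: "weight e (replicate_mset r k) = (r * fst (e k), r * snd (e k))" for r k
    by (simp add: weight_def)
  show ?thesis
    by (induction A rule: infinite_finite_induct) (simp_all add: add rep, simp_all add: weight_def)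
qed

text \<open>A choice of variables for the factors determines its monomial, so the counts for the
  single monomials add up. Since r W > 0, every chosen variable occurs in the monomial, and the
  bounds i and j on the exponents confine it to the finite set ?V.\<close>

lemma sum_mcoeff_prod_powersum:
  assumes A: "finite A" and r: "\<And>W. W \<in> A \<Longrightarrow> r W > 0" and e: "inj e" and n: "(\<Sum>W\<in>A. r W) = n"
  shows "(\<Sum>m\<in>weight_set e n i j. mcoeff (\<Prod>W\<in>A. powersum (r W)) m) =
    of_nat (card {g \<in> A \<rightarrow>\<^sub>E UNIV. (\<Sum>W\<in>A. r W * fst (e (g W))) = i \<and> (\<Sum>W\<in>A. r W * snd (e (g W))) = j})"
proof -
  let ?V = "{k. fst (e k) \<le> i \<and> snd (e k) \<le> j}"
  let ?m = "\<lambda>g. \<Sum>W\<in>A. replicate_mset (r W) (g W)"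
  let ?G = "\<lambda>m. {g \<in> A \<rightarrow>\<^sub>E ?V. ?m g = m}"
  have V: "finite ?V" by (rule finite_small_vars[OF e])
  have "(\<Sum>m\<in>weight_set e n i j. mcoeff (\<Prod>W\<in>A. powersum (r W)) m) =
      of_nat (\<Sum>m\<in>weight_set e n i j. card (?G m))"
    unfolding of_nat_sum
    by (intro sum.cong refl mcoeff_prod_powersum A V r weight_set_vars)
  also have "(\<Sum>m\<in>weight_set e n i j. card (?G m)) = card (\<Union>m\<in>weight_set e n i j. ?G m)"
    using finite_weight_set[OF e] A V by (intro card_UN_disjoint[symmetric]) (auto simp: finite_PiE)
  also have "(\<Union>m\<in>weight_set e n i j. ?G m) =
      {g \<in> A \<rightarrow>\<^sub>E UNIV. (\<Sum>W\<in>A. r W * fst (e (g W))) = i \<and> (\<Sum>W\<in>A. r W * snd (e (g W))) = j}"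
  proof -
    have size: "size (?m g) = n" for g
      unfolding n[symmetric] by (induction A rule: infinite_finite_induct) simp_all
    have "g \<in> A \<rightarrow>\<^sub>E ?V" if "g \<in> A \<rightarrow>\<^sub>E UNIV" "?m g \<in> weight_set e n i j" for g
    proof (rule PiE_I)
      fix W assume W: "W \<in> A"
      have "?m g = replicate_mset (r W) (g W) + (\<Sum>W\<in>A - {W}. replicate_mset (r W) (g W))"
        using A W by (rule sum.remove)
      hence "g W \<in># ?m g" using r[OF W] by simp
      thus "g W \<in> ?V" using weight_set_vars[OF that(2)] by blast
    qed (use that(1) in \<open>auto simp: PiE_def extensional_def\<close>)
    moreover have "?m g \<in> weight_set e n i j \<longleftrightarrow>
        (\<Sum>W\<in>A. r W * fst (e (g W))) = i \<and> (\<Sum>W\<in>A. r W * snd (e (g W))) = j" for g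
      unfolding weight_set_def mem_Collect_eq size weight_replicate_sum by simp
    ultimately show ?thesis by (auto simp: PiE_def)
  qed
  finally show ?thesis .
qed

section \<open>The characteristic map\<close>

context hom_to_cl_tensor
begin

text \<open>A cycle W of even length is an invariant set on which \<sigma> has sign (-1)^(|W| - 1) =
  -1, so c_W anticommutes with \<sigma> and \<open>tr_eq_0\<close> applies.\<close>

lemma tr_not_odd:
  assumes \<sigma>: "\<sigma> permutes {1..n}" and "cycle_type n \<sigma> \<notin> odd_partitions n"
  shows "tr (gp_act \<sigma>) = 0"
proof -
  \<comment> \<open>The orbit sizes always add up to n, so the type fails to be an odd partition
    only through an even part.\<close>
  have "\<Sum>\<^sub># (cycle_type n \<sigma>) = n"
    using sum_orbit_sizes[OF \<sigma>] by (simp add: cycle_type_orbit_sizes)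
  then obtain x where x: "x \<in> {1..n}" "even (card (orbit \<sigma> x))"
    using assms(2) by (auto simp: odd_partitions_def cycle_type_def)
  show ?thesis
  proof (rule tr_eq_0[OF \<sigma>])
    show "orbit \<sigma> x \<subseteq> {1..n}" using permutes_orbit_subset[OF \<sigma> x(1)] .
    show "\<sigma> ` orbit \<sigma> x = orbit \<sigma> x" by (rule permutes_image_orbit[OF \<sigma>]) simp
    have "card (orbit \<sigma> x) > 0" using orbit_enum(3)[OF \<sigma>] by simp
    hence "odd (card (orbit \<sigma> x) - 1)" using x(2) by simp
    thus "inv_sign \<sigma> (orbit \<sigma> x) = -1" by (simp add: inv_sign_orbit[OF \<sigma>])
  qed
qed

text \<open>In odd classes the signs at fixed basis elements are 1 by \<open>u1\<close>, so the
  trace on M is a plain count; a conjugating \<pi> carries fixed elements to fixed elements. The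
  other classes drop out by \<open>tr_not_odd\<close>.\<close>

lemma dim_Hom_odd_classes:
  assumes u1: "\<And>\<sigma> y. \<sigma> permutes {1..n} \<Longrightarrow> cycle_type n \<sigma> \<in> odd_partitions n \<Longrightarrow>
      y \<in> basis M \<Longrightarrow> op \<sigma> y = y \<Longrightarrow> u \<sigma> y = 1"
  shows "of_nat (dim_Hom n D N) =
    (\<Sum>\<alpha>\<in>odd_partitions n. of_nat (card {y \<in> basis M. op (perm_of_type n \<alpha>) y = y}) *
       tr (gp_act (perm_of_type n \<alpha>)) / of_nat (zee \<alpha>))"
proof -
  let ?fix = "\<lambda>\<sigma>. {y \<in> basis M. op \<sigma> y = y}"
  let ?F = "\<lambda>\<sigma>. (\<Sum>y\<in>?fix \<sigma>. u \<sigma> y) * tr (gp_act \<sigma>)"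
  have F: "?F \<sigma> = of_nat (card (?fix \<sigma>)) * tr (gp_act \<sigma>)"
    if "\<sigma> permutes {1..n}" "cycle_type n \<sigma> \<in> odd_partitions n" for \<sigma>
    using u1[OF that] by simp
  have "of_nat (dim_Hom n D N) = (\<Sum>\<sigma> | \<sigma> permutes {1..n}. ?F \<sigma>) / fact n"
    by (rule dim_Hom_character)
  also have "\<dots> = (\<Sum>\<alpha>\<in>odd_partitions n. ?F (perm_of_type n \<alpha>) / of_nat (zee \<alpha>))"
  proof (rule sum_class_function)
    fix \<sigma> \<tau> \<pi>
    assume *: "\<sigma> permutes {1..n}" "\<tau> permutes {1..n}" "\<pi> permutes {1..n}" "\<pi> \<circ> \<sigma> = \<tau> \<circ> \<pi>"
      "cycle_type n \<sigma> \<in> odd_partitions n" "cycle_type n \<tau> = cycle_type n \<sigma>"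
    have "bij_betw (op \<pi>) (?fix \<sigma>) (?fix \<tau>)"
      unfolding bij_betw_def
    proof
      show "inj_on (op \<pi>) (?fix \<sigma>)" using op_eq_iff[OF *(3)] by (auto intro: inj_onI)
      have fix_iff: "op \<tau> (op \<pi> y) = op \<pi> y \<longleftrightarrow> op \<sigma> y = y" if y: "y \<in> basis M" for y
      proof -
        have "op \<tau> (op \<pi> y) = op \<pi> (op \<sigma> y)"
          using op_comp[OF *(2,3) y] op_comp[OF *(3,1) y] by (simp only: *(4))
        thus ?thesis using op_eq_iff[OF *(3) op_in[OF *(1) y] y] by simp
      qed
      show "op \<pi> ` ?fix \<sigma> = ?fix \<tau>"
      proof (intro equalityI subsetI)
        fix z assume "z \<in> op \<pi> ` ?fix \<sigma>"
        thus "z \<in> ?fix \<tau>" using fix_iff op_in[OF *(3)] by auto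
      next
        fix z assume z: "z \<in> ?fix \<tau>"
        let ?y = "op (inv \<pi>) z"
        have "?y \<in> basis M" "op \<pi> ?y = z"
          using z op_in[OF permutes_inv[OF *(3)]] op_inverse[OF *(3)] by auto
        thus "z \<in> op \<pi> ` ?fix \<sigma>" using z fix_iff[of ?y] by (intro image_eqI[of _ _ ?y]) auto
      qed
    qed
    hence "card (?fix \<sigma>) = card (?fix \<tau>)" by (rule bij_betw_same_card)
    moreover have "cycle_type n \<tau> \<in> odd_partitions n" using *(5,6) by simp
    ultimately show "?F \<sigma> = ?F \<tau>"
      using F[OF *(1,5)] F[OF *(2)] by (simp only: tr_conjugate[OF *(1-4)])
  next
    fix \<sigma> assume "\<sigma> permutes {1..n}" "cycle_type n \<sigma> \<notin> odd_partitions n"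
    thus "?F \<sigma> = 0" using tr_not_odd by simp
  qed
  also have "\<dots> = (\<Sum>\<alpha>\<in>odd_partitions n. of_nat (card (?fix (perm_of_type n \<alpha>))) *
       tr (gp_act (perm_of_type n \<alpha>)) / of_nat (zee \<alpha>))"
    using perm_of_type F by (intro sum.cong refl) simp
  finally show ?thesis .
qed

text \<open>The common form of both claims. A and B are the ranges of the exponents of t and s: all
  numbers for a symmetric power, 0 and 1 for an exterior power. \<open>fixed\<close> translates
  fixed basis elements into exponents attached to the cycles, and \<open>e\<close> translates these
  into variables.\<close>

lemma dim_Hom_eq_specialization:
  assumes u1: "\<And>\<sigma> y. \<sigma> permutes {1..n} \<Longrightarrow> cycle_type n \<sigma> \<in> odd_partitions n \<Longrightarrow>
      y \<in> basis M \<Longrightarrow> op \<sigma> y = y \<Longrightarrow> u \<sigma> y = 1"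
    and fixed: "\<And>\<sigma>. \<sigma> permutes {1..n} \<Longrightarrow> card {y \<in> basis M. op \<sigma> y = y} =
      card (orbit_functions \<sigma> {1..n} A i) * card (orbit_functions \<sigma> {1..n} B j)"
    and e: "bij_betw e UNIV (A \<times> B)" and y: "\<And>k. y k = tvar ^ fst (e k) * svar ^ snd (e k)"
    and ch: "ch_minus n D = mconst c * q" and c: "c \<noteq> 0"
  shows "of_nat (dim_Hom n D N) = c * fps_nth (fps_nth (mfps_eval q y) i) j"
proof -
  let ?p = "\<lambda>\<alpha>. \<Prod>i\<in>#\<alpha>. powersum i :: nat mfps"
  let ?t = "\<lambda>\<alpha>. tr (gp_act (perm_of_type n \<alpha>)) / of_nat (zee \<alpha>)"
  have inj: "inj e" using e by (simp add: bij_betw_def)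
  have p: "finite (orbit \<sigma> ` {1..n}) \<and> (\<forall>W\<in>orbit \<sigma> ` {1..n}. card W > 0) \<and>
      (\<Sum>W\<in>orbit \<sigma> ` {1..n}. card W) = n \<and> ?p \<alpha> = (\<Prod>W\<in>orbit \<sigma> ` {1..n}. powersum (card W))"
    if \<alpha>: "\<alpha> \<in> odd_partitions n" and \<sigma>: "\<sigma> = perm_of_type n \<alpha>" for \<alpha> \<sigma>
  proof -
    have \<sigma>p: "\<sigma> permutes {1..n}" and \<alpha>': "\<alpha> = orbit_sizes {1..n} \<sigma>"
      using perm_of_type[OF \<alpha>] \<sigma> by (simp_all add: cycle_type_orbit_sizes)
    have "?p \<alpha> = (\<Prod>W\<in>orbit \<sigma> ` {1..n}. powersum (card W))"
      unfolding \<alpha>' orbit_sizes_def prod_unfold_prod_mset image_mset.compositionality comp_def ..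
    moreover have "(\<Sum>W\<in>orbit \<sigma> ` {1..n}. card W) = n"
      using sum_orbit_sizes[OF \<sigma>p] by (simp add: orbit_sizes_def sum_unfold_sum_mset)
    moreover have "\<forall>W\<in>orbit \<sigma> ` {1..n}. card W > 0"
      using orbit_enum(3)[OF \<sigma>p] by auto
    ultimately show ?thesis by simp
  qed
  have mc: "c * mcoeff q m = (\<Sum>\<alpha>\<in>odd_partitions n. ?t \<alpha> * mcoeff (?p \<alpha>) m)" for m
  proof -
    have "c * mcoeff q m = mcoeff (ch_minus n D) m" by (simp add: ch mcoeff_mconst_mult)
    also have "\<dots> = (\<Sum>\<alpha>\<in>odd_partitions n. ?t \<alpha> * mcoeff (?p \<alpha>) m)"
      by (simp add: ch_minus_def mcoeff_sum mcoeff_mconst_mult trace_on_eq_tr gp_act_def)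
    finally show ?thesis .
  qed
  \<comment> \<open>Each \<alpha> has total n, so every monomial of p_\<alpha> has degree n. The
    characteristic inherits this, and so does q because c is not 0.\<close>
  have homogeneous: "mcoeff q m = 0" if m: "size m \<noteq> n" for m
  proof -
    have "mcoeff (?p \<alpha>) m = 0" if \<alpha>: "\<alpha> \<in> odd_partitions n" for \<alpha>
    proof -
      let ?O = "orbit (perm_of_type n \<alpha>) ` {1..n}"
      note P = p[OF \<alpha> refl]
      have "size (\<Sum>W\<in>?O. replicate_mset (card W) (g W)) = n" for g :: "nat set \<Rightarrow> nat"
        using P by (simp add: size_multiset_sum)
      hence none: "{g \<in> ?O \<rightarrow>\<^sub>E set_mset m. (\<Sum>W\<in>?O. replicate_mset (card W) (g W)) = m} = {}"
        using m by blast
      have "mcoeff (\<Prod>W\<in>?O. powersum (card W)) m =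
          of_nat (card {g \<in> ?O \<rightarrow>\<^sub>E set_mset m. (\<Sum>W\<in>?O. replicate_mset (card W) (g W)) = m})"
        by (rule mcoeff_prod_powersum) (use P in auto)
      with P show ?thesis by (simp only: none card.empty of_nat_0)
    qed
    hence "c * mcoeff q m = 0" unfolding mc by (intro sum.neutral) simp
    thus ?thesis using c by simp
  qed
  have "c * fps_nth (fps_nth (mfps_eval q y) i) j = (\<Sum>m\<in>weight_set e n i j. c * mcoeff q m)"
    by (simp only: mfps_eval_homogeneous[OF y inj homogeneous] sum_distrib_left)
  also have "\<dots> = (\<Sum>\<alpha>\<in>odd_partitions n. ?t \<alpha> * (\<Sum>m\<in>weight_set e n i j. mcoeff (?p \<alpha>) m))"
    unfolding mc by (subst sum.swap) (simp only: sum_distrib_left)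
  also have "\<dots> = (\<Sum>\<alpha>\<in>odd_partitions n. of_nat (card {y \<in> basis M. op (perm_of_type n \<alpha>) y = y}) *
       tr (gp_act (perm_of_type n \<alpha>)) / of_nat (zee \<alpha>))"
  proof (rule sum.cong[OF refl])
    fix \<alpha> assume \<alpha>: "\<alpha> \<in> odd_partitions n"
    let ?\<sigma> = "perm_of_type n \<alpha>"
    let ?O = "orbit ?\<sigma> ` {1..n}"
    note P = p[OF \<alpha> refl]
    have "(\<Sum>m\<in>weight_set e n i j. mcoeff (?p \<alpha>) m) =
        of_nat (card {g \<in> ?O \<rightarrow>\<^sub>E UNIV. (\<Sum>W\<in>?O. card W * fst (e (g W))) = i \<and>
          (\<Sum>W\<in>?O. card W * snd (e (g W))) = j})"
      unfolding P[THEN conjunct2, THEN conjunct2, THEN conjunct2]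
      by (rule sum_mcoeff_prod_powersum) (use P inj in auto)
    also have "\<dots> = of_nat (card {y \<in> basis M. op ?\<sigma> y = y})"
      using fixed[of ?\<sigma>] perm_of_type[OF \<alpha>] by (simp only: card_pair_orbit_functions[OF e])
    finally show "?t \<alpha> * (\<Sum>m\<in>weight_set e n i j. mcoeff (?p \<alpha>) m) =
       of_nat (card {y \<in> basis M. op ?\<sigma> y = y}) * tr (gp_act ?\<sigma>) / of_nat (zee \<alpha>)"
      by simp
  qed
  also have "\<dots> = of_nat (dim_Hom n D N)" by (rule dim_Hom_odd_classes[OF u1, symmetric])
  finally show ?thesis by simp
qed

lemma dim_Hom_empty: "basis M = {} \<Longrightarrow> dim_Hom n D N = 0"
  using dim_Hom_character by simp

end

lemma hom_to_cl_tensorI: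
  "hc_module n D \<Longrightarrow> sm_finite_dim D \<Longrightarrow> monomial_rep n M op u \<Longrightarrow> hom_to_cl_tensor n D M op u"
  by (simp add: hom_to_cl_tensor_def hom_to_cl_tensor_axioms_def)

text \<open>The exponents of t and s in the k-th variable of \<open>vars_t_st\<close>. The exponent
  of s is at most 1, just as a subset contains each cycle at most once.\<close>

definition st_exponents :: "nat \<Rightarrow> nat \<times> nat" where
  "st_exponents k = (case sum_decode k of Inl p \<Rightarrow> (p, 0) | Inr p \<Rightarrow> (p, 1))"

lemma bij_st_exponents: "bij_betw st_exponents UNIV (UNIV \<times> {0, 1})"
  by (rule bij_betw_byWitness[where f' = "\<lambda>(p, b). sum_encode (if b = 0 then Inl p else Inr p)"])
     (auto simp: st_exponents_def split: sum.splits, metis sum_decode_inverse, metis sum_decode_inverse)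

lemma vars_t_st_exponents:
  "vars_t_st k = tvar ^ fst (st_exponents k) * svar ^ snd (st_exponents k)"
  by (simp add: vars_t_st_def st_exponents_def mult.commute split: sum.splits)

lemma vars_ts_exponents:
  "vars_ts k = tvar ^ fst (prod_decode k) * svar ^ snd (prod_decode k)"
  by (simp add: vars_ts_def split: prod.splits)

lemma bij_prod_decode': "bij_betw prod_decode UNIV (UNIV \<times> UNIV)"
  using bij_prod_decode by simp

lemma card_fixed_sym_power:
  assumes "\<sigma> permutes {1..n}"
  shows "card {m \<in> basis (sym_power i (perm_rep n)). image_mset \<sigma> m = m} =
    card (orbit_functions \<sigma> {1..n} UNIV i)"
  using card_fixed_multisets[OF assms, of i] by (simp add: basis_sym_power)

lemma card_fixed_ext_power:
  assumes "\<sigma> permutes {1..n}"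
  shows "card {I \<in> basis (ext_power j (perm_rep n)). \<sigma> ` I = I} =
    card (orbit_functions \<sigma> {1..n} {0, 1} j)"
  using card_fixed_subsets[OF assms, of j] by (simp add: basis_ext_power)

lemma card_fixed_tensor:
  "card {p \<in> basis (tensor_rep V W). map_prod f g p = p} =
    card {x \<in> basis V. f x = x} * card {y \<in> basis W. g y = y}"
proof -
  have "{p \<in> basis (tensor_rep V W). map_prod f g p = p} = {x \<in> basis V. f x = x} \<times> {y \<in> basis W. g y = y}"
    by (auto simp: tensor_rep_def)
  thus ?thesis by (simp add: card_cartesian_product)
qed

theorem theorem5p11:
  fixes n :: nat and \<xi> :: "nat list" and D :: "'v::ab_group_add supermodule"
  assumes "n \<ge> 1" and "strict_partition n \<xi>" and "is_D n \<xi> D"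
  shows "d_hat n D =
           fps_const (fps_const (two_factor \<xi>)) * mfps_eval (schurQ \<xi>) vars_t_st \<and>
         d_tilde n D =
           fps_const (fps_const (two_factor \<xi>)) * mfps_eval (schurQ \<xi>) vars_ts"
proof
  have D: "hc_module n D" "sm_finite_dim D"
    and ch: "ch_minus n D = mconst (two_factor \<xi>) * schurQ \<xi>"
    using assms(3) by (auto simp: is_D_def hc_irreducible_def)
  have c: "two_factor \<xi> \<noteq> 0" by (simp add: two_factor_def)
  let ?S = "\<lambda>i. sym_power i (perm_rep n)" and ?E = "\<lambda>j. ext_power j (perm_rep n)"
  note hom = hom_to_cl_tensorI[OF D]
  have hat: "of_nat (dim_Hom n D (cl_tensor n (tensor_rep (?S i) (?E j)))) =
      two_factor \<xi> * fps_nth (fps_nth (mfps_eval (schurQ \<xi>) vars_t_st) i) j" for i j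
  proof (rule hom_to_cl_tensor.dim_Hom_eq_specialization
      [OF hom[OF tensor_monomial_rep[OF sym_power_monomial_rep ext_power_monomial_rep]]
        _ _ bij_st_exponents vars_t_st_exponents ch c])
    fix \<sigma> p assume \<sigma>: "\<sigma> permutes {1..n}" "cycle_type n \<sigma> \<in> odd_partitions n"
      and p: "p \<in> basis (tensor_rep (?S i) (?E j))" "map_prod (image_mset \<sigma>) ((`) \<sigma>) p = p"
    have "finite (snd p)" "\<sigma> ` snd p = snd p"
      using p finite_subset[of "snd p" "{1..n}"] by (auto simp: tensor_rep_def basis_ext_power prod_eq_iff)
    moreover have "\<forall>i\<in>#orbit_sizes {1..n} \<sigma>. odd i"
      using \<sigma>(2) by (simp add: odd_partitions_def cycle_type_orbit_sizes)
    ultimately show "1 * inv_sign \<sigma> (snd p) = 1"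
      using inv_sign_orbits_odd[OF \<sigma>(1)] by simp
  next
    fix \<sigma> assume "\<sigma> permutes {1..n}"
    thus "card {p \<in> basis (tensor_rep (?S i) (?E j)). map_prod (image_mset \<sigma>) ((`) \<sigma>) p = p} =
        card (orbit_functions \<sigma> {1..n} UNIV i) * card (orbit_functions \<sigma> {1..n} {0, 1} j)"
      by (simp only: card_fixed_tensor card_fixed_sym_power card_fixed_ext_power)
  qed
  \<comment> \<open>The sum over j in \<open>d_hat\<close> stops at n, while the specialization has
    coefficients for every j; beyond n the exterior power has an empty basis, and \<open>hat\<close>
    then makes those coefficients 0 too.\<close>
  have hat_0: "dim_Hom n D (cl_tensor n (tensor_rep (?S i) (?E j))) = 0" if "j > n" for i j
  proof (rule hom_to_cl_tensor.dim_Hom_empty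
      [OF hom[OF tensor_monomial_rep[OF sym_power_monomial_rep ext_power_monomial_rep]]])
    have "card I \<noteq> j" if "I \<subseteq> {1..n}" for I
      using card_mono[OF _ that] \<open>j > n\<close> by simp
    hence "basis (?E j) = {}" unfolding basis_ext_power by blast
    thus "basis (tensor_rep (?S i) (?E j)) = {}" by (simp add: tensor_rep_def)
  qed
  have tilde: "of_nat (dim_Hom n D (cl_tensor n (tensor_rep (?S i) (?S j)))) =
      two_factor \<xi> * fps_nth (fps_nth (mfps_eval (schurQ \<xi>) vars_ts) i) j" for i j
  proof (rule hom_to_cl_tensor.dim_Hom_eq_specialization
      [OF hom[OF tensor_monomial_rep[OF sym_power_monomial_rep sym_power_monomial_rep]]
        _ _ bij_prod_decode' vars_ts_exponents ch c])
    fix \<sigma> assume "\<sigma> permutes {1..n}"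
    thus "card {p \<in> basis (tensor_rep (?S i) (?S j)). map_prod (image_mset \<sigma>) (image_mset \<sigma>) p = p} =
        card (orbit_functions \<sigma> {1..n} UNIV i) * card (orbit_functions \<sigma> {1..n} UNIV j)"
      by (simp only: card_fixed_tensor card_fixed_sym_power)
  \<comment> \<open>What remains is that the signs on the tensor product of two symmetric powers are
    1 * 1 = 1.\<close>
  qed simp
  show "d_hat n D = fps_const (fps_const (two_factor \<xi>)) * mfps_eval (schurQ \<xi>) vars_t_st"
  proof (rule fps_ext, rule fps_ext)
    fix i j
    have "fps_nth (fps_nth (d_hat n D) i) j =
        (\<Sum>k = 0..n. if k = j then of_nat (dim_Hom n D (cl_tensor n (tensor_rep (?S i) (?E j)))) else 0)"
      unfolding d_hat_def fps_nth_Abs_fps fps_sum_nth by (intro sum.cong) auto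
    also have "\<dots> = of_nat (dim_Hom n D (cl_tensor n (tensor_rep (?S i) (?E j))))"
      using hat_0[of j i] by simp
    finally show "fps_nth (fps_nth (d_hat n D) i) j =
        fps_nth (fps_nth (fps_const (fps_const (two_factor \<xi>)) * mfps_eval (schurQ \<xi>) vars_t_st) i) j"
      by (simp add: hat)
  qed
  show "d_tilde n D = fps_const (fps_const (two_factor \<xi>)) * mfps_eval (schurQ \<xi>) vars_ts"
    by (rule fps_ext, rule fps_ext) (simp add: d_tilde_def tilde)
qed

end
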